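(* Let $M$ be an $F$-structure manifold of degree $K$. The following conditions are equivalent, where each of the identities (ii)–(iv) is required for all vector fields $X,Y$ on $M$: (i) $D_m$ is integrable; (ii) $N_l(mX,mY)=0$; (iii) $N_F(mX,mY)=0$; (iv) $l\,N_F(mX,mY)=0$.
   Context: An $F$-structure manifold of degree $K$ is a smooth $n$-dimensional manifold $M$ with a nonzero smooth $(1,1)$-tensor field $F$ of constant rank $r$ satisfying $\alpha F^{K+1}+\beta F^{K}+F=0$, where $K\ge 3$ is an integer and $\alpha,\beta$ are real or complex numbers (polynomials in $F$ with complex coefficients are regarded as endomorphisms of the complexified tangent bundle). Put $l=-(\alpha F^{K}+\beta F^{K-1})$ and $m=I+\alpha F^{K}+\beta F^{K-1}$; $D_l=\mathrm{Im}\,l$ and $D_m=\mathrm{Im}\,m$ are complementary distributions of dimensions $r$ and $n-r$. For a $(1,1)$-tensor field $T$, the Nijenhuis tensor is $N_T(X,Y)=[TX,TY]-T[TX,Y]-T[X,TY]+T^2[X,Y]$. A distribution $D$ is integrable if through each point of $M$ there is an integral manifold of $D$ (equivalently, by Frobenius, $D$ is involutive). *)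

theory Defs
  imports "HOL-Analysis.Analysis"
begin

section \<open>Smooth maps\<close>

(* On an open set S, k_times_differentiable k f S says that f has continuous iterated directional
   derivatives up to order k, i.e. that f is C^k. *)
primrec k_times_differentiable ::
  "nat \<Rightarrow> ('e::real_normed_vector \<Rightarrow> 'f::real_normed_vector) \<Rightarrow> 'e set \<Rightarrow> bool" where
  "k_times_differentiable 0 f S \<longleftrightarrow> continuous_on S f"
| "k_times_differentiable (Suc k) f S \<longleftrightarrow>
     (\<forall>x\<in>S. f differentiable (at x)) \<and>
     (\<forall>v. k_times_differentiable k (\<lambda>x. frechet_derivative f (at x) v) S)"

definition smooth_on ::
  "'e set \<Rightarrow> ('e::real_normed_vector \<Rightarrow> 'f::real_normed_vector) \<Rightarrow> bool" where
  "smooth_on S f \<longleftrightarrow> (\<forall>k. k_times_differentiable k f S)"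


section \<open>Smooth manifolds\<close>

(* A chart is a pair (U, phi) with U open in M and phi a homeomorphism of U onto an open subset of
   R^n; the values of phi outside U are irrelevant. The manifold M is the whole type 'a, and its
   dimension n is CARD('n). *)
type_synonym ('a, 'n) chart = "'a set \<times> ('a \<Rightarrow> real^'n)"

definition is_chart :: "('a::topological_space, 'n::finite) chart \<Rightarrow> bool" where
  "is_chart c \<longleftrightarrow> open (fst c) \<and> open (snd c ` fst c) \<and>
     (\<exists>g. homeomorphism (fst c) (snd c ` fst c) (snd c) g)"

definition transition :: "('a, 'n::finite) chart \<Rightarrow> ('a, 'n) chart \<Rightarrow> real^'n \<Rightarrow> real^'n" where
  "transition c d = snd d \<circ> inv_into (fst c) (snd c)"

definition smoothly_compatible :: "('a, 'n::finite) chart \<Rightarrow> ('a, 'n) chart \<Rightarrow> bool" where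
  "smoothly_compatible c d \<longleftrightarrow>
     smooth_on (snd c ` (fst c \<inter> fst d)) (transition c d) \<and>
     smooth_on (snd d ` (fst c \<inter> fst d)) (transition d c)"

(* A smooth structure is a maximal smooth atlas. *)
definition smooth_structure :: "('a::topological_space, 'n::finite) chart set \<Rightarrow> bool" where
  "smooth_structure A \<longleftrightarrow>
     (\<forall>c\<in>A. is_chart c) \<and> (\<Union>c\<in>A. fst c) = UNIV \<and>
     (\<forall>c\<in>A. \<forall>d\<in>A. smoothly_compatible c d) \<and>
     (\<forall>c. is_chart c \<and> (\<forall>d\<in>A. smoothly_compatible c d) \<longrightarrow> c \<in> A)"


section \<open>Vector fields and (1,1)-tensor fields\<close>

(* Vector fields and tensor fields are given by their components in all charts of the smooth
   structure: X c x is the value at the point with coordinates x in the chart c. Values at x outside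
   the image of c are irrelevant. *)
type_synonym ('a, 'n) vfield = "('a, 'n) chart \<Rightarrow> real^'n \<Rightarrow> real^'n"
type_synonym ('a, 'n) cvfield = "('a, 'n) chart \<Rightarrow> real^'n \<Rightarrow> complex^'n"
type_synonym ('a, 'n) tfield = "('a, 'n) chart \<Rightarrow> real^'n \<Rightarrow> real^'n \<Rightarrow> real^'n"
type_synonym ('a, 'n) ctfield = "('a, 'n) chart \<Rightarrow> real^'n \<Rightarrow> complex^'n \<Rightarrow> complex^'n"

definition smooth_vector_field ::
  "('a, 'n::finite) chart set \<Rightarrow> ('a, 'n) vfield \<Rightarrow> bool" where
  "smooth_vector_field A X \<longleftrightarrow>
     (\<forall>c\<in>A. smooth_on (snd c ` fst c) (X c)) \<and>
     (\<forall>c\<in>A. \<forall>d\<in>A. \<forall>x\<in>snd c ` (fst c \<inter> fst d).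
        X d (transition c d x) = frechet_derivative (transition c d) (at x) (X c x))"

definition smooth_tensor_field ::
  "('a, 'n::finite) chart set \<Rightarrow> ('a, 'n) tfield \<Rightarrow> bool" where
  "smooth_tensor_field A F \<longleftrightarrow>
     (\<forall>c\<in>A. \<forall>x\<in>snd c ` fst c. linear (F c x)) \<and>
     (\<forall>c\<in>A. \<forall>v. smooth_on (snd c ` fst c) (\<lambda>x. F c x v)) \<and>
     (\<forall>c\<in>A. \<forall>d\<in>A. \<forall>x\<in>snd c ` (fst c \<inter> fst d). \<forall>v.
        F d (transition c d x) (frechet_derivative (transition c d) (at x) v) =
        frechet_derivative (transition c d) (at x) (F c x v))"


section \<open>Complexification\<close>

definition cvec :: "real^'n \<Rightarrow> complex^'n" where
  "cvec v = (\<chi> i. complex_of_real (v $ i))"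

definition Re_vec :: "complex^'n \<Rightarrow> real^'n" where
  "Re_vec v = (\<chi> i. Re (v $ i))"

definition Im_vec :: "complex^'n \<Rightarrow> real^'n" where
  "Im_vec v = (\<chi> i. Im (v $ i))"

(* The complex-linear extension of a real-linear map. *)
definition clinear_ext :: "(real^'n \<Rightarrow> complex^'m) \<Rightarrow> complex^'n \<Rightarrow> complex^'m" where
  "clinear_ext f v = f (Re_vec v) + \<i> *s f (Im_vec v)"

definition complexify_subspace :: "(real^'n) set \<Rightarrow> (complex^'n) set" where
  "complexify_subspace V = {cvec u + \<i> *s cvec w | u w. u \<in> V \<and> w \<in> V}"

definition complexify_vfield :: "('a, 'n::finite) vfield \<Rightarrow> ('a, 'n) cvfield" where
  "complexify_vfield X = (\<lambda>c x. cvec (X c x))"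

definition complexify_tfield :: "('a, 'n::finite) tfield \<Rightarrow> ('a, 'n) ctfield" where
  "complexify_tfield F = (\<lambda>c x. clinear_ext (\<lambda>v. cvec (F c x v)))"


section \<open>Lie bracket and Nijenhuis tensor\<close>

(* In each chart, [X,Y] = DY(X) - DX(Y), with the derivative extended complex-linearly in the
   direction of differentiation. *)
definition lie_bracket :: "('a, 'n::finite) cvfield \<Rightarrow> ('a, 'n) cvfield \<Rightarrow> ('a, 'n) cvfield" where
  "lie_bracket X Y = (\<lambda>c x.
     clinear_ext (frechet_derivative (Y c) (at x)) (X c x) -
     clinear_ext (frechet_derivative (X c) (at x)) (Y c x))"

definition apply_tensor :: "('a, 'n) ctfield \<Rightarrow> ('a, 'n) cvfield \<Rightarrow> ('a, 'n) cvfield" where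
  "apply_tensor T X = (\<lambda>c x. T c x (X c x))"

definition nijenhuis ::
  "('a, 'n::finite) ctfield \<Rightarrow> ('a, 'n) cvfield \<Rightarrow> ('a, 'n) cvfield \<Rightarrow> ('a, 'n) cvfield" where
  "nijenhuis T X Y = (\<lambda>c x.
     lie_bracket (apply_tensor T X) (apply_tensor T Y) c x
     - apply_tensor T (lie_bracket (apply_tensor T X) Y) c x
     - apply_tensor T (lie_bracket X (apply_tensor T Y)) c x
     + apply_tensor T (apply_tensor T (lie_bracket X Y)) c x)"

definition vanishes :: "('a, 'n::finite) chart set \<Rightarrow> ('a, 'n) cvfield \<Rightarrow> bool" where
  "vanishes A X \<longleftrightarrow> (\<forall>c\<in>A. \<forall>x\<in>snd c ` fst c. X c x = 0)"


section \<open>Distributions and integrability\<close>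

(* A distribution is a subbundle of the complexified tangent bundle, given by its fibres in all
   charts. *)
type_synonym ('a, 'n) distribution = "('a, 'n) chart \<Rightarrow> real^'n \<Rightarrow> (complex^'n) set"

definition image_distribution :: "('a, 'n) ctfield \<Rightarrow> ('a, 'n) distribution" where
  "image_distribution T = (\<lambda>c x. range (T c x))"

definition slice_chart ::
  "('a, 'n::finite) chart set \<Rightarrow> 'a set \<Rightarrow> ('a, 'n) chart \<Rightarrow> (real^'n) set \<Rightarrow> bool" where
  "slice_chart A N c V \<longleftrightarrow>
     c \<in> A \<and> subspace V \<and> snd c ` (N \<inter> fst c) = snd c ` fst c \<inter> V"

(* An integral manifold of D is a nonempty submanifold N (a set covered by slice charts) with
   T_p N (x) C = D_p for all p in N. In a slice chart for N with slice V, the tangent space of N at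
   each of its points is V. *)
definition integral_manifold ::
  "('a, 'n::finite) chart set \<Rightarrow> ('a, 'n) distribution \<Rightarrow> 'a set \<Rightarrow> bool" where
  "integral_manifold A D N \<longleftrightarrow> N \<noteq> {} \<and>
     (\<forall>p\<in>N. \<exists>c V. slice_chart A N c V \<and> p \<in> fst c \<and>
        (\<forall>x\<in>snd c ` (N \<inter> fst c). D c x = complexify_subspace V))"

definition integrable_distribution ::
  "('a, 'n::finite) chart set \<Rightarrow> ('a, 'n) distribution \<Rightarrow> bool" where
  "integrable_distribution A D \<longleftrightarrow> (\<forall>p. \<exists>N. p \<in> N \<and> integral_manifold A D N)"


section \<open>F-structures of degree K\<close>

(* F is a real tensor field; its powers enter the defining equation through the complexification,
   since alpha and beta may be complex. *)
definition F_structure ::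
  "('a::topological_space, 'n::finite) chart set \<Rightarrow> nat \<Rightarrow> complex \<Rightarrow> complex \<Rightarrow> nat \<Rightarrow>
   ('a, 'n) tfield \<Rightarrow> bool" where
  "F_structure A K \<alpha> \<beta> r F \<longleftrightarrow>
     smooth_structure A \<and> smooth_tensor_field A F \<and>
     (\<exists>c\<in>A. \<exists>x\<in>snd c ` fst c. \<exists>v. F c x v \<noteq> 0) \<and>
     (\<forall>c\<in>A. \<forall>x\<in>snd c ` fst c. dim (range (F c x)) = r) \<and>
     (\<forall>c\<in>A. \<forall>x\<in>snd c ` fst c. \<forall>v.
        \<alpha> *s (complexify_tfield F c x ^^ (K + 1)) v + \<beta> *s (complexify_tfield F c x ^^ K) v
        + complexify_tfield F c x v = 0)"

definition l_tensor :: "nat \<Rightarrow> complex \<Rightarrow> complex \<Rightarrow> ('a, 'n::finite) tfield \<Rightarrow> ('a, 'n) ctfield" where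
  "l_tensor K \<alpha> \<beta> F = (\<lambda>c x v.
     - (\<alpha> *s (complexify_tfield F c x ^^ K) v + \<beta> *s (complexify_tfield F c x ^^ (K - 1)) v))"

definition m_tensor :: "nat \<Rightarrow> complex \<Rightarrow> complex \<Rightarrow> ('a, 'n::finite) tfield \<Rightarrow> ('a, 'n) ctfield" where
  "m_tensor K \<alpha> \<beta> F = (\<lambda>c x v.
     v + \<alpha> *s (complexify_tfield F c x ^^ K) v + \<beta> *s (complexify_tfield F c x ^^ (K - 1)) v)"

end

theory Submission
  imports Defs
begin

text \<open>Although \<open>\<alpha>\<close> and \<open>\<beta>\<close> may be complex, \<open>l\<close> and \<open>m\<close> are complexifications of real projections, \<open>m\<close> being
  a projection onto \<open>ker F\<close>. Since \<open>l m = F m = 0\<close>, the Nijenhuis tensors reduce to \<open>l [mX, mY]\<close> and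
  \<open>F\<^sup>2 [mX, mY]\<close>, and \<open>ker F\<^sup>2 = ker F = ker l\<close>; so each of the three identities says that \<open>ker F\<close> is
  involutive. Differentiating \<open>F (mY) = 0\<close> turns this into a pointwise condition: the derivative
  \<open>(w, u) \<mapsto> (D\<^sub>w F) u\<close> is symmetric on \<open>ker F\<close>. In a slice chart of an integral manifold it vanishes,
  and symmetry carries over to the other charts because the second derivatives of transition maps are
  symmetric. Conversely, near a point \<open>ker F\<close> has a frame of commuting fields \<open>x \<mapsto> A x v\<close>, and an
  integral manifold is the image of a solution of the total differential equation \<open>Dg s = A (g s)\<close>.\<close>

section \<open>Smooth maps\<close>

text \<open>That \<open>l\<close> and \<open>m\<close> are real is forced by the structure equation.
  Its real part gives \<open>ker F\<^sup>2 = ker F\<close>, because both high powers contain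
  \<open>F\<^sup>2\<close>; hence one factor \<open>F\<close> can be cancelled from its imaginary
  part, and what remains says that the imaginary part of \<open>m\<close> vanishes. Two gaps shape
  the rest. The identities test global fields, while the pointwise condition concerns vectors at one
  point; bump functions extend every vector to a global field, and the Hausdorff property makes the
  extension by zero smooth. An integral manifold must be exhibited in charts of the maximal atlas,
  so the flattening map and its inverse must both be smooth; both are therefore written down
  explicitly. A commuting frame is used rather than an arbitrary involutive one because
  \<open>Dg s = A (g s)\<close> prescribes the whole derivative of \<open>g\<close>: commutation is
  its integrability condition, and the equation itself raises the regularity of \<open>g\<close>
  order by order.\<close>

text \<open>Differentiability and the derivative at a point depend only on nearby values, and
  openness of \<open>S\<close> makes each of its points interior; so replacing \<open>f\<close> by
  \<open>g\<close> survives every differentiation.\<close>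

lemma k_times_differentiable_cong:
  assumes "open S" and "\<And>x. x \<in> S \<Longrightarrow> f x = g x" and "k_times_differentiable k f S"
  shows "k_times_differentiable k g S"
  using assms(2,3)
proof (induction k arbitrary: f g)
  case 0
  then show ?case by (auto simp: continuous_on_cong[of S S f g])
next
  case (Suc k)
  have d: "g differentiable at x" "frechet_derivative f (at x) = frechet_derivative g (at x)"
    if "x \<in> S" for x
  proof -
    have "f differentiable at x" using Suc.prems that by auto
    then obtain f' where f': "(f has_derivative f') (at x)" by (auto simp: differentiable_def)
    then have "(g has_derivative f') (at x)"
      by (rule has_derivative_transform_within_open[OF _ \<open>open S\<close> that]) (use Suc.prems in auto)
    with f' show "g differentiable at x" "frechet_derivative f (at x) = frechet_derivative g (at x)"
      by (auto simp: differentiable_def frechet_derivative_at[symmetric])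
  qed
  then show ?case
    using Suc.IH[of "\<lambda>x. frechet_derivative f (at x) v" "\<lambda>x. frechet_derivative g (at x) v" for v]
      Suc.prems by auto
qed

text \<open>Lets a derivative formula found by calculus stand in for the opaque
  \<open>frechet_derivative\<close>; the inductions for products, compositions and inverses go
  through this rule.\<close>

lemma k_times_differentiable_SucI:
  assumes "open S" and "\<And>x. x \<in> S \<Longrightarrow> (f has_derivative f' x) (at x)"
    and "\<And>v. k_times_differentiable k (\<lambda>x. f' x v) S"
  shows "k_times_differentiable (Suc k) f S"
proof -
  have "frechet_derivative f (at x) = f' x" if "x \<in> S" for x
    using frechet_derivative_at[OF assms(2)[OF that]] by simp
  then show ?thesis
    using assms(2) k_times_differentiable_cong[OF assms(1) _ assms(3)]
    by (auto simp: differentiable_def)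
qed

lemma k_times_differentiable_SucD:
  assumes "k_times_differentiable (Suc k) f S"
  shows "k_times_differentiable k f S"
  using assms
proof (induction k arbitrary: f)
  case 0
  then show ?case
    by (auto intro!: continuous_at_imp_continuous_on differentiable_imp_continuous_within)
next
  case (Suc k)
  then show ?case by (metis k_times_differentiable.simps(2))
qed

lemma k_times_differentiable_has_derivative:
  assumes "k_times_differentiable (Suc k) f S" "x \<in> S"
  shows "(f has_derivative frechet_derivative f (at x)) (at x)"
  using assms by (auto simp: frechet_derivative_works)

lemma k_times_differentiable_subset:
  assumes "k_times_differentiable k f S" and "T \<subseteq> S"
  shows "k_times_differentiable k f T"
  using assms by (induction k arbitrary: f) (auto intro: continuous_on_subset)

text \<open>Locality of smoothness, needed to glue a field supported in one chart to the zero
  field.\<close>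

lemma k_times_differentiable_Union:
  assumes "\<And>S. S \<in> \<S> \<Longrightarrow> open S" and "\<And>S. S \<in> \<S> \<Longrightarrow> k_times_differentiable k f S"
  shows "k_times_differentiable k f (\<Union>\<S>)"
  using assms(2) by (induction k arbitrary: f) (auto intro: continuous_on_open_Union assms(1))

lemma k_times_differentiable_const:
  assumes "open S"
  shows "k_times_differentiable k (\<lambda>x. c) S"
proof (induction k arbitrary: c)
  case (Suc k)
  show ?case by (rule k_times_differentiable_SucI[OF assms, where f' = "\<lambda>_ _. 0"]) (auto simp: Suc)
qed auto

lemma k_times_differentiable_add:
  assumes "open S" and "k_times_differentiable k f S" and "k_times_differentiable k g S"
  shows "k_times_differentiable k (\<lambda>x. f x + g x) S"
  using assms(2,3)
proof (induction k arbitrary: f g)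
  case (Suc k)
  show ?case
    by (rule k_times_differentiable_SucI[OF assms(1) has_derivative_add, OF
          k_times_differentiable_has_derivative[OF Suc.prems(1)]
          k_times_differentiable_has_derivative[OF Suc.prems(2)]])
       (use Suc in auto)
qed (auto intro: continuous_intros)

lemma k_times_differentiable_sum:
  assumes "open S" and "\<And>i. i \<in> I \<Longrightarrow> k_times_differentiable k (f i) S"
  shows "k_times_differentiable k (\<lambda>x. \<Sum>i\<in>I. f i x) S"
  using assms(2)
  by (induction I rule: infinite_finite_induct)
     (auto intro!: k_times_differentiable_const k_times_differentiable_add assms(1))

text \<open>The product rule yields two terms of the same bilinear shape, in each of which the
  undifferentiated factor is used with one order of differentiability less.\<close>

lemma k_times_differentiable_bilinear:
  assumes "open S" and "k_times_differentiable k f S" and "k_times_differentiable k g S"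
    and "bounded_bilinear h"
  shows "k_times_differentiable k (\<lambda>x. h (f x) (g x)) S"
  using assms(2,3)
proof (induction k arbitrary: f g)
  case 0
  then show ?case by (auto intro!: bounded_bilinear.continuous_on[OF assms(4)])
next
  case (Suc k)
  show ?case
    by (rule k_times_differentiable_SucI[OF assms(1) bounded_bilinear.FDERIV[OF assms(4)], OF
          k_times_differentiable_has_derivative[OF Suc.prems(1)]
          k_times_differentiable_has_derivative[OF Suc.prems(2)]])
       (use Suc.prems in \<open>auto intro!: k_times_differentiable_add assms(1) Suc.IH
          k_times_differentiable_SucD[OF Suc.prems(1)] k_times_differentiable_SucD[OF Suc.prems(2)]\<close>)
qed

lemma k_times_differentiable_linear:
  assumes "open S" and "k_times_differentiable k f S" and "bounded_linear h"
  shows "k_times_differentiable k (\<lambda>x. h (f x)) S"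
  using assms(2)
proof (induction k arbitrary: f)
  case 0
  then show ?case by (auto intro!: bounded_linear.continuous_on[OF assms(3)])
next
  case (Suc k)
  show ?case
    by (rule k_times_differentiable_SucI[OF assms(1) bounded_linear.has_derivative[OF assms(3)], OF
          k_times_differentiable_has_derivative[OF Suc.prems]])
       (use Suc in auto)
qed

text \<open>Smoothness is defined through derivatives in fixed directions. This expansion moves a
  varying argument into scalar coefficients and leaves finitely many fixed directions.\<close>

lemma linear_eq_sum_Basis:
  assumes "linear (f :: 'a::euclidean_space \<Rightarrow> 'b::real_vector)"
  shows "f v = (\<Sum>j\<in>Basis. (v \<bullet> j) *\<^sub>R f j)"
  by (metis (no_types, lifting) euclidean_representation linear_sum linear_scale assms sum.cong)

text \<open>The chain rule applies the derivative of \<open>f\<close> to the moving vector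
  \<open>Dg v\<close>. Expanded in a basis this is a sum of products, whose factors
  \<open>frechet_derivative f (at (g x)) j\<close> are again compositions with \<open>g\<close>, of
  lower order.\<close>

lemma k_times_differentiable_compose:
  fixes f :: "'b::euclidean_space \<Rightarrow> 'c::real_normed_vector"
  assumes "open S" and "k_times_differentiable k f T" and "k_times_differentiable k g S"
    and "g ` S \<subseteq> T"
  shows "k_times_differentiable k (\<lambda>x. f (g x)) S"
  using assms(2,3)
proof (induction k arbitrary: f)
  case 0
  then show ?case using assms(4) by (auto intro: continuous_on_compose2)
next
  case (Suc k)
  have f: "(f has_derivative frechet_derivative f (at (g x))) (at (g x))" if "x \<in> S" for x
    using k_times_differentiable_has_derivative[OF Suc.prems(1)] that assms(4) by blast
  have g: "(g has_derivative frechet_derivative g (at x)) (at x)" if "x \<in> S" for x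
    using k_times_differentiable_has_derivative[OF Suc.prems(2)] that by blast
  have *: "k_times_differentiable k (\<lambda>x. \<Sum>j\<in>Basis.
      (frechet_derivative g (at x) v \<bullet> j) *\<^sub>R frechet_derivative f (at (g x)) j) S" for v
    by (intro k_times_differentiable_sum k_times_differentiable_bilinear[OF _ _ _ bounded_bilinear_scaleR]
        k_times_differentiable_linear[OF _ _ bounded_linear_inner_left] Suc.IH assms(1)
        k_times_differentiable_SucD[OF Suc.prems(2)]) (use Suc.prems in auto)
  have eq: "frechet_derivative f (at (g x)) (frechet_derivative g (at x) v) = (\<Sum>j\<in>Basis.
      (frechet_derivative g (at x) v \<bullet> j) *\<^sub>R frechet_derivative f (at (g x)) j)" if "x \<in> S" for x v
    by (rule linear_eq_sum_Basis[OF has_derivative_linear[OF f[OF that]]])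
  show ?case
    by (rule k_times_differentiable_SucI[OF assms(1) has_derivative_compose[OF g f]])
       (auto intro: k_times_differentiable_cong[OF assms(1) eq[symmetric] *])
qed

lemma smooth_on_cong:
  assumes "open S" and "\<And>x. x \<in> S \<Longrightarrow> f x = g x" and "smooth_on S f"
  shows "smooth_on S g"
  using k_times_differentiable_cong[OF assms(1,2)] assms(3) by (simp add: smooth_on_def)

lemma smooth_on_subset: "smooth_on S f \<Longrightarrow> T \<subseteq> S \<Longrightarrow> smooth_on T f"
  unfolding smooth_on_def using k_times_differentiable_subset by blast

lemma smooth_on_Union:
  assumes "\<And>S. S \<in> \<S> \<Longrightarrow> open S" and "\<And>S. S \<in> \<S> \<Longrightarrow> smooth_on S f"
  shows "smooth_on (\<Union>\<S>) f"
  using assms k_times_differentiable_Union unfolding smooth_on_def by blast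

lemma smooth_on_has_derivative:
  assumes "smooth_on S f" and "x \<in> S"
  shows "(f has_derivative frechet_derivative f (at x)) (at x)"
  using k_times_differentiable_has_derivative[of 0] assms by (metis smooth_on_def)

lemma smooth_on_frechet_derivative:
  assumes "smooth_on S f"
  shows "smooth_on S (\<lambda>x. frechet_derivative f (at x) v)"
  unfolding smooth_on_def
proof
  fix k
  have "k_times_differentiable (Suc k) f S" using assms by (simp only: smooth_on_def)
  then show "k_times_differentiable k (\<lambda>x. frechet_derivative f (at x) v) S" by simp
qed

lemma smooth_on_imp_continuous_on:
  assumes "smooth_on S f"
  shows "continuous_on S f"
proof -
  have "k_times_differentiable 0 f S" using assms by (simp only: smooth_on_def)
  then show ?thesis by simp
qed

lemma smooth_on_const: "open S \<Longrightarrow> smooth_on S (\<lambda>x. c)"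
  by (simp add: smooth_on_def k_times_differentiable_const)

lemma smooth_on_id:
  assumes "open S"
  shows "smooth_on S (\<lambda>x. x)"
  unfolding smooth_on_def
proof
  fix k show "k_times_differentiable k (\<lambda>x. x) S"
  proof (cases k)
    case (Suc j)
    show ?thesis unfolding Suc
      by (rule k_times_differentiable_SucI[OF assms has_derivative_ident])
         (rule k_times_differentiable_const[OF assms])
  qed auto
qed

lemma smooth_on_add:
  "open S \<Longrightarrow> smooth_on S f \<Longrightarrow> smooth_on S g \<Longrightarrow> smooth_on S (\<lambda>x. f x + g x)"
  by (simp add: smooth_on_def k_times_differentiable_add)

lemma smooth_on_sum:
  "open S \<Longrightarrow> (\<And>i. i \<in> I \<Longrightarrow> smooth_on S (f i)) \<Longrightarrow> smooth_on S (\<lambda>x. \<Sum>i\<in>I. f i x)"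
  by (simp add: smooth_on_def k_times_differentiable_sum)

lemma smooth_on_linear:
  "open S \<Longrightarrow> smooth_on S f \<Longrightarrow> bounded_linear h \<Longrightarrow> smooth_on S (\<lambda>x. h (f x))"
  by (simp add: smooth_on_def k_times_differentiable_linear)

lemma smooth_on_minus: "open S \<Longrightarrow> smooth_on S f \<Longrightarrow> smooth_on S (\<lambda>x. - f x)"
  by (rule smooth_on_linear[OF _ _ bounded_linear_minus[OF bounded_linear_ident]])

lemma smooth_on_diff:
  "open S \<Longrightarrow> smooth_on S f \<Longrightarrow> smooth_on S g \<Longrightarrow> smooth_on S (\<lambda>x. f x - g x)"
  using smooth_on_add[of S f "\<lambda>x. - g x"] smooth_on_minus by auto

lemma smooth_on_bilinear:
  "open S \<Longrightarrow> smooth_on S f \<Longrightarrow> smooth_on S g \<Longrightarrow> bounded_bilinear h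
    \<Longrightarrow> smooth_on S (\<lambda>x. h (f x) (g x))"
  by (simp add: smooth_on_def k_times_differentiable_bilinear)

lemma smooth_on_scaleR:
  "open S \<Longrightarrow> smooth_on S f \<Longrightarrow> smooth_on S g \<Longrightarrow> smooth_on S (\<lambda>x. f x *\<^sub>R g x)"
  using smooth_on_bilinear[OF _ _ _ bounded_bilinear_scaleR] .

lemma smooth_on_mult:
  fixes f :: "'a::real_normed_vector \<Rightarrow> 'b::real_normed_algebra"
  shows "open S \<Longrightarrow> smooth_on S f \<Longrightarrow> smooth_on S g \<Longrightarrow> smooth_on S (\<lambda>x. f x * g x)"
  using smooth_on_bilinear[OF _ _ _ bounded_bilinear_mult] .

lemma smooth_on_prod:
  fixes f :: "'i \<Rightarrow> 'a::real_normed_vector \<Rightarrow> 'b::{real_normed_algebra, comm_ring_1}"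
  assumes "open S" and "\<And>i. i \<in> I \<Longrightarrow> smooth_on S (f i)"
  shows "smooth_on S (\<lambda>x. \<Prod>i\<in>I. f i x)"
  using assms(2)
  by (induction I rule: infinite_finite_induct) (auto intro!: smooth_on_const smooth_on_mult assms(1))

lemma smooth_on_compose:
  fixes f :: "'b::euclidean_space \<Rightarrow> 'c::real_normed_vector"
  assumes "open S" and "smooth_on T f" and "smooth_on S g" and "g ` S \<subseteq> T"
  shows "smooth_on S (\<lambda>x. f (g x))"
  using k_times_differentiable_compose[OF assms(1) _ _ assms(4)] assms(2,3) unfolding smooth_on_def by blast

lemma smooth_on_apply_linear:
  fixes g :: "'a::real_normed_vector \<Rightarrow> 'b::euclidean_space"
  assumes "open S" and "smooth_on S g" and "\<And>v. smooth_on S (\<lambda>x. f x v)"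
    and "\<And>x. x \<in> S \<Longrightarrow> linear (f x)"
  shows "smooth_on S (\<lambda>x. f x (g x))"
proof (rule smooth_on_cong[OF assms(1)])
  show "smooth_on S (\<lambda>x. \<Sum>j\<in>Basis. (g x \<bullet> j) *\<^sub>R f x j)"
    by (intro smooth_on_sum smooth_on_scaleR smooth_on_linear[OF _ _ bounded_linear_inner_left] assms)
  show "(\<Sum>j\<in>Basis. (g x \<bullet> j) *\<^sub>R f x j) = f x (g x)" if "x \<in> S" for x
    by (rule linear_eq_sum_Basis[OF assms(4)[OF that], symmetric])
qed

text \<open>The derivative of \<open>1 / f\<close> is a product of \<open>1 / f\<close> with
  derivatives of \<open>f\<close>, so the induction on the order feeds on itself.\<close>

lemma smooth_on_inverse_real:
  fixes f :: "'a::real_normed_vector \<Rightarrow> real"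
  assumes "open S" and "smooth_on S f" and "\<And>x. x \<in> S \<Longrightarrow> f x \<noteq> 0"
  shows "smooth_on S (\<lambda>x. inverse (f x))"
  unfolding smooth_on_def
proof
  fix k show "k_times_differentiable k (\<lambda>x. inverse (f x)) S"
  proof (induction k)
    case 0
    then show ?case
      using smooth_on_imp_continuous_on[OF assms(2)] assms(3) by (auto intro!: continuous_intros)
  next
    case (Suc k)
    have f: "k_times_differentiable k (\<lambda>x. frechet_derivative f (at x) v) S" for v
      using smooth_on_frechet_derivative[OF assms(2)] by (auto simp: smooth_on_def)
    have "k_times_differentiable k
        (\<lambda>x. - (inverse (f x) * frechet_derivative f (at x) v * inverse (f x))) S" for v
      by (intro k_times_differentiable_linear[OF _ _ bounded_linear_minus[OF bounded_linear_ident]]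
          k_times_differentiable_bilinear[OF _ _ _ bounded_bilinear_mult] assms(1) Suc f)
    then show ?case
      using assms(3) smooth_on_has_derivative[OF assms(2)]
      by (intro k_times_differentiable_SucI[OF assms(1), where f' = "\<lambda>x v. - (inverse (f x) * frechet_derivative f (at x) v * inverse (f x))"] Deriv.has_derivative_inverse) auto
  qed
qed

section \<open>Taylor estimates and symmetry of second derivatives\<close>

text \<open>Smoothness gives continuity of the derivative in each fixed direction only. Compactness
  bounds it on the basis directions, and the sum of these bounds controls all directions.\<close>

lemma smooth_on_frechet_derivative_bounded:
  fixes G :: "'a::euclidean_space \<Rightarrow> 'b::real_normed_vector"
  assumes "smooth_on S G" and "compact K" and "K \<subseteq> S"
  obtains L where "L \<ge> 0" and "\<And>x u. x \<in> K \<Longrightarrow> norm (frechet_derivative G (at x) u) \<le> L * norm u"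
proof -
  have "\<exists>B. \<forall>x\<in>K. norm (frechet_derivative G (at x) j) \<le> B" for j
  proof -
    have "continuous_on K (\<lambda>x. frechet_derivative G (at x) j)"
      using smooth_on_imp_continuous_on[OF smooth_on_frechet_derivative[OF assms(1)]] assms(3)
      by (rule continuous_on_subset)
    then have "bounded ((\<lambda>x. frechet_derivative G (at x) j) ` K)"
      using assms(2) compact_continuous_image compact_imp_bounded by blast
    then show ?thesis by (auto simp: bounded_iff)
  qed
  then obtain B where B: "\<And>x j. x \<in> K \<Longrightarrow> norm (frechet_derivative G (at x) j) \<le> B j" by metis
  define L where "L = (\<Sum>j\<in>Basis. \<bar>B j\<bar>)"
  show thesis
  proof
    show "L \<ge> 0" by (auto simp: L_def intro: sum_nonneg)
    fix x u assume "x \<in> K"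
    then have "linear (frechet_derivative G (at x))"
      using smooth_on_has_derivative[OF assms(1)] assms(3) has_derivative_linear by blast
    then have "norm (frechet_derivative G (at x) u)
        = norm (\<Sum>j\<in>Basis. (u \<bullet> j) *\<^sub>R frechet_derivative G (at x) j)"
      by (metis linear_eq_sum_Basis)
    also have "\<dots> \<le> (\<Sum>j\<in>Basis. norm u * \<bar>B j\<bar>)"
      by (rule sum_norm_le) (use B[OF \<open>x \<in> K\<close>] in \<open>auto intro!: mult_mono Basis_le_norm order.trans[OF _ abs_ge_self]\<close>)
    finally show "norm (frechet_derivative G (at x) u) \<le> L * norm u"
      by (simp add: L_def sum_distrib_left mult.commute)
  qed
qed

lemma norm_diff_le_of_derivative_bound:
  fixes f :: "'a::{real_normed_vector, perfect_space} \<Rightarrow> 'b::real_normed_vector"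
  assumes "convex S" and "\<And>x. x \<in> S \<Longrightarrow> (f has_derivative f' x) (at x within S)"
    and "\<And>x u. x \<in> S \<Longrightarrow> norm (f' x u) \<le> B * norm u" and "x \<in> S" and "y \<in> S"
  shows "norm (f x - f y) \<le> B * norm (x - y)"
  by (rule differentiable_bound[OF assms(1,2) _ assms(4,5)]) (use assms(3) in \<open>auto intro: onorm_le\<close>)

lemma smooth_on_lipschitz:
  fixes G :: "'a::euclidean_space \<Rightarrow> 'b::real_normed_vector"
  assumes "smooth_on S G" and "compact K" and "convex K" and "K \<subseteq> S"
  obtains L where "L \<ge> 0" and "\<And>x y. x \<in> K \<Longrightarrow> y \<in> K \<Longrightarrow> norm (G x - G y) \<le> L * norm (x - y)"
proof -
  obtain L where L: "L \<ge> 0" "\<And>x u. x \<in> K \<Longrightarrow> norm (frechet_derivative G (at x) u) \<le> L * norm u"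
    using smooth_on_frechet_derivative_bounded[OF assms(1,2,4)] by blast
  show thesis
  proof
    show "norm (G x - G y) \<le> L * norm (x - y)" if "x \<in> K" "y \<in> K" for x y
      by (rule norm_diff_le_of_derivative_bound[OF assms(3) _ L(2) that])
         (use assms(4) in \<open>auto intro!: has_derivative_at_withinI smooth_on_has_derivative[OF assms(1)]\<close>)
  qed (fact L)
qed

lemma smooth_on_frechet_derivative_lipschitz:
  fixes G :: "'a::euclidean_space \<Rightarrow> 'b::real_normed_vector"
  assumes "smooth_on S G" and "compact K" and "convex K" and "K \<subseteq> S"
  obtains C where "C \<ge> 0" and "\<And>x y u. x \<in> K \<Longrightarrow> y \<in> K \<Longrightarrow>
    norm (frechet_derivative G (at x) u - frechet_derivative G (at y) u) \<le> C * norm (x - y) * norm u"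
proof -
  let ?D = "\<lambda>x. frechet_derivative G (at x)"
  have "\<exists>L. \<forall>x\<in>K. \<forall>y\<in>K. norm (?D x j - ?D y j) \<le> L * norm (x - y)" for j
    using smooth_on_lipschitz[OF smooth_on_frechet_derivative[OF assms(1)] assms(2-4)] by metis
  then obtain B where B: "\<And>x y j. x \<in> K \<Longrightarrow> y \<in> K \<Longrightarrow> norm (?D x j - ?D y j) \<le> B j * norm (x - y)"
    by metis
  define C where "C = (\<Sum>j\<in>Basis. \<bar>B j\<bar>)"
  show thesis
  proof
    show "C \<ge> 0" by (auto simp: C_def intro: sum_nonneg)
    fix x y u assume xy: "x \<in> K" "y \<in> K"
    have "linear (?D z)" if "z \<in> K" for z
      using smooth_on_has_derivative[OF assms(1)] assms(4) has_derivative_linear that by blast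
    then have "linear (\<lambda>u. ?D x u - ?D y u)" using xy by (intro linear_compose_sub) auto
    then have "norm (?D x u - ?D y u) = norm (\<Sum>j\<in>Basis. (u \<bullet> j) *\<^sub>R (?D x j - ?D y j))"
      using linear_eq_sum_Basis[of "\<lambda>u. ?D x u - ?D y u" u] by simp
    also have "\<dots> \<le> (\<Sum>j\<in>Basis. norm u * (\<bar>B j\<bar> * norm (x - y)))"
    proof (rule sum_norm_le)
      fix j :: 'a assume "j \<in> Basis"
      moreover have "norm (?D x j - ?D y j) \<le> \<bar>B j\<bar> * norm (x - y)"
        using B[OF xy] by (rule order.trans) (simp add: mult_right_mono)
      ultimately show "norm ((u \<bullet> j) *\<^sub>R (?D x j - ?D y j)) \<le> norm u * (\<bar>B j\<bar> * norm (x - y))"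
        by (auto intro!: mult_mono Basis_le_norm)
    qed
    finally show "norm (?D x u - ?D y u) \<le> C * norm (x - y) * norm u"
      by (simp add: C_def sum_distrib_left sum_distrib_right ac_simps)
  qed
qed

text \<open>Mean value inequality for \<open>G\<close> minus its linearisation at \<open>x\<close>:
  the derivative of this difference at \<open>z\<close> is the increment of the derivative of
  \<open>G\<close>, which the Lipschitz estimate bounds.\<close>

lemma smooth_on_taylor:
  fixes G :: "'a::euclidean_space \<Rightarrow> 'b::real_normed_vector"
  assumes "smooth_on S G" and "compact K" and "convex K" and "K \<subseteq> S"
  obtains C where "C \<ge> 0" and "\<And>x y. x \<in> K \<Longrightarrow> y \<in> K \<Longrightarrow>
    norm (G y - G x - frechet_derivative G (at x) (y - x)) \<le> C * (norm (y - x))\<^sup>2"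
proof -
  let ?D = "\<lambda>x. frechet_derivative G (at x)"
  obtain C where C: "C \<ge> 0" "\<And>x y u. x \<in> K \<Longrightarrow> y \<in> K \<Longrightarrow>
      norm (?D x u - ?D y u) \<le> C * norm (x - y) * norm u"
    using smooth_on_frechet_derivative_lipschitz[OF assms] by blast
  show thesis
  proof
    fix x y assume xy: "x \<in> K" "y \<in> K"
    have seg: "closed_segment x y \<subseteq> K" using xy assms(3) by (simp add: closed_segment_subset)
    have lin: "bounded_linear (?D x)"
      using smooth_on_has_derivative[OF assms(1)] assms(4) has_derivative_bounded_linear xy by blast
    \<comment> \<open>Working on the segment instead of \<open>K\<close> guarantees
      \<open>norm (z - x) \<le> norm (y - x)\<close>, which produces the second factor of the
      square.\<close>
    have "norm ((G y - ?D x y) - (G x - ?D x x)) \<le> C * norm (y - x) * norm (y - x)"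
    proof (rule norm_diff_le_of_derivative_bound[where S = "closed_segment x y"])
      fix z assume z: "z \<in> closed_segment x y"
      then have "z \<in> S" using seg assms(4) by blast
      then show "((\<lambda>z. G z - ?D x z) has_derivative (\<lambda>u. ?D z u - ?D x u)) (at z within closed_segment x y)"
        by (intro has_derivative_diff has_derivative_at_withinI[OF smooth_on_has_derivative[OF assms(1)]]
            bounded_linear.has_derivative[OF lin] has_derivative_ident)
      have "norm (z - x) \<le> norm (y - x)" using z segment_bound1 by blast
      then have "C * norm (z - x) * norm u \<le> C * norm (y - x) * norm u" for u :: 'a
        using C(1) by (intro mult_right_mono mult_left_mono) auto
      then show "norm (?D z u - ?D x u) \<le> C * norm (y - x) * norm u" for u
        using C(2)[of z x u] z seg xy order.trans by blast
    qed auto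
    moreover have "(G y - ?D x y) - (G x - ?D x x) = G y - G x - ?D x (y - x)"
      by (simp add: linear_diff[OF bounded_linear.linear[OF lin]])
    ultimately show "norm (G y - G x - ?D x (y - x)) \<le> C * (norm (y - x))\<^sup>2"
      by (simp add: power2_eq_square mult.assoc)
  qed (fact C)
qed

text \<open>The second difference is symmetric in \<open>v\<close> and \<open>w\<close>, whereas the
  iterated derivative that approximates it is not visibly so; the cubic error makes the comparison
  survive division by the square of \<open>t\<close>.\<close>

lemma second_difference_bound:
  fixes f :: "'a::euclidean_space \<Rightarrow> 'b::real_normed_vector"
  assumes "open S" and "smooth_on S f" and "x \<in> S"
  obtains e B where "e > 0" and "\<And>t. 0 < t \<Longrightarrow> t < e \<Longrightarrow>
    norm (f (x + t *\<^sub>R v + t *\<^sub>R w) - f (x + t *\<^sub>R w) - f (x + t *\<^sub>R v) + f x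
      - t\<^sup>2 *\<^sub>R frechet_derivative (\<lambda>y. frechet_derivative f (at y) w) (at x) v) \<le> B * t ^ 3"
proof -
  let ?G = "\<lambda>y. frechet_derivative f (at y) w"
  let ?D = "frechet_derivative ?G (at x)"
  obtain d where d: "d > 0" "cball x d \<subseteq> S" using assms(1,3) open_contains_cball by blast
  have G: "smooth_on S ?G" by (rule smooth_on_frechet_derivative[OF assms(2)])
  obtain C where C: "C \<ge> 0" "\<And>y z. y \<in> cball x d \<Longrightarrow> z \<in> cball x d \<Longrightarrow>
      norm (?G z - ?G y - frechet_derivative ?G (at y) (z - y)) \<le> C * (norm (z - y))\<^sup>2"
    using smooth_on_taylor[OF G compact_cball convex_cball d(2)] by blast
  have linD: "linear ?D"
    by (rule has_derivative_linear[OF smooth_on_has_derivative[OF G assms(3)]])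
  define N where "N = norm v + norm w"
  \<comment> \<open>For \<open>t < e\<close> all points
    \<open>x + a *\<^sub>R v + s *\<^sub>R w\<close> with \<open>a\<close> and \<open>s\<close>
    between \<open>0\<close> and \<open>t\<close> stay in the ball; the summand \<open>1\<close>
    covers the case \<open>N = 0\<close>.\<close>
  define e where "e = d / (N + 1)"
  have N: "N \<ge> 0" by (simp add: N_def)
  show thesis
  proof
    show "e > 0" using d N by (simp add: e_def)
    fix t :: real assume t: "0 < t" "t < e"
    have tN: "t * N \<le> d"
    proof -
      have "t * N \<le> e * (N + 1)" using t N by (intro mult_mono) auto
      then show ?thesis using N by (simp add: e_def)
    qed
    have nm: "norm (a *\<^sub>R v + s *\<^sub>R w) \<le> t * N" if "0 \<le> s" "s \<le> t" "0 \<le> a" "a \<le> t" for a s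
    proof -
      have "norm (a *\<^sub>R v + s *\<^sub>R w) \<le> a * norm v + s * norm w"
        using norm_triangle_ineq[of "a *\<^sub>R v" "s *\<^sub>R w"] that by simp
      also have "\<dots> \<le> t * norm v + t * norm w"
        by (intro add_mono mult_right_mono) (use that in auto)
      finally show ?thesis by (simp add: N_def algebra_simps)
    qed
    have mem: "x + a *\<^sub>R v + s *\<^sub>R w \<in> cball x d" if "0 \<le> s" "s \<le> t" "0 \<le> a" "a \<le> t" for a s
    proof -
      have "dist x (x + a *\<^sub>R v + s *\<^sub>R w) = norm (a *\<^sub>R v + s *\<^sub>R w)"
        by (metis add.assoc add_diff_cancel_left' dist_commute dist_norm)
      then show ?thesis using nm[OF that] tN by simp
    qed
    \<comment> \<open>\<open>?p t - ?p 0\<close> is exactly the quantity to be bounded. The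
      derivative of \<open>?p\<close> in \<open>s\<close> is a first difference of \<open>?G\<close>
      minus its linear part, and two Taylor expansions at \<open>x\<close> bound it; hence the
      factor \<open>2\<close>.\<close>
    let ?p = "\<lambda>s. f (x + t *\<^sub>R v + s *\<^sub>R w) - f (x + s *\<^sub>R w) - (s * t) *\<^sub>R ?D v"
    have "norm (?p t - ?p 0) \<le> (2 * C * (t * N)\<^sup>2) * norm (t - 0)"
    proof (rule norm_diff_le_of_derivative_bound[where S = "{0..t}"])
      fix s assume s: "s \<in> {0..t}"
      have m1: "x + t *\<^sub>R v + s *\<^sub>R w \<in> cball x d" and m2: "x + s *\<^sub>R w \<in> cball x d"
        using mem[of s t] mem[of s 0] s t by auto
      have fd: "(f has_derivative frechet_derivative f (at z)) (at z)" if "z \<in> cball x d" for z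
        using smooth_on_has_derivative[OF assms(2)] d(2) that by blast
      have sc: "frechet_derivative f (at z) (r *\<^sub>R w) = r *\<^sub>R ?G z" if "z \<in> cball x d" for z r
        using has_derivative_linear[OF fd[OF that]] by (rule linear_scale)
      have c: "((\<lambda>s. f (y + s *\<^sub>R w)) has_derivative (\<lambda>r. r *\<^sub>R ?G (y + s *\<^sub>R w))) (at s within {0..t})"
        if "y + s *\<^sub>R w \<in> cball x d" for y
      proof -
        have "((\<lambda>s. y + s *\<^sub>R w) has_derivative (\<lambda>r. r *\<^sub>R w)) (at s within {0..t})"
          by (auto intro!: derivative_eq_intros)
        from has_derivative_compose[OF this fd[OF that]] sc[OF that] show ?thesis by simp
      qed
      show "(?p has_derivative (\<lambda>r. r *\<^sub>R ?G (x + t *\<^sub>R v + s *\<^sub>R w) - r *\<^sub>R ?G (x + s *\<^sub>R w)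
          - (r * t) *\<^sub>R ?D v)) (at s within {0..t})"
        by (rule has_derivative_diff[OF has_derivative_diff[OF c[OF m1] c[OF m2]]])
           (auto intro!: derivative_eq_intros)
      have e1: "norm (?G (x + a *\<^sub>R v + s *\<^sub>R w) - ?G x - ?D (a *\<^sub>R v + s *\<^sub>R w)) \<le> C * (t * N)\<^sup>2"
        if "0 \<le> a" "a \<le> t" for a
      proof -
        have "norm (?G (x + a *\<^sub>R v + s *\<^sub>R w) - ?G x - ?D (a *\<^sub>R v + s *\<^sub>R w))
            \<le> C * (norm (a *\<^sub>R v + s *\<^sub>R w))\<^sup>2"
          using C(2)[of x "x + a *\<^sub>R v + s *\<^sub>R w"] mem[of s a] s that d(1) by (simp add: add.assoc)
        also have "\<dots> \<le> C * (t * N)\<^sup>2"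
          using nm[of s a] s that C(1) by (intro mult_left_mono power_mono) auto
        finally show ?thesis .
      qed
      have "?G (x + t *\<^sub>R v + s *\<^sub>R w) - ?G (x + s *\<^sub>R w) - t *\<^sub>R ?D v
          = (?G (x + t *\<^sub>R v + s *\<^sub>R w) - ?G x - ?D (t *\<^sub>R v + s *\<^sub>R w))
            - (?G (x + 0 *\<^sub>R v + s *\<^sub>R w) - ?G x - ?D (0 *\<^sub>R v + s *\<^sub>R w))"
        by (simp add: linear_add[OF linD] linear_scale[OF linD])
      also have "norm \<dots> \<le> C * (t * N)\<^sup>2 + C * (t * N)\<^sup>2"
        by (rule order.trans[OF norm_triangle_ineq4 add_mono]) (use e1[of t] e1[of 0] t in auto)
      finally have b: "norm (?G (x + t *\<^sub>R v + s *\<^sub>R w) - ?G (x + s *\<^sub>R w) - t *\<^sub>R ?D v) \<le> 2 * C * (t * N)\<^sup>2"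
        by simp
      show "norm (r *\<^sub>R ?G (x + t *\<^sub>R v + s *\<^sub>R w) - r *\<^sub>R ?G (x + s *\<^sub>R w) - (r * t) *\<^sub>R ?D v)
          \<le> 2 * C * (t * N)\<^sup>2 * norm r" for r :: real
      proof -
        have "r *\<^sub>R ?G (x + t *\<^sub>R v + s *\<^sub>R w) - r *\<^sub>R ?G (x + s *\<^sub>R w) - (r * t) *\<^sub>R ?D v
            = r *\<^sub>R (?G (x + t *\<^sub>R v + s *\<^sub>R w) - ?G (x + s *\<^sub>R w) - t *\<^sub>R ?D v)"
          by (simp add: scaleR_diff_right)
        then show ?thesis
          using mult_left_mono[OF b abs_ge_zero[of r]] by (simp add: mult.commute)
      qed
    qed (use t in auto)
    also have "2 * C * (t * N)\<^sup>2 * norm (t - 0) = 2 * C * N\<^sup>2 * t ^ 3"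
      using t by (simp add: power_mult_distrib power2_eq_square power3_eq_cube)
    finally show "norm (f (x + t *\<^sub>R v + t *\<^sub>R w) - f (x + t *\<^sub>R w) - f (x + t *\<^sub>R v) + f x
        - t\<^sup>2 *\<^sub>R ?D v) \<le> 2 * C * N\<^sup>2 * t ^ 3"
      by (simp add: power2_eq_square algebra_simps)
  qed
qed

text \<open>Exchanging \<open>v\<close> and \<open>w\<close> leaves the second difference unchanged,
  so both mixed derivatives approximate the same quantity and differ by at most a multiple of
  \<open>t\<close>, for every small \<open>t\<close>.\<close>

lemma frechet_derivative_commute:
  fixes f :: "'a::euclidean_space \<Rightarrow> 'b::real_normed_vector"
  assumes "open S" and "smooth_on S f" and "x \<in> S"
  shows "frechet_derivative (\<lambda>y. frechet_derivative f (at y) w) (at x) v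
       = frechet_derivative (\<lambda>y. frechet_derivative f (at y) v) (at x) w"
    (is "?a = ?b")
proof (rule ccontr)
  assume "?a \<noteq> ?b"
  then have pos: "norm (?a - ?b) > 0" by simp
  let ?Q = "\<lambda>t. f (x + t *\<^sub>R v + t *\<^sub>R w) - f (x + t *\<^sub>R w) - f (x + t *\<^sub>R v) + f x"
  obtain e1 B1 where 1: "e1 > 0" "\<And>t. 0 < t \<Longrightarrow> t < e1 \<Longrightarrow> norm (?Q t - t\<^sup>2 *\<^sub>R ?a) \<le> B1 * t ^ 3"
    using second_difference_bound[OF assms, of v w] by blast
  obtain e2 B2 where 2: "e2 > 0" "\<And>t. 0 < t \<Longrightarrow> t < e2 \<Longrightarrow>
      norm (f (x + t *\<^sub>R w + t *\<^sub>R v) - f (x + t *\<^sub>R v) - f (x + t *\<^sub>R w) + f x - t\<^sup>2 *\<^sub>R ?b) \<le> B2 * t ^ 3"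
    using second_difference_bound[OF assms, of w v] by blast
  have bd: "norm (?a - ?b) \<le> (B1 + B2) * t" if t: "0 < t" "t < e1" "t < e2" for t
  proof -
    have eq: "?Q t = f (x + t *\<^sub>R w + t *\<^sub>R v) - f (x + t *\<^sub>R v) - f (x + t *\<^sub>R w) + f x"
      by (simp add: algebra_simps)
    have "t\<^sup>2 * norm (?a - ?b) = norm ((?Q t - t\<^sup>2 *\<^sub>R ?b) - (?Q t - t\<^sup>2 *\<^sub>R ?a))"
      by (simp flip: scaleR_diff_right)
    also have "\<dots> \<le> B2 * t ^ 3 + B1 * t ^ 3"
      by (rule order.trans[OF norm_triangle_ineq4 add_mono[OF 2(2)[OF t(1,3), folded eq] 1(2)[OF t(1,2)]]])
    finally have "t\<^sup>2 * norm (?a - ?b) \<le> t\<^sup>2 * ((B1 + B2) * t)"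
      by (simp add: power2_eq_square power3_eq_cube algebra_simps)
    then show ?thesis using t by (simp del: mult_le_cancel_left add: mult_le_cancel_left_pos)
  qed
  have "((\<lambda>t. (B1 + B2) * t) \<longlongrightarrow> (B1 + B2) * 0) (at_right 0)"
    by (intro tendsto_intros)
  moreover have "\<forall>\<^sub>F t in at_right 0. norm (?a - ?b) \<le> (B1 + B2) * t"
    using bd 1(1) 2(1) by (auto simp: eventually_at_right_field intro!: exI[of _ "min e1 e2"])
  ultimately have "norm (?a - ?b) \<le> (B1 + B2) * 0"
    by (rule tendsto_lowerbound) simp
  with pos show False by simp
qed

section \<open>Total differential equations\<close>

text \<open>Turns the integral over the unit interval along the ray of \<open>r *\<^sub>R s\<close>
  into the integral from \<open>0\<close> to \<open>r\<close> along the ray of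
  \<open>s\<close>.\<close>

lemma integral_rescale_unit:
  fixes f :: "real \<Rightarrow> 'a::banach"
  assumes "f integrable_on {0..c}" and "0 < c"
  shows "integral {0..1} (\<lambda>t. c *\<^sub>R f (c * t)) = integral {0..c} f"
proof -
  have img: "(\<lambda>x. x / c) ` {0..c} = {0..1}"
    using assms(2) by (auto simp: field_simps image_iff intro!: bexI[of _ "c * _"])
  have "((\<lambda>x. f (c * x)) has_integral (1 / \<bar>c\<bar>) *\<^sub>R integral {0..c} f) {0..1}"
    using has_integral_stretch_real[OF integrable_integral[OF assms(1)], of c] assms(2) by (simp add: img)
  from has_integral_cmul[OF this, of c] show ?thesis
    using assms(2) by (intro integral_unique) simp
qed

text \<open>One Banach fixed point yields the solutions along all rays at once. The unknown is a
  function of \<open>s\<close>, and the equation is \<open>g s = x0 + integral {0..1} (\<lambda>t. A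
  (g (t *\<^sub>R s)) s)\<close>. The bound on \<open>M * \<epsilon>\<close> keeps the values in the
  ball, the bound on \<open>L * \<epsilon>\<close> gives the contraction constant
  \<open>1 / 2\<close>.\<close>

lemma ray_solutions:
  fixes A :: "'a::euclidean_space \<Rightarrow> 'b::euclidean_space \<Rightarrow>\<^sub>L 'a"
  assumes cont: "continuous_on (cball x0 R) A"
    and M: "\<And>x. x \<in> cball x0 R \<Longrightarrow> norm (A x) \<le> M"
    and L: "\<And>x y. x \<in> cball x0 R \<Longrightarrow> y \<in> cball x0 R \<Longrightarrow> norm (A x - A y) \<le> L * norm (x - y)"
    and "R > 0" and "\<epsilon> \<ge> 0" and "L \<ge> 0" and "M * \<epsilon> \<le> R" and "L * \<epsilon> \<le> 1 / 2"
  shows "\<exists>g. g 0 = x0 \<and> (\<forall>s\<in>cball 0 \<epsilon>. g s \<in> cball x0 R) \<and>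
    (\<forall>s\<in>cball 0 \<epsilon>. \<forall>t\<in>{0..1}.
      ((\<lambda>t. g (t *\<^sub>R s)) has_vector_derivative A (g (t *\<^sub>R s)) s) (at t within {0..1}))"
proof -
  \<comment> \<open>The fixed point lives in the complete space of bounded continuous functions on
    the whole space. The retraction \<open>c\<close> onto the small ball keeps the equation
    controlled for every \<open>s\<close> and is the identity where the conclusion is
    claimed.\<close>
  define c :: "'b \<Rightarrow> 'b" where "c = closest_point (cball 0 \<epsilon>)"
  have c_mem: "norm (c s) \<le> \<epsilon>" for s
    using closest_point_in_set[of "cball 0 \<epsilon>" s] \<open>\<epsilon> \<ge> 0\<close> by (auto simp: c_def)
  have c_self: "c s = s" if "s \<in> cball 0 \<epsilon>" for s
    using that by (simp add: c_def closest_point_self)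
  have c_cont: "continuous_on T c" for T
    unfolding c_def using \<open>\<epsilon> \<ge> 0\<close> by (intro continuous_on_closest_point) auto
  define \<S> :: "('b \<Rightarrow>\<^sub>C 'a) set" where "\<S> = PiC UNIV (\<lambda>_. cball x0 R)"
  have \<S>: "G \<in> \<S> \<longleftrightarrow> (\<forall>s. apply_bcontfun G s \<in> cball x0 R)" for G
    by (auto simp: \<S>_def mem_PiC_iff Pi_iff)
  define f where "f G s t = A (apply_bcontfun G (t *\<^sub>R c s)) (c s)" for G s and t :: real
  define T where "T G = (\<lambda>s. x0 + integral {0..1} (f G s))" for G
  have f_cont2: "continuous_on (UNIV \<times> cbox 0 1) (\<lambda>(s, t). f G s t)" if "G \<in> \<S>" for G
  proof -
    have "continuous_on (UNIV \<times> cbox 0 1) (\<lambda>p::'b \<times> real. snd p *\<^sub>R c (fst p))"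
      by (intro continuous_on_scaleR continuous_on_compose2[OF c_cont[of UNIV]] continuous_on_fst
          continuous_on_snd continuous_on_id subset_UNIV)
    then have 1: "continuous_on (UNIV \<times> cbox 0 1) (\<lambda>p::'b \<times> real. apply_bcontfun G (snd p *\<^sub>R c (fst p)))"
      by (rule continuous_on_compose2[OF continuous_on_apply_bcontfun[of UNIV G]]) auto
    have "continuous_on (UNIV \<times> cbox 0 1) (\<lambda>p::'b \<times> real. A (apply_bcontfun G (snd p *\<^sub>R c (fst p))))"
      by (rule continuous_on_compose2[OF cont 1]) (use that \<S> in blast)
    then show ?thesis
      unfolding f_def case_prod_unfold
      by (intro blinfun.continuous_on continuous_on_compose2[OF c_cont[of UNIV]] continuous_on_fst
          continuous_on_id subset_UNIV)
  qed
  have f_cont: "continuous_on {0..1} (f G s)" if "G \<in> \<S>" for G s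
  proof -
    have "continuous_on {0..1} (\<lambda>t. (\<lambda>(s, t). f G s t) (s, t))"
      by (rule continuous_on_compose2[OF f_cont2[OF that]])
         (auto intro!: continuous_on_Pair continuous_on_const continuous_on_id)
    then show ?thesis by simp
  qed
  have T_mem: "T G s \<in> cball x0 R" if "G \<in> \<S>" for G s
  proof -
    have "norm (f G s t) \<le> M * \<epsilon>" for t
    proof -
      have "norm (f G s t) \<le> norm (A (apply_bcontfun G (t *\<^sub>R c s))) * norm (c s)"
        unfolding f_def by (rule norm_blinfun)
      also have "\<dots> \<le> M * \<epsilon>"
        using M[of "apply_bcontfun G (t *\<^sub>R c s)"] that c_mem \<S>
        by (intro mult_mono) (auto intro: order.trans[OF norm_ge_zero])
      finally show ?thesis .
    qed
    then have "norm (integral {0..1} (f G s)) \<le> M * \<epsilon> * (1 - 0)"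
      by (intro integral_bound f_cont that) auto
    then show ?thesis using \<open>M * \<epsilon> \<le> R\<close> by (simp add: T_def dist_norm)
  qed
  have T_bc: "T G \<in> bcontfun" if "G \<in> \<S>" for G
  proof (rule bcontfun_normI)
    show "continuous_on UNIV (T G)"
      unfolding T_def using integral_continuous_on_param[OF f_cont2[OF that]]
      by (intro continuous_on_add continuous_on_const) simp
    show "norm (T G s) \<le> norm x0 + R" for s
      using T_mem[OF that, of s] norm_triangle_sub[of "T G s" x0] by (simp add: dist_norm norm_minus_commute)
  qed
  have apply_T: "apply_bcontfun (Bcontfun (T G)) = T G" if "G \<in> \<S>" for G
    using T_bc[OF that] by (rule Bcontfun_inverse)
  have "\<exists>!G\<in>\<S>. Bcontfun (T G) = G"
  proof (rule Banach_fix[where c = "1/2"])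
    show "complete \<S>"
      unfolding \<S>_def by (simp add: complete_eq_closed closed_PiC)
    have "const_bcontfun x0 \<in> \<S>" using \<open>R > 0\<close> by (simp add: \<S> const_bcontfun.rep_eq)
    then show "\<S> \<noteq> {}" by blast
    show "(\<lambda>G. Bcontfun (T G)) ` \<S> \<subseteq> \<S>"
      using T_mem by (auto simp: \<S> apply_T)
    fix G G' assume G: "G \<in> \<S>" "G' \<in> \<S>"
    show "dist (Bcontfun (T G)) (Bcontfun (T G')) \<le> 1 / 2 * dist G G'"
    proof (rule dist_bound)
      fix s
      have "norm (f G s t - f G' s t) \<le> 1 / 2 * dist G G'" for t
      proof -
        let ?u = "t *\<^sub>R c s"
        have "norm (f G s t - f G' s t) \<le> norm (A (apply_bcontfun G ?u) - A (apply_bcontfun G' ?u)) * norm (c s)"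
          unfolding f_def by (metis norm_blinfun blinfun.diff_left)
        also have "\<dots> \<le> (L * dist G G') * \<epsilon>"
        proof (intro mult_mono c_mem)
          have "norm (A (apply_bcontfun G ?u) - A (apply_bcontfun G' ?u))
              \<le> L * norm (apply_bcontfun G ?u - apply_bcontfun G' ?u)"
            by (rule L) (use G \<S> in auto)
          also have "\<dots> \<le> L * dist G G'"
            using dist_bounded[of G ?u G'] \<open>L \<ge> 0\<close> by (intro mult_left_mono) (auto simp: dist_norm)
          finally show "norm (A (apply_bcontfun G ?u) - A (apply_bcontfun G' ?u)) \<le> L * dist G G'" .
        qed (use \<open>L \<ge> 0\<close> in auto)
        also have "\<dots> \<le> 1 / 2 * dist G G'"
          using mult_right_mono[OF \<open>L * \<epsilon> \<le> 1 / 2\<close> zero_le_dist[of G G']] by (simp add: ac_simps)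
        finally show ?thesis .
      qed
      then have "norm (integral {0..1} (\<lambda>t. f G s t - f G' s t)) \<le> 1 / 2 * dist G G' * (1 - 0)"
        by (intro integral_bound continuous_on_diff f_cont G) auto
      also have "integral {0..1} (\<lambda>t. f G s t - f G' s t) = T G s - T G' s"
        unfolding T_def
        using Henstock_Kurzweil_Integration.integral_diff[OF integrable_continuous_real[OF f_cont[OF G(1), of s]]
          integrable_continuous_real[OF f_cont[OF G(2), of s]]] by simp
      finally show "dist (apply_bcontfun (Bcontfun (T G)) s) (apply_bcontfun (Bcontfun (T G')) s) \<le> 1 / 2 * dist G G'"
        by (simp add: apply_T G dist_norm)
    qed
  qed auto
  then obtain G where G: "G \<in> \<S>" "Bcontfun (T G) = G" by blast
  have fixpoint: "apply_bcontfun G s = x0 + integral {0..1} (f G s)" for s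
    using apply_T[OF G(1)] G(2) by (simp add: T_def)
  let ?g = "apply_bcontfun G"
  show ?thesis
  proof (intro exI conjI ballI)
    have "c 0 = 0" using \<open>\<epsilon> \<ge> 0\<close> by (simp add: c_self)
    then have "f G 0 = (\<lambda>t. 0)" by (auto simp: f_def blinfun.zero_right)
    then show "?g 0 = x0" using fixpoint[of 0] by simp
    show "?g s \<in> cball x0 R" if "s \<in> cball 0 \<epsilon>" for s :: 'b using G(1) \<S> by blast
    fix s :: 'b and t :: real assume s: "s \<in> cball 0 \<epsilon>" and t: "t \<in> {0..1}"
    \<comment> \<open>Rescaling the fixed point equation at \<open>r *\<^sub>R s\<close> gives the
      integral equation along the ray of \<open>s\<close>; the fundamental theorem of calculus then
      supplies the derivative.\<close>
    have ray: "?g (r *\<^sub>R s) = x0 + integral {0..r} (f G s)" if r: "r \<in> {0..1}" for r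
    proof (cases "r = 0")
      case True
      then show ?thesis using \<open>?g 0 = x0\<close> by simp
    next
      case False
      have "r * norm s \<le> 1 * \<epsilon>" using r s by (intro mult_mono) auto
      then have "c (r *\<^sub>R s) = r *\<^sub>R s" using r by (intro c_self) simp
      then have "f G (r *\<^sub>R s) t = r *\<^sub>R f G s (r * t)" for t
        using c_self[OF s] by (simp add: f_def blinfun.scaleR_right mult.commute)
      then have "f G (r *\<^sub>R s) = (\<lambda>t. r *\<^sub>R f G s (r * t))" by blast
      moreover have "f G s integrable_on {0..r}"
        by (intro integrable_continuous_real continuous_on_subset[OF f_cont[OF G(1), of s]]) (use r in auto)
      ultimately show ?thesis
        using fixpoint[of "r *\<^sub>R s"] integral_rescale_unit[of "f G s" r] r False by simp
    qed
    have "((\<lambda>u. x0 + integral {0..u} (f G s)) has_vector_derivative f G s t) (at t within {0..1})"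
      using integral_has_vector_derivative[OF f_cont[OF G(1)] t, of s]
      by (auto intro!: derivative_eq_intros)
    then have "((\<lambda>u. ?g (u *\<^sub>R s)) has_vector_derivative f G s t) (at t within {0..1})"
      by (rule has_vector_derivative_transform[OF t, rotated]) (simp add: ray)
    then show "((\<lambda>t. ?g (t *\<^sub>R s)) has_vector_derivative A (?g (t *\<^sub>R s)) s) (at t within {0..1})"
      using c_self[OF s] by (simp add: f_def)
  qed
qed

text \<open>A substitute for Gronwall's inequality on an interval so short that the bound of the derivative
  by \<open>norm (e t) / 2\<close> can be absorbed.\<close>
lemma norm_le_of_derivative_le:
  fixes e :: "real \<Rightarrow> 'a::real_normed_vector"
  assumes "\<And>t. t \<in> {0..1} \<Longrightarrow> (e has_vector_derivative e' t) (at t within {0..1})"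
    and "\<And>t. t \<in> {0..1} \<Longrightarrow> norm (e' t) \<le> a + norm (e t) / 2"
    and "e 0 = 0" and "t \<in> {0..1}"
  shows "norm (e t) \<le> 2 * a"
proof -
  have "continuous_on {0..1} (\<lambda>t. norm (e t))"
    using assms(1) by (intro continuous_intros continuous_on_vector_derivative)
  then obtain m where m: "m \<in> {0..1}" "\<And>t. t \<in> {0..1} \<Longrightarrow> norm (e t) \<le> norm (e m)"
    using continuous_attains_sup[of "{0..1::real}" "\<lambda>t. norm (e t)"] by auto
  \<comment> \<open>At a maximum \<open>m\<close> of \<open>norm (e t)\<close> the derivative bound
    becomes uniform on the interval, and \<open>norm (e m) \<le> a + norm (e m) / 2\<close> is
    solved for \<open>norm (e m)\<close>.\<close>
  let ?B = "a + norm (e m) / 2"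
  have bound: "norm (e' t) \<le> ?B" if "t \<in> {0..1}" for t
    using assms(2)[OF that] m(2)[OF that] by linarith
  have "norm (e m - e 0) \<le> ?B * norm (m - 0)"
  proof (rule norm_diff_le_of_derivative_bound[where S = "{0..1}"])
    show "(e has_derivative (\<lambda>r. r *\<^sub>R e' t)) (at t within {0..1})" if "t \<in> {0..1}" for t
      using assms(1)[OF that] by (simp add: has_vector_derivative_def)
    show "norm (r *\<^sub>R e' t) \<le> ?B * norm r" if "t \<in> {0..1}" for t r
      using mult_left_mono[OF bound[OF that], of "norm r"] by (simp add: mult.commute)
  qed (use m in auto)
  moreover have "?B * norm (m - 0) \<le> ?B * 1"
    using m(1) bound[OF m(1)] by (intro mult_left_mono) (auto intro: order.trans[OF norm_ge_zero])
  ultimately show ?thesis using m(2)[OF assms(4)] assms(3) by simp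
qed

text \<open>The solution is defined by solving the equation along the rays \<open>t *\<^sub>R s\<close>. The commutation
  hypothesis makes \<open>g (t *\<^sub>R s) + t *\<^sub>R A (g (t *\<^sub>R s)) h\<close> a solution along the ray of \<open>s + h\<close>
  up to an error of second order in \<open>h\<close>, which gives the derivative of \<open>g\<close>.\<close>
lemma total_differential_equation:
  fixes A :: "'a::euclidean_space \<Rightarrow> 'b::euclidean_space \<Rightarrow>\<^sub>L 'a"
  assumes "open S" and "smooth_on S A" and "x0 \<in> S"
    and comm: "\<And>x u v. x \<in> S \<Longrightarrow>
      blinfun_apply (frechet_derivative A (at x) (A x u)) v = blinfun_apply (frechet_derivative A (at x) (A x v)) u"
  obtains \<epsilon> g where "\<epsilon> > 0" and "g 0 = x0" and "\<And>s. s \<in> ball 0 \<epsilon> \<Longrightarrow> g s \<in> S"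
    and "\<And>s. s \<in> ball 0 \<epsilon> \<Longrightarrow> (g has_derivative blinfun_apply (A (g s))) (at s)"
proof -
  let ?D = "\<lambda>x. frechet_derivative A (at x)"
  obtain R where R: "R > 0" "cball x0 R \<subseteq> S" using assms(1,3) open_contains_cball by blast
  let ?K = "cball x0 R"
  have cont: "continuous_on ?K A"
    by (rule continuous_on_subset[OF smooth_on_imp_continuous_on[OF assms(2)] R(2)])
  have "bounded (A ` ?K)"
    by (rule compact_imp_bounded[OF compact_continuous_image[OF cont compact_cball]])
  then obtain M where "\<forall>x\<in>?K. norm (A x) \<le> M" by (auto simp: bounded_iff)
  then have M: "\<And>x. x \<in> ?K \<Longrightarrow> norm (A x) \<le> M" by (rule bspec)
  have "x0 \<in> ?K" using R(1) by simp
  then have M0: "M \<ge> 0" by (rule order.trans[OF norm_ge_zero M])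
  obtain L1 where "L1 \<ge> 0" and L1: "\<And>x y. x \<in> ?K \<Longrightarrow> y \<in> ?K \<Longrightarrow> norm (A x - A y) \<le> L1 * norm (x - y)"
    using smooth_on_lipschitz[OF assms(2) compact_cball convex_cball R(2)] by metis
  obtain L2 where "L2 \<ge> 0" and L2: "\<And>x u. x \<in> ?K \<Longrightarrow> norm (?D x u) \<le> L2 * norm u"
    using smooth_on_frechet_derivative_bounded[OF assms(2) compact_cball R(2)] by metis
  define L where "L = \<bar>L1\<bar> + \<bar>L2\<bar>"
  have L0: "L \<ge> 0" by (simp add: L_def)
  have L: "norm (A x - A y) \<le> L * norm (x - y)" if "x \<in> ?K" "y \<in> ?K" for x y
    by (rule order.trans[OF L1[OF that]]) (auto simp: L_def intro!: mult_right_mono)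
  have LD: "norm (?D x u) \<le> L * norm u" if "x \<in> ?K" for x u
    by (rule order.trans[OF L2[OF that]]) (auto simp: L_def intro!: mult_right_mono)
  obtain C where C: "C \<ge> 0" "\<And>x y. x \<in> ?K \<Longrightarrow> y \<in> ?K \<Longrightarrow> norm (A y - A x - ?D x (y - x)) \<le> C * (norm (y - x))\<^sup>2"
    using smooth_on_taylor[OF assms(2) compact_cball convex_cball R(2)] by metis
  \<comment> \<open>Chosen to meet both smallness conditions of \<open>ray_solutions\<close>; the
    summands \<open>1\<close> avoid division by zero.\<close>
  define \<epsilon> where "\<epsilon> = min (R / (M + 1)) (1 / (2 * (L + 1)))"
  have \<epsilon>: "\<epsilon> > 0" using R(1) M0 L0 by (simp add: \<epsilon>_def)
  have M\<epsilon>: "M * \<epsilon> \<le> R"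
  proof -
    have "M * \<epsilon> \<le> (M + 1) * (R / (M + 1))" using M0 \<epsilon> by (intro mult_mono) (auto simp: \<epsilon>_def)
    then show ?thesis using M0 by simp
  qed
  have L\<epsilon>: "L * \<epsilon> \<le> 1 / 2"
  proof -
    have "L * \<epsilon> \<le> (L + 1) * (1 / (2 * (L + 1)))" using L0 \<epsilon> by (intro mult_mono) (auto simp: \<epsilon>_def)
    also have "\<dots> = 1 / 2" using L0 by (simp add: field_simps)
    finally show ?thesis .
  qed
  have "\<exists>g. g 0 = x0 \<and> (\<forall>s\<in>cball 0 \<epsilon>. g s \<in> ?K) \<and> (\<forall>s\<in>cball 0 \<epsilon>. \<forall>t\<in>{0..1}.
      ((\<lambda>t. g (t *\<^sub>R s)) has_vector_derivative A (g (t *\<^sub>R s)) s) (at t within {0..1}))"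
    by (rule ray_solutions[OF cont M L R(1) less_imp_le[OF \<epsilon>] L0 M\<epsilon> L\<epsilon>])
  then obtain g where g0: "g 0 = x0" and "\<forall>s\<in>cball 0 \<epsilon>. g s \<in> ?K"
    and "\<forall>s\<in>cball 0 \<epsilon>. \<forall>t\<in>{0..1}.
      ((\<lambda>t. g (t *\<^sub>R s)) has_vector_derivative A (g (t *\<^sub>R s)) s) (at t within {0..1})"
    by (elim exE conjE)
  then have gK: "\<And>s. s \<in> cball 0 \<epsilon> \<Longrightarrow> g s \<in> ?K"
    and gd: "\<And>s t. s \<in> cball 0 \<epsilon> \<Longrightarrow> t \<in> {0..1} \<Longrightarrow>
      ((\<lambda>t. g (t *\<^sub>R s)) has_vector_derivative A (g (t *\<^sub>R s)) s) (at t within {0..1})"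
    by (auto simp del: mem_cball atLeastAtMost_iff)
  have rayK: "g (t *\<^sub>R s) \<in> ?K" if "s \<in> cball 0 \<epsilon>" "t \<in> {0..1}" for s t
  proof -
    have "t * norm s \<le> 1 * \<epsilon>" using that by (intro mult_mono) auto
    then show ?thesis using that by (intro gK) simp
  qed
  \<comment> \<open>The outer \<open>2\<close> comes from \<open>norm_le_of_derivative_le\<close>.
    Inside, \<open>norm (z t - y t) \<le> 2 * (M * norm h)\<close> is inserted once into a Lipschitz
    term and once, squared, into a Taylor remainder.\<close>
  define Q where "Q = 2 * (2 * L * M + 4 * C * M\<^sup>2 * \<epsilon>)"
  have Q0: "Q \<ge> 0" using L0 M0 C(1) \<epsilon> by (simp add: Q_def)
  have main: "norm (g (s + h) - g s - A (g s) h) \<le> Q * (norm h)\<^sup>2"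
    if s: "s \<in> cball 0 \<epsilon>" and sh: "s + h \<in> cball 0 \<epsilon>" for s h
  proof -
    define y z where "y = (\<lambda>t. g (t *\<^sub>R s))" and "z = (\<lambda>t. g (t *\<^sub>R (s + h)))"
    have yd: "(y has_vector_derivative A (y t) s) (at t within {0..1})"
      and zd: "(z has_vector_derivative A (z t) (s + h)) (at t within {0..1})" if "t \<in> {0..1}" for t
      unfolding y_def z_def using gd[OF s that] gd[OF sh that] by auto
    have yK: "y t \<in> ?K" and zK: "z t \<in> ?K" if "t \<in> {0..1}" for t
      unfolding y_def z_def using rayK[OF s that] rayK[OF sh that] by auto
    have ns: "norm s \<le> \<epsilon>" using s by simp
    have absorb: "L * norm w * norm s \<le> norm w / 2" for w :: 'a
    proof -
      have "L * norm w * norm s \<le> L * norm w * \<epsilon>"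
        using ns L0 by (intro mult_left_mono) auto
      also have "\<dots> = (L * \<epsilon>) * norm w" by simp
      also have "\<dots> \<le> 1 / 2 * norm w" using L\<epsilon> by (intro mult_right_mono) auto
      finally show ?thesis by simp
    qed
    \<comment> \<open>A first, crude comparison of neighbouring rays: they differ to first order in
      \<open>h\<close>. This is what makes the Taylor remainder below quadratic in
      \<open>h\<close>.\<close>
    have zy: "norm (z t - y t) \<le> 2 * (M * norm h)" if "t \<in> {0..1}" for t
    proof (rule norm_le_of_derivative_le[OF _ _ _ that])
      fix t :: real assume t: "t \<in> {0..1}"
      show "((\<lambda>t. z t - y t) has_vector_derivative A (z t) (s + h) - A (y t) s) (at t within {0..1})"
        by (intro has_vector_derivative_diff zd yd t)
      have "A (z t) (s + h) - A (y t) s = A (z t) h + (A (z t) - A (y t)) s"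
        by (simp add: blinfun.bilinear_simps)
      also have "norm \<dots> \<le> M * norm h + L * norm (z t - y t) * norm s"
        by (intro order.trans[OF norm_triangle_ineq] add_mono order.trans[OF norm_blinfun]
            mult_right_mono M L zK yK t norm_ge_zero)
      finally show "norm (A (z t) (s + h) - A (y t) s) \<le> M * norm h + norm (z t - y t) / 2"
        using absorb[of "z t - y t"] by linarith
    qed (simp add: y_def z_def)
    define w where "w = (\<lambda>t. y t + t *\<^sub>R A (y t) h)"
    have wd: "(w has_vector_derivative A (y t) s + (A (y t) h + t *\<^sub>R (?D (y t) (A (y t) s)) h)) (at t within {0..1})"
      if t: "t \<in> {0..1}" for t
    proof -
      have yS: "y t \<in> S" using yK[OF t] R(2) by blast
      have "((\<lambda>t. A (y t)) has_vector_derivative ?D (y t) (A (y t) s)) (at t within {0..1})"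
        using has_derivative_compose[OF yd[OF t, unfolded has_vector_derivative_def]
            smooth_on_has_derivative[OF assms(2) yS]]
        by (simp add: has_vector_derivative_def linear_scale[OF has_derivative_linear[OF
            smooth_on_has_derivative[OF assms(2) yS]]])
      then have "((\<lambda>t. A (y t) h) has_vector_derivative blinfun_apply (?D (y t) (A (y t) s)) h) (at t within {0..1})"
        by (rule bounded_linear.has_vector_derivative[OF blinfun.bounded_linear_left])
      then have "((\<lambda>t. t *\<^sub>R A (y t) h) has_vector_derivative (t *\<^sub>R blinfun_apply (?D (y t) (A (y t) s)) h
          + 1 *\<^sub>R A (y t) h)) (at t within {0..1})"
        by (intro has_vector_derivative_scaleR DERIV_ident)
      from has_vector_derivative_add[OF yd[OF t] this] show ?thesis
        by (simp add: w_def add.commute)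
    qed
    have "norm (z 1 - w 1) \<le> 2 * ((2 * L * M + 4 * C * M\<^sup>2 * \<epsilon>) * (norm h)\<^sup>2)"
    proof (rule norm_le_of_derivative_le)
      fix t :: real assume t: "t \<in> {0..1}"
      let ?e' = "A (z t) (s + h) - (A (y t) s + (A (y t) h + t *\<^sub>R (?D (y t) (A (y t) s)) h))"
      show "((\<lambda>t. z t - w t) has_vector_derivative ?e') (at t within {0..1})"
        by (intro has_vector_derivative_diff zd wd t)
      have yS: "y t \<in> S" using yK[OF t] R(2) by blast
      note lin = has_derivative_linear[OF smooth_on_has_derivative[OF assms(2) yS]]
      \<comment> \<open>By \<open>comm\<close> the last term of \<open>?e'\<close> is the derivative
        of \<open>A\<close> in direction \<open>t *\<^sub>R A (y t) h\<close>, that is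
        \<open>w t - y t\<close>, applied to \<open>s\<close>. Splitting this direction as
        \<open>(z t - y t) - (z t - w t)\<close> leaves an increment of \<open>A\<close>, a Taylor
        remainder and a term linear in the error \<open>z t - w t\<close>.\<close>
      have "?e' = blinfun_apply (A (z t) - A (y t)) h + blinfun_apply (A (z t) - A (y t) - ?D (y t) (z t - y t)) s
          + blinfun_apply (?D (y t) (z t - w t)) s"
        by (simp add: w_def linear_diff[OF lin] linear_add[OF lin] linear_scale[OF lin]
            blinfun.bilinear_simps comm[OF yS])
      also have "norm \<dots> \<le> L * norm (z t - y t) * norm h + C * (norm (z t - y t))\<^sup>2 * norm s
          + L * norm (z t - w t) * norm s"
        by (intro order.trans[OF norm_triangle_ineq] add_mono order.trans[OF norm_blinfun]
            mult_right_mono LD C(2) L zK yK t norm_ge_zero)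
      also have "\<dots> \<le> L * (2 * (M * norm h)) * norm h + C * (2 * (M * norm h))\<^sup>2 * \<epsilon> + norm (z t - w t) / 2"
        using L0 M0 C(1) \<epsilon> zy[OF t] ns
        by (intro add_mono absorb mult_mono power_mono) auto
      finally show "norm ?e' \<le> (2 * L * M + 4 * C * M\<^sup>2 * \<epsilon>) * (norm h)\<^sup>2 + norm (z t - w t) / 2"
        by (simp add: power2_eq_square algebra_simps)
    qed (auto simp: y_def z_def w_def)
    then have "norm (z 1 - w 1) \<le> Q * (norm h)\<^sup>2" by (simp only: Q_def mult.assoc)
    then show ?thesis by (simp add: y_def z_def w_def diff_diff_eq)
  qed
  show thesis
  proof
    show "\<epsilon> > 0" "g 0 = x0" by fact+
    fix s :: 'b assume s: "s \<in> ball 0 \<epsilon>"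
    then show "g s \<in> S" using gK[of s] R(2) by auto
    show "(g has_derivative blinfun_apply (A (g s))) (at s)"
      unfolding has_derivative_at_alt
    proof (intro conjI allI impI)
      show "bounded_linear (blinfun_apply (A (g s)))" by (rule blinfun.bounded_linear_right)
      fix e :: real assume e: "e > 0"
      define d where "d = min (\<epsilon> - norm s) (e / (Q + 1))"
      have "d > 0" using s e Q0 by (simp add: d_def)
      moreover have "norm (g s' - g s - A (g s) (s' - s)) \<le> e * norm (s' - s)" if "norm (s' - s) < d" for s'
      proof -
        have "norm s' \<le> norm s + norm (s' - s)" by (metis add.commute diff_add_cancel norm_triangle_ineq)
        then have "norm s' \<le> \<epsilon>" using that by (simp add: d_def)
        then have "norm (g s' - g s - A (g s) (s' - s)) \<le> (Q * norm (s' - s)) * norm (s' - s)"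
          using main[of s "s' - s"] s by (simp add: power2_eq_square mult.assoc)
        also have "\<dots> \<le> e * norm (s' - s)"
        proof (rule mult_right_mono)
          have "Q * norm (s' - s) \<le> (Q + 1) * (e / (Q + 1))"
            using that Q0 by (intro mult_mono) (auto simp: d_def)
          then show "Q * norm (s' - s) \<le> e" using Q0 by simp
        qed simp
        finally show ?thesis .
      qed
      ultimately show "\<exists>d>0. \<forall>s'. norm (s' - s) < d \<longrightarrow>
          norm (g s' - g s - A (g s) (s' - s)) \<le> e * norm (s' - s)" by blast
    qed
  qed
qed

text \<open>Bootstrapping: if \<open>g\<close> is of order \<open>k\<close>, so is
  \<open>A (g s)\<close>; as this is the derivative of \<open>g\<close>, the order of
  \<open>g\<close> rises by one.\<close>

lemma total_differential_equation_smooth: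
  fixes A :: "'a::euclidean_space \<Rightarrow> 'b::euclidean_space \<Rightarrow>\<^sub>L 'a"
  assumes "open T" and "smooth_on S A" and "g ` T \<subseteq> S"
    and "\<And>s. s \<in> T \<Longrightarrow> (g has_derivative blinfun_apply (A (g s))) (at s)"
  shows "smooth_on T g"
  unfolding smooth_on_def
proof
  fix k show "k_times_differentiable k g T"
  proof (induction k)
    case 0
    then show ?case
      using assms(1,4) by (auto intro!: continuous_at_imp_continuous_on has_derivative_continuous)
  next
    case (Suc k)
    have "k_times_differentiable k A S" using assms(2) by (simp add: smooth_on_def)
    then have "k_times_differentiable k (\<lambda>s. A (g s)) T"
      by (rule k_times_differentiable_compose[OF assms(1) _ Suc assms(3)])
    then show ?case
      by (intro k_times_differentiable_SucI[OF assms(1,4)]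
          k_times_differentiable_linear[OF assms(1) _ blinfun.bounded_linear_left])
  qed
qed

section \<open>Local integral manifolds\<close>

lemma smooth_on_vec_nth: "open S \<Longrightarrow> smooth_on S f \<Longrightarrow> smooth_on S (\<lambda>x. f x $ i)"
  by (rule smooth_on_linear[OF _ _ bounded_linear_vec_nth])

lemma smooth_on_componentwise:
  fixes f :: "'a::real_normed_vector \<Rightarrow> real^'n::finite"
  assumes "open S" and "\<And>i. smooth_on S (\<lambda>x. f x $ i)"
  shows "smooth_on S f"
proof (rule smooth_on_cong[OF assms(1)])
  show "smooth_on S (\<lambda>x. \<Sum>i\<in>UNIV. (f x $ i) *\<^sub>R axis i 1)"
    by (intro smooth_on_sum smooth_on_scaleR smooth_on_const assms)
  show "(\<Sum>i\<in>UNIV. (f x $ i) *\<^sub>R axis i 1) = f x" for x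
    using basis_expansion[of "f x"] by (simp add: scalar_mult_eq_scaleR)
qed

lemma smooth_on_det:
  fixes M :: "'a::real_normed_vector \<Rightarrow> real^'n::finite^'n"
  assumes "open S" and "\<And>i j. smooth_on S (\<lambda>x. M x $ i $ j)"
  shows "smooth_on S (\<lambda>x. det (M x))"
  unfolding det_def by (intro smooth_on_sum smooth_on_mult smooth_on_const smooth_on_prod assms)

text \<open>Cramer's rule writes the solution as a quotient of determinants, which are polynomials
  in the smooth matrix entries.\<close>

lemma smooth_on_linear_solution:
  fixes B :: "'a::real_normed_vector \<Rightarrow> real^'n::finite \<Rightarrow> real^'n"
  assumes "open S" and "\<And>v. smooth_on S (\<lambda>x. B x v)" and "\<And>x. x \<in> S \<Longrightarrow> linear (B x)"
    and "\<And>x. x \<in> S \<Longrightarrow> det (matrix (B x)) \<noteq> 0" and "\<And>x. x \<in> S \<Longrightarrow> B x (w x) = b"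
  shows "smooth_on S w"
proof -
  let ?M = "\<lambda>x. matrix (B x)"
  have M: "smooth_on S (\<lambda>x. ?M x $ i $ j)" for i j
    by (simp add: matrix_def smooth_on_vec_nth assms)
  let ?c = "\<lambda>k x. det (\<chi> i j. if j = k then b $ i else ?M x $ i $ j) * inverse (det (?M x))"
  have entry: "smooth_on S (\<lambda>x. (\<chi> i j. if j = k then b $ i else ?M x $ i $ j) $ i $ j)" for i j k
    by (cases "j = k") (auto intro: smooth_on_const assms(1) M)
  have c: "smooth_on S (?c k)" for k
    by (intro smooth_on_mult smooth_on_inverse_real smooth_on_det assms(1) M entry assms(4))
  show ?thesis
  proof (rule smooth_on_componentwise[OF assms(1)], rule smooth_on_cong[OF assms(1) _ c])
    fix k x assume x: "x \<in> S"
    have "?M x *v w x = b"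
      using assms(5)[OF x] matrix_vector_mul(2)[OF assms(3)[OF x]] by metis
    then have "w x = (\<chi> k. det (\<chi> i j. if j = k then b $ i else ?M x $ i $ j) / det (?M x))"
      using cramer[OF assms(4)[OF x]] by blast
    then show "?c k x = w x $ k" by (simp add: divide_inverse)
  qed
qed

text \<open>In a finite-dimensional domain an operator is a finite sum of rank-one operators built
  from its values on a basis, so smoothness of these values gives smoothness in the operator
  norm.\<close>

lemma smooth_on_blinfun:
  fixes A :: "'a::real_normed_vector \<Rightarrow> 'b::euclidean_space \<Rightarrow>\<^sub>L 'c::real_normed_vector"
  assumes "open S" and "\<And>v. smooth_on S (\<lambda>x. A x v)"
  shows "smooth_on S A"
proof (rule smooth_on_cong[OF assms(1)])
  show "smooth_on S (\<lambda>x. \<Sum>i\<in>Basis. blinfun_scaleR_left (A x i) o\<^sub>L blinfun_inner_left i)"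
    by (intro smooth_on_sum assms(1) smooth_on_linear[OF _ assms(2),
          where h = "\<lambda>y. blinfun_scaleR_left y o\<^sub>L blinfun_inner_left _"]
        bounded_linear_compose[OF bounded_bilinear.bounded_linear_left[OF bounded_bilinear_blinfun_compose]
          bounded_linear_blinfun_scaleR_left])
  show "(\<Sum>i\<in>Basis. blinfun_scaleR_left (A x i) o\<^sub>L blinfun_inner_left i) = A x" for x
  proof (rule blinfun_eqI)
    fix v
    show "blinfun_apply (\<Sum>i\<in>Basis. blinfun_scaleR_left (A x i) o\<^sub>L blinfun_inner_left i) v = A x v"
      using linear_eq_sum_Basis[OF bounded_linear.linear[OF blinfun.bounded_linear_right], of "A x" v]
      by (simp add: blinfun.sum_left)
  qed
qed

text \<open>The product rule for a tensor that is known to be smooth only on each fixed vector. The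
  first term freezes the argument at \<open>a x\<close>; in this form derivatives of
  \<open>F\<close> enter the pointwise condition.\<close>

lemma has_derivative_apply_linear:
  fixes F :: "'a::real_normed_vector \<Rightarrow> 'b::euclidean_space \<Rightarrow> 'c::real_normed_vector"
  assumes "open S" and "x \<in> S" and "\<And>y. y \<in> S \<Longrightarrow> linear (F y)" and "\<And>v. smooth_on S (\<lambda>y. F y v)"
    and "(a has_derivative a') (at x)"
  shows "((\<lambda>y. F y (a y)) has_derivative
    (\<lambda>w. frechet_derivative (\<lambda>y. F y (a x)) (at x) w + F x (a' w))) (at x)"
proof -
  let ?D = "\<lambda>v. frechet_derivative (\<lambda>y. F y v) (at x)"
  have D: "((\<lambda>y. F y v) has_derivative ?D v) (at x)" for v
    by (rule smooth_on_has_derivative[OF assms(4,2)])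
  have expand: "(\<Sum>j\<in>Basis. (v \<bullet> j) *\<^sub>R F y j) = F y v" if "y \<in> S" for y v
    by (rule linear_eq_sum_Basis[OF assms(3)[OF that], symmetric])
  have "((\<lambda>y. \<Sum>j\<in>Basis. (a x \<bullet> j) *\<^sub>R F y j) has_derivative
      (\<lambda>w. \<Sum>j\<in>Basis. (a x \<bullet> j) *\<^sub>R ?D j w)) (at x)"
    by (intro has_derivative_sum has_derivative_scaleR_right D)
  then have "((\<lambda>y. F y (a x)) has_derivative (\<lambda>w. \<Sum>j\<in>Basis. (a x \<bullet> j) *\<^sub>R ?D j w)) (at x)"
    by (rule has_derivative_transform_within_open[OF _ assms(1,2) expand])
  then have eq: "?D (a x) = (\<lambda>w. \<Sum>j\<in>Basis. (a x \<bullet> j) *\<^sub>R ?D j w)"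
    using D has_derivative_unique by blast
  have "((\<lambda>y. \<Sum>j\<in>Basis. (a y \<bullet> j) *\<^sub>R F y j) has_derivative
      (\<lambda>w. \<Sum>j\<in>Basis. (a x \<bullet> j) *\<^sub>R ?D j w + (a' w \<bullet> j) *\<^sub>R F x j)) (at x)"
    by (intro has_derivative_sum has_derivative_scaleR D has_derivative_inner_left assms(5))
  then have "((\<lambda>y. F y (a y)) has_derivative
      (\<lambda>w. \<Sum>j\<in>Basis. (a x \<bullet> j) *\<^sub>R ?D j w + (a' w \<bullet> j) *\<^sub>R F x j)) (at x)"
    by (rule has_derivative_transform_within_open[OF _ assms(1,2) expand])
  then show ?thesis
    by (simp add: eq sum.distrib expand[OF assms(2)])
qed

text \<open>If \<open>P\<close> is the value of the projection at the base point, then every nearby fibre of the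
  distribution projects isomorphically under \<open>P\<close>; \<open>a x\<close> inverts this projection. Hence the fields
  \<open>a v\<close> commute: their bracket lies in the distribution and is annihilated by \<open>P\<close>.\<close>
lemma commuting_frame:
  fixes F m :: "real^'n::finite \<Rightarrow> real^'n \<Rightarrow> real^'n"
  assumes "open S" and "x0 \<in> S"
    and linF: "\<And>x. x \<in> S \<Longrightarrow> linear (F x)" and smF: "\<And>v. smooth_on S (\<lambda>x. F x v)"
    and linm: "\<And>x. x \<in> S \<Longrightarrow> linear (m x)" and smm: "\<And>v. smooth_on S (\<lambda>x. m x v)"
    and Fm: "\<And>x v. x \<in> S \<Longrightarrow> F x (m x v) = 0" and mF: "\<And>x v. x \<in> S \<Longrightarrow> F x v = 0 \<Longrightarrow> m x v = v"
    and sym: "\<And>x u w. x \<in> S \<Longrightarrow> F x u = 0 \<Longrightarrow> F x w = 0 \<Longrightarrow>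
      frechet_derivative (\<lambda>y. F y u) (at x) w = frechet_derivative (\<lambda>y. F y w) (at x) u"
  obtains T and A :: "real^'n \<Rightarrow> (real^'n) \<Rightarrow>\<^sub>L (real^'n)"
  where "open T" and "x0 \<in> T" and "T \<subseteq> S" and "smooth_on T A"
    and "\<And>x v. x \<in> T \<Longrightarrow> F x (A x v) = 0"
    and "\<And>x v. x \<in> T \<Longrightarrow> F x v = 0 \<Longrightarrow> A x v = v"
    and "\<And>x v. x \<in> T \<Longrightarrow> m x0 (A x v) = m x0 v"
    and "\<And>x v. x \<in> T \<Longrightarrow> A x (m x0 v) = A x v"
    and "\<And>x u v. x \<in> T \<Longrightarrow> blinfun_apply (frechet_derivative A (at x) (A x u)) v
      = blinfun_apply (frechet_derivative A (at x) (A x v)) u"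
proof -
  define P where "P = m x0"
  have linP: "linear P" unfolding P_def by (rule linm[OF assms(2)])
  have blP: "bounded_linear P" using linP by (simp add: linear_conv_bounded_linear)
  have mm: "m x (m x v) = m x v" if "x \<in> S" for x v by (rule mF[OF that Fm[OF that]])
  have PP: "P (P v) = P v" for v unfolding P_def by (rule mm[OF assms(2)])
  \<comment> \<open>The operator \<open>P m + (1 - P) (1 - m)\<close>, the usual intertwiner of two
    nearby projections: \<open>P (B x v) = B x (m x v)\<close>. It is the identity at
    \<open>x0\<close>, hence invertible nearby.\<close>
  define B where "B x v = P (m x v) + (v - m x v - P (v - m x v))" for x v
  have linB: "linear (B x)" if "x \<in> S" for x
    unfolding B_def
    by (intro linear_compose_add linear_compose_sub linear_compose[OF _ linP, unfolded o_def]
        linm[OF that] linear_ident[unfolded id_def])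
  have smB: "smooth_on S (\<lambda>x. B x v)" for v
    unfolding B_def
    by (intro smooth_on_add smooth_on_diff smooth_on_linear[OF _ _ blP] smooth_on_const smm assms(1))
  have PB: "P (B x v) = P (m x v)" if "x \<in> S" for x v
    by (simp only: B_def linear_add[OF linP] linear_diff[OF linP] PP) simp
  have Bm: "B x (m x v) = P (m x v)" if "x \<in> S" for x v
    using mm[OF that] by (simp add: B_def linear_0[OF linP])
  define T where "T = {x \<in> S. det (matrix (B x)) \<noteq> 0}"
  have "smooth_on S (\<lambda>x. det (matrix (B x)))"
    by (rule smooth_on_det[OF assms(1)]) (simp add: matrix_def smooth_on_vec_nth assms(1) smB)
  then have "open (S \<inter> (\<lambda>x. det (matrix (B x))) -` (- {0}))"
    by (intro continuous_open_preimage smooth_on_imp_continuous_on assms(1)) auto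
  moreover have "T = S \<inter> (\<lambda>x. det (matrix (B x))) -` (- {0})" by (auto simp: T_def)
  ultimately have openT: "open T" by simp
  have TS: "T \<subseteq> S" by (auto simp: T_def)
  have inj: "inj (B x)" if "x \<in> T" for x
    using that det_nz_iff_inj[OF linB] by (auto simp: T_def)
  have surj: "surj (B x)" if "x \<in> T" for x
    using linear_injective_imp_surjective[OF linB inj] that TS by auto
  have "B x0 = id"
    by (auto simp: B_def fun_eq_iff PP linear_diff[OF linP] simp flip: P_def)
  then have "x0 \<in> T" using assms(2) by (simp add: T_def matrix_id_mat_1 flip: id_def)
  \<comment> \<open>\<open>P v\<close> is fixed by \<open>P\<close>, so by the intertwining its
    preimage under \<open>B x\<close> is fixed by \<open>m x\<close>, hence lies in the fibre at
    \<open>x\<close>, and it projects back to \<open>P v\<close>.\<close>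
  define a where "a x v = inv (B x) (P v)" for x v
  have Ba: "B x (a x v) = P v" if "x \<in> T" for x v
    unfolding a_def by (rule surj_f_inv_f[OF surj[OF that]])
  have B_eqD: "u = v" if "x \<in> T" "B x u = B x v" for x u v
    using inj[OF that(1)] that(2) by (rule injD)
  have ma: "m x (a x v) = a x v" if "x \<in> T" for x v
  proof (rule B_eqD[OF that])
    have "B x (m x (a x v)) = P (B x (a x v))" using PB Bm that TS by auto
    then show "B x (m x (a x v)) = B x (a x v)" using Ba[OF that] PP by simp
  qed
  have Fa: "F x (a x v) = 0" if "x \<in> T" for x v
    using Fm[of x "a x v"] ma[OF that] that TS by auto
  have Pa: "P (a x v) = P v" if "x \<in> T" for x v
  proof -
    have "P (a x v) = P (B x (a x v))" using PB[of x "a x v"] ma[OF that] that TS by auto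
    then show ?thesis using Ba[OF that] PP by simp
  qed
  have a_ker: "a x v = v" if "x \<in> T" "F x v = 0" for x v
    by (rule B_eqD[OF that(1)]) (use Ba[OF that(1)] Bm[of x v] mF[of x v] that TS in auto)
  have lina: "linear (a x)" if "x \<in> T" for x
  proof -
    have lB: "linear (B x)" using linB that TS by blast
    show ?thesis
      by (rule linearI; rule B_eqD[OF that])
         (simp_all add: Ba[OF that] linear_add[OF lB] linear_scale[OF lB] linear_add[OF linP] linear_scale[OF linP])
  qed
  have sma: "smooth_on T (\<lambda>x. a x v)" for v
    by (rule smooth_on_linear_solution[OF openT smooth_on_subset[OF smB TS] linB _ Ba])
       (auto simp: T_def)
  define A where "A x = Blinfun (a x)" for x
  have A: "blinfun_apply (A x) = a x" if "x \<in> T" for x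
    unfolding A_def using lina[OF that] by (simp add: bounded_linear_Blinfun_apply linear_conv_bounded_linear)
  have smA: "smooth_on T A"
    by (rule smooth_on_blinfun[OF openT], rule smooth_on_cong[OF openT _ sma]) (simp add: A)
  have DA: "blinfun_apply (frechet_derivative A (at x) w) v = frechet_derivative (\<lambda>y. a y v) (at x) w"
    if "x \<in> T" for x v w
  proof -
    have "((\<lambda>y. A y v) has_derivative (\<lambda>w. blinfun_apply (frechet_derivative A (at x) w) v)) (at x)"
      by (rule bounded_linear.has_derivative[OF blinfun.bounded_linear_left
            smooth_on_has_derivative[OF smA that]])
    then have "((\<lambda>y. a y v) has_derivative (\<lambda>w. blinfun_apply (frechet_derivative A (at x) w) v)) (at x)"
      by (rule has_derivative_transform_within_open[OF _ openT that]) (simp add: A)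
    from frechet_derivative_at[OF this] show ?thesis by metis
  qed
  have commute: "frechet_derivative (\<lambda>y. a y v) (at x) (a x u) = frechet_derivative (\<lambda>y. a y u) (at x) (a x v)"
    if x: "x \<in> T" for x u v
  proof -
    let ?D = "\<lambda>v. frechet_derivative (\<lambda>y. a y v) (at x)"
    have xS: "x \<in> S" using x TS by blast
    have D: "((\<lambda>y. a y v) has_derivative ?D v) (at x)" for v
      by (rule smooth_on_has_derivative[OF sma x])
    have F0: "frechet_derivative (\<lambda>y. F y (a x v)) (at x) w + F x (?D v w) = 0" for v w
    proof -
      have "((\<lambda>y. 0) has_derivative (\<lambda>w. frechet_derivative (\<lambda>y. F y (a x v)) (at x) w + F x (?D v w))) (at x)"
        by (rule has_derivative_transform_within_open[OF
              has_derivative_apply_linear[OF assms(1) xS linF smF D] openT x Fa])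
      from has_derivative_unique[OF this has_derivative_const] show ?thesis by metis
    qed
    have P0: "P (?D v w) = 0" for v w
    proof -
      have "((\<lambda>y. P v) has_derivative (\<lambda>w. P (?D v w))) (at x)"
        by (rule has_derivative_transform_within_open[OF bounded_linear.has_derivative[OF blP D] openT x Pa])
      from has_derivative_unique[OF this has_derivative_const] show ?thesis by metis
    qed
    \<comment> \<open>The bracket of two frame fields. \<open>F x\<close> kills it by
      differentiating \<open>F y (a y v) = 0\<close> and using \<open>sym\<close>; \<open>P\<close>
      kills it because \<open>P (a y v)\<close> does not depend on \<open>y\<close>. A fibre vector
      killed by \<open>P\<close> is \<open>0\<close>, as \<open>a x\<close> recovers it from its
      projection.\<close>
    let ?\<delta> = "?D v (a x u) - ?D u (a x v)"
    have "F x ?\<delta> = F x (?D v (a x u)) - F x (?D u (a x v))" by (rule linear_diff[OF linF[OF xS]])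
    also have "\<dots> = 0"
      using F0[of v "a x u"] F0[of u "a x v"] sym[OF xS Fa[OF x, of v] Fa[OF x, of u]]
      by (simp add: add_eq_0_iff)
    finally have "?\<delta> = a x ?\<delta>" using a_ker[OF x] by simp
    also have "\<dots> = 0"
    proof (rule B_eqD[OF x])
      have "P ?\<delta> = 0" using P0 linear_diff[OF linP] by simp
      moreover have "B x 0 = 0" by (rule linear_0[OF linB[OF xS]])
      ultimately show "B x (a x ?\<delta>) = B x 0" using Ba[OF x] by simp
    qed
    finally show ?thesis by simp
  qed
  show thesis
  proof (rule that[OF openT \<open>x0 \<in> T\<close> TS smA])
    show "F x (A x v) = 0" "m x0 (A x v) = m x0 v" "A x (m x0 v) = A x v" if "x \<in> T" for x v
      using Fa[OF that] Pa[OF that] PP by (simp_all add: A[OF that] a_def flip: P_def)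
    show "A x v = v" if "x \<in> T" "F x v = 0" for x v using a_ker[OF that] by (simp add: A[OF that(1)])
    show "blinfun_apply (frechet_derivative A (at x) (A x u)) v = blinfun_apply (frechet_derivative A (at x) (A x v)) u"
      if "x \<in> T" for x u v
      using commute[OF that] by (simp add: DA[OF that] A[OF that])
  qed
qed

text \<open>The solution \<open>g\<close> parametrises the integral manifold as a graph over the fibre \<open>E\<close> at the base
  point, and the chart is the shear that flattens this graph; so no inverse function theorem is
  needed.\<close>
lemma local_frobenius:
  fixes F m :: "real^'n::finite \<Rightarrow> real^'n \<Rightarrow> real^'n"
  assumes "open S" and "x0 \<in> S"
    and linF: "\<And>x. x \<in> S \<Longrightarrow> linear (F x)" and smF: "\<And>v. smooth_on S (\<lambda>x. F x v)"
    and linm: "\<And>x. x \<in> S \<Longrightarrow> linear (m x)" and smm: "\<And>v. smooth_on S (\<lambda>x. m x v)"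
    and Fm: "\<And>x v. x \<in> S \<Longrightarrow> F x (m x v) = 0" and mF: "\<And>x v. x \<in> S \<Longrightarrow> F x v = 0 \<Longrightarrow> m x v = v"
    and sym: "\<And>x u w. x \<in> S \<Longrightarrow> F x u = 0 \<Longrightarrow> F x w = 0 \<Longrightarrow>
      frechet_derivative (\<lambda>y. F y u) (at x) w = frechet_derivative (\<lambda>y. F y w) (at x) u"
  obtains E U and \<psi> \<psi>' :: "real^'n \<Rightarrow> real^'n"
  where "subspace E" and "open U" and "x0 \<in> U" and "U \<subseteq> S" and "open (\<psi> ` U)"
    and "smooth_on U \<psi>" and "smooth_on (\<psi> ` U) \<psi>'" and "\<And>x. x \<in> U \<Longrightarrow> \<psi>' (\<psi> x) = x" and "\<psi> x0 \<in> E"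
    and "\<And>x. x \<in> U \<Longrightarrow> \<psi> x \<in> E \<Longrightarrow> frechet_derivative \<psi> (at x) ` {v. F x v = 0} = E"
proof -
  obtain T and A :: "real^'n \<Rightarrow> (real^'n) \<Rightarrow>\<^sub>L (real^'n)"
    where T: "open T" "x0 \<in> T" "T \<subseteq> S" and smA: "smooth_on T A"
    and FA: "\<And>x v. x \<in> T \<Longrightarrow> F x (A x v) = 0"
    and A_ker: "\<And>x v. x \<in> T \<Longrightarrow> F x v = 0 \<Longrightarrow> A x v = v"
    and PA: "\<And>x v. x \<in> T \<Longrightarrow> m x0 (A x v) = m x0 v"
    and AP: "\<And>x v. x \<in> T \<Longrightarrow> A x (m x0 v) = A x v"
    and comm: "\<And>x u v. x \<in> T \<Longrightarrow> blinfun_apply (frechet_derivative A (at x) (A x u)) v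
      = blinfun_apply (frechet_derivative A (at x) (A x v)) u"
    by (rule commuting_frame[OF assms]; (assumption | (rule that; (assumption | iprover))))
  obtain \<epsilon> g where \<epsilon>: "\<epsilon> > 0" and g0: "g 0 = x0" and gT: "\<And>s. s \<in> ball 0 \<epsilon> \<Longrightarrow> g s \<in> T"
    and gd: "\<And>s. s \<in> ball 0 \<epsilon> \<Longrightarrow> (g has_derivative blinfun_apply (A (g s))) (at s)"
    by (rule total_differential_equation[OF T(1) smA T(2) comm];
        (assumption | (rule that; (assumption | iprover))))
  have smg: "smooth_on (ball 0 \<epsilon>) g"
    by (rule total_differential_equation_smooth[OF open_ball smA _ gd]) (use gT in auto)
  define P where "P = m x0"
  have linP: "linear P" unfolding P_def by (rule linm[OF assms(2)])
  have blP: "bounded_linear P" using linP by (simp add: linear_conv_bounded_linear)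
  have PP: "P (P v) = P v" for v unfolding P_def by (rule mF[OF assms(2) Fm[OF assms(2)]])
  \<comment> \<open>\<open>P (A x v) = P v\<close> makes the derivative of
    \<open>P (g s) - P s\<close> zero on the ball, so the mean value inequality with constant
    \<open>0\<close> applies.\<close>
  have Pg: "P (g s) = P x0 + P s" if s: "s \<in> ball 0 \<epsilon>" for s
  proof -
    have "norm ((P (g s) - P s) - (P (g 0) - P 0)) \<le> 0 * norm (s - 0)"
    proof (rule norm_diff_le_of_derivative_bound[where S = "ball 0 \<epsilon>"])
      fix t :: "real^'n" assume t: "t \<in> ball 0 \<epsilon>"
      show "((\<lambda>s. P (g s) - P s) has_derivative (\<lambda>v. P (A (g t) v) - P v)) (at t within ball 0 \<epsilon>)"
        by (intro has_derivative_diff bounded_linear.has_derivative[OF blP] has_derivative_at_withinI[OF gd[OF t]]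
            has_derivative_ident)
      show "norm (P (A (g t) v) - P v) \<le> 0 * norm v" for v
        using PA[OF gT[OF t]] by (simp add: P_def)
    qed (use s \<epsilon> in auto)
    then show ?thesis by (simp add: g0 linear_0[OF linP] algebra_simps)
  qed
  define h where "h s = g s - s" for s
  have smh: "smooth_on (ball 0 \<epsilon>) h"
    unfolding h_def by (intro smooth_on_diff smooth_on_id smg open_ball)
  have Ph: "P (h s) = P x0" if "s \<in> ball 0 \<epsilon>" for s
    using Pg[OF that] by (simp add: h_def linear_diff[OF linP])
  define E where "E = range P"
  have E: "v \<in> E \<longleftrightarrow> P v = v" for v unfolding E_def by (metis PP rangeE rangeI)
  define U where "U = {x \<in> S. P (x - x0) \<in> ball 0 \<epsilon>}"
  \<comment> \<open>\<open>P (h s) = P x0\<close> is constant, so subtracting \<open>h\<close>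
    shifts the \<open>P\<close>-component by a constant only. Hence \<open>P (\<psi> x)\<close>
    still reveals the argument at which \<open>h\<close> was evaluated, and adding \<open>h\<close>
    back inverts the map.\<close>
  define \<psi> where "\<psi> x = x - h (P (x - x0))" for x
  define \<psi>' where "\<psi>' z = z + h (P z)" for z
  have contP: "continuous_on X P" for X
    by (rule linear_continuous_on[OF blP])
  have P\<psi>: "P (\<psi> x) = P (x - x0)" if "x \<in> U" for x
    using Ph[of "P (x - x0)"] that by (simp add: \<psi>_def U_def linear_diff[OF linP])
  have inv: "\<psi>' (\<psi> x) = x" if "x \<in> U" for x
    unfolding \<psi>'_def P\<psi>[OF that] by (simp add: \<psi>_def)
  let ?W = "P -` ball 0 \<epsilon>"
  have openW: "open ?W"
    using continuous_on_open_vimage[OF open_UNIV, of P] contP by auto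
  have sm\<psi>': "smooth_on ?W \<psi>'"
    unfolding \<psi>'_def
    by (intro smooth_on_add smooth_on_id openW smooth_on_compose[OF _ smh] smooth_on_linear[OF _ _ blP]) auto
  have surj: "\<psi>' z \<in> U \<and> \<psi> (\<psi>' z) = z" if "z \<in> ?W" "\<psi>' z \<in> S" for z
  proof -
    have "P (\<psi>' z - x0) = P z"
      using Ph[of "P z"] that PP by (simp add: \<psi>'_def linear_diff[OF linP] linear_add[OF linP])
    then show ?thesis using that by (simp add: U_def \<psi>_def) (simp add: \<psi>'_def)
  qed
  \<comment> \<open>The image is described through the explicit inverse, as a preimage of an open
    set under the continuous map \<open>\<psi>'\<close>; this yields its openness.\<close>
  have img: "\<psi> ` U = ?W \<inter> \<psi>' -` S"
  proof (intro equalityI subsetI)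
    show "z \<in> ?W \<inter> \<psi>' -` S" if "z \<in> \<psi> ` U" for z
      using that P\<psi> inv by (auto simp: U_def)
    show "z \<in> \<psi> ` U" if "z \<in> ?W \<inter> \<psi>' -` S" for z
      using surj[of z] that by (metis IntE image_eqI vimageE)
  qed
  have openU: "open U"
  proof -
    have "open (S \<inter> (\<lambda>x. P (x - x0)) -` ball 0 \<epsilon>)"
      by (intro continuous_open_preimage assms(1) open_ball continuous_on_compose2[OF contP[of UNIV]]
          continuous_on_diff continuous_on_id continuous_on_const subset_UNIV)
    moreover have "U = S \<inter> (\<lambda>x. P (x - x0)) -` ball 0 \<epsilon>" by (auto simp: U_def)
    ultimately show ?thesis by simp
  qed
  have sm\<psi>: "smooth_on U \<psi>"
    unfolding \<psi>_def
    by (intro smooth_on_diff smooth_on_id openU smooth_on_compose[OF _ smh] smooth_on_linear[OF _ _ blP]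
        smooth_on_const) (auto simp: U_def)
  show thesis
  proof (rule that[of E U \<psi> \<psi>'])
    show "open U" "smooth_on U \<psi>" by (fact openU, fact sm\<psi>)
    show "\<psi>' (\<psi> x) = x" if "x \<in> U" for x by (rule inv[OF that])
    show "subspace E" unfolding E_def using linP subspace_UNIV by (rule linear_subspace_image)
    show "x0 \<in> U" using assms(2) \<epsilon> by (simp add: U_def linear_0[OF linP])
    show "U \<subseteq> S" by (auto simp: U_def)
    show "open (\<psi> ` U)"
      unfolding img by (rule continuous_open_preimage[OF smooth_on_imp_continuous_on[OF sm\<psi>'] openW assms(1)])
    show "smooth_on (\<psi> ` U) \<psi>'" by (rule smooth_on_subset[OF sm\<psi>']) (auto simp: img)
    have "\<psi> x0 = 0" by (simp add: \<psi>_def linear_0[OF linP] h_def g0)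
    then show "\<psi> x0 \<in> E" by (simp add: E linear_0[OF linP])
    fix x assume x: "x \<in> U" "\<psi> x \<in> E"
    define s where "s = \<psi> x"
    have Ps: "P s = s" using x(2) by (simp add: s_def E)
    have s: "s \<in> ball 0 \<epsilon>" using P\<psi>[OF x(1)] x(1) Ps by (simp add: s_def U_def)
    have xs: "x = g s" using inv[OF x(1)] Ps by (simp add: \<psi>'_def h_def flip: s_def)
    have xT: "x \<in> T" using gT[OF s] xs by simp
    have D\<psi>: "(\<psi> has_derivative frechet_derivative \<psi> (at x)) (at x)"
      by (rule smooth_on_has_derivative[OF sm\<psi> x(1)])
    \<comment> \<open>The shear undoes the parametrisation: \<open>\<psi> (g (P t)) = P t\<close>.
      Without the inner \<open>P\<close> such an identity would hold only for \<open>t\<close> in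
      \<open>E\<close>; with it, it holds on an open set and can be differentiated at
      \<open>s\<close>.\<close>
    have "frechet_derivative \<psi> (at x) (A x v) = P v" for v
    proof -
      have "((\<lambda>t. g (P t)) has_derivative (\<lambda>v. A x (P v))) (at s)"
        using has_derivative_compose[OF bounded_linear.has_derivative[OF blP has_derivative_ident], of g "A x"]
          gd[OF s] Ps xs by simp
      then have "((\<lambda>t. \<psi> (g (P t))) has_derivative (\<lambda>v. frechet_derivative \<psi> (at x) (A x (P v)))) (at s)"
        using has_derivative_compose[of "\<lambda>t. g (P t)" _ s UNIV \<psi>] D\<psi> Ps xs by simp
      then have "(P has_derivative (\<lambda>v. frechet_derivative \<psi> (at x) (A x (P v)))) (at s)"
      proof (rule has_derivative_transform_within_open[OF _ openW])
        show "s \<in> ?W" using s Ps by simp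
        fix t assume "t \<in> ?W"
        then show "\<psi> (g (P t)) = P t"
          using Pg[of "P t"] PP by (simp add: \<psi>_def h_def linear_diff[OF linP])
      qed
      from has_derivative_unique[OF this bounded_linear_imp_has_derivative[OF blP]]
      have "frechet_derivative \<psi> (at x) (A x (P v)) = P v" by metis
      then show ?thesis using AP[OF xT, of v] by (simp add: P_def)
    qed
    moreover have "{v. F x v = 0} = range (blinfun_apply (A x))"
    proof (intro equalityI subsetI)
      show "v \<in> range (blinfun_apply (A x))" if "v \<in> {v. F x v = 0}" for v
        using A_ker[OF xT, of v] that by (intro range_eqI[of _ _ v]) simp
    qed (use FA[OF xT] in auto)
    ultimately show "frechet_derivative \<psi> (at x) ` {v. F x v = 0} = E"
      by (simp add: E_def image_image)
  qed
qed

section \<open>Complexification and brackets\<close>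

lemma Re_vec_cvec [simp]: "Re_vec (cvec u + \<i> *s cvec w) = u"
  and Im_vec_cvec [simp]: "Im_vec (cvec u + \<i> *s cvec w) = w"
  by (simp_all add: Re_vec_def Im_vec_def cvec_def vec_eq_iff)

lemma cvec_Re_Im: "cvec (Re_vec v) + \<i> *s cvec (Im_vec v) = v"
  by (simp add: Re_vec_def Im_vec_def cvec_def vec_eq_iff complex_eq_iff)

lemma cvec_0 [simp]: "cvec 0 = 0"
  by (simp add: cvec_def vec_eq_iff)

lemma cvec_eq_iff [simp]: "cvec u = cvec v \<longleftrightarrow> u = v"
  by (simp add: cvec_def vec_eq_iff)

lemma cvec_eq_0_iff [simp]: "cvec u = 0 \<longleftrightarrow> u = 0"
  by (metis cvec_0 cvec_eq_iff)

lemma cvec_diff: "cvec (u - v) = cvec u - cvec v"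
  by (simp add: cvec_def vec_eq_iff)

lemma bounded_linear_cvec: "bounded_linear (cvec :: real^'n::finite \<Rightarrow> complex^'n)"
proof -
  have "linear (cvec :: real^'n \<Rightarrow> complex^'n)"
    by (rule linearI) (simp_all add: cvec_def vec_eq_iff scaleR_conv_of_real[where 'a = complex])
  then show ?thesis by (simp add: linear_conv_bounded_linear)
qed

lemma cvec_pair_eq_iff:
  "cvec u + \<i> *s cvec w = cvec u' + \<i> *s cvec w' \<longleftrightarrow> u = u' \<and> w = w'"
  by (metis Re_vec_cvec Im_vec_cvec)

lemma clinear_ext_cvec: "f 0 = 0 \<Longrightarrow> clinear_ext f (cvec v) = f v"
  using Re_vec_cvec[of v 0] Im_vec_cvec[of v 0] by (simp add: clinear_ext_def)

text \<open>The real vectors of the complexification give back the original set. Thus the equality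
  of complex fibres in an integral manifold can be read in the real tangent space.\<close>

lemma complexify_subspace_eq_imp:
  assumes "complexify_subspace V = complexify_subspace W" and "0 \<in> V" and "0 \<in> W"
  shows "V = W"
proof -
  have "u \<in> V \<longleftrightarrow> cvec u \<in> complexify_subspace V" if "0 \<in> V" for u and V :: "(real^'a) set"
  proof
    assume "u \<in> V"
    then have "\<exists>u' w. cvec u = cvec u' + \<i> *s cvec w \<and> u' \<in> V \<and> w \<in> V"
      using that by (intro exI[of _ u] exI[of _ 0]) simp
    then show "cvec u \<in> complexify_subspace V" by (simp add: complexify_subspace_def)
  next
    assume "cvec u \<in> complexify_subspace V"
    then obtain u' w where "cvec u + \<i> *s cvec 0 = cvec u' + \<i> *s cvec w" "u' \<in> V"
      by (auto simp: complexify_subspace_def)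
    then show "u \<in> V" unfolding cvec_pair_eq_iff by simp
  qed
  then show ?thesis using assms by blast
qed

lemma complexify_tfield_power:
  assumes "linear (F c x)"
  shows "(complexify_tfield F c x ^^ k) (cvec u + \<i> *s cvec w)
    = cvec ((F c x ^^ k) u) + \<i> *s cvec ((F c x ^^ k) w)"
  by (induction k) (simp_all add: complexify_tfield_def clinear_ext_def)

lemma complexify_tfield_cvec:
  assumes "linear (F c x)"
  shows "complexify_tfield F c x (cvec u) = cvec (F c x u)"
  by (simp add: complexify_tfield_def clinear_ext_cvec linear_0[OF assms])

section \<open>Linear algebra of the structure equation at one point\<close>

definition kernel_projection ::
  "nat \<Rightarrow> real \<Rightarrow> real \<Rightarrow> (real^'n \<Rightarrow> real^'n) \<Rightarrow> real^'n \<Rightarrow> real^'n" where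
  "kernel_projection K a b f v = v + a *\<^sub>R (f ^^ K) v + b *\<^sub>R (f ^^ (K - 1)) v"

lemma linear_funpow:
  fixes f :: "'a::real_vector \<Rightarrow> 'a"
  shows "linear f \<Longrightarrow> linear (f ^^ k)"
  by (induction k) (auto intro!: linearI simp: linear_add linear_scale)

lemma linear_kernel_projection:
  assumes "linear f"
  shows "linear (kernel_projection K a b f)"
  unfolding kernel_projection_def
  by (intro linear_compose_add linear_compose_scale_right linear_funpow[OF assms] linear_ident[unfolded id_def])

locale f_endomorphism =
  fixes K :: nat and \<alpha> \<beta> :: complex and f :: "real^'n::finite \<Rightarrow> real^'n"
  assumes K: "K \<ge> 3" and lin: "linear f"
    and eq: "\<And>v. \<alpha> *s cvec ((f ^^ (K + 1)) v) + \<beta> *s cvec ((f ^^ K) v) + cvec (f v) = 0"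
begin

lemma Re_eq: "Re \<alpha> *\<^sub>R (f ^^ (K + 1)) v + Re \<beta> *\<^sub>R (f ^^ K) v + f v = 0"
proof (rule vec_eq_iff[THEN iffD2], rule allI)
  fix i show "(Re \<alpha> *\<^sub>R (f ^^ (K + 1)) v + Re \<beta> *\<^sub>R (f ^^ K) v + f v) $ i = 0 $ i"
    using arg_cong[OF eq[of v], of "\<lambda>w. Re (w $ i)"] by (simp add: cvec_def)
qed

lemma Im_eq: "Im \<alpha> *\<^sub>R (f ^^ (K + 1)) v + Im \<beta> *\<^sub>R (f ^^ K) v = 0"
proof (rule vec_eq_iff[THEN iffD2], rule allI)
  fix i show "(Im \<alpha> *\<^sub>R (f ^^ (K + 1)) v + Im \<beta> *\<^sub>R (f ^^ K) v) $ i = 0 $ i"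
    using arg_cong[OF eq[of v], of "\<lambda>w. Im (w $ i)"] by (simp add: cvec_def)
qed

lemma funpow_eq_0:
  assumes "(f ^^ j) v = 0" and "j \<le> k"
  shows "(f ^^ k) v = 0"
proof -
  have "(f ^^ k) v = (f ^^ (k - j)) ((f ^^ j) v)"
    using assms(2) by (metis comp_apply funpow_add le_add_diff_inverse2)
  then show ?thesis using assms(1) linear_0[OF linear_funpow[OF lin]] by simp
qed

text \<open>As \<open>K \<ge> 3\<close>, the powers \<open>K\<close> and \<open>K + 1\<close> both
  contain \<open>f\<^sup>2\<close>; once these vanish at \<open>v\<close>, the real part of the
  equation leaves only \<open>f v\<close>.\<close>

lemma square_eq_0_iff: "f (f v) = 0 \<longleftrightarrow> f v = 0"
proof
  assume "f (f v) = 0"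
  then have "(f ^^ 2) v = 0" by (simp add: numeral_2_eq_2)
  then have "(f ^^ (K + 1)) v = 0" "(f ^^ K) v = 0"
    using K funpow_eq_0[of 2 v "K + 1"] funpow_eq_0[of 2 v K] by (simp_all del: funpow.simps)
  then show "f v = 0" using Re_eq[of v] by (simp del: funpow.simps)
qed (simp add: linear_0[OF lin])

text \<open>The imaginary part of the structure equation is one degree too high. It has the form
  \<open>f (f ?z) = 0\<close>, and equality of the kernels of \<open>f\<close> and its square
  cancels one factor.\<close>

lemma Im_eq': "Im \<alpha> *\<^sub>R (f ^^ K) v + Im \<beta> *\<^sub>R (f ^^ (K - 1)) v = 0"
proof -
  obtain j where j: "K = Suc (Suc j)" using that[of "K - 2"] K by simp
  let ?z = "Im \<alpha> *\<^sub>R (f ^^ (K - 1)) v + Im \<beta> *\<^sub>R (f ^^ j) v"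
  have fz: "f ?z = Im \<alpha> *\<^sub>R (f ^^ K) v + Im \<beta> *\<^sub>R (f ^^ (K - 1)) v"
    by (simp add: j linear_add[OF lin] linear_scale[OF lin])
  have "f (f ?z) = Im \<alpha> *\<^sub>R (f ^^ (K + 1)) v + Im \<beta> *\<^sub>R (f ^^ K) v"
    unfolding fz by (simp add: j linear_add[OF lin] linear_scale[OF lin])
  then have "f ?z = 0" using Im_eq square_eq_0_iff by metis
  then show ?thesis by (simp only: fz)
qed

text \<open>By \<open>Im_eq'\<close> the imaginary parts of the coefficients contribute nothing, so
  \<open>m\<close> may be computed with \<open>Re \<alpha>\<close> and \<open>Re \<beta>\<close> and
  maps real vectors to real vectors.\<close>

lemma kernel_projection_complex:
  "cvec v + \<alpha> *s cvec ((f ^^ K) v) + \<beta> *s cvec ((f ^^ (K - 1)) v)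
    = cvec (kernel_projection K (Re \<alpha>) (Re \<beta>) f v)"
proof (rule vec_eq_iff[THEN iffD2], rule allI)
  fix i
  show "(cvec v + \<alpha> *s cvec ((f ^^ K) v) + \<beta> *s cvec ((f ^^ (K - 1)) v)) $ i
    = cvec (kernel_projection K (Re \<alpha>) (Re \<beta>) f v) $ i"
    using arg_cong[OF Im_eq'[of v], of "\<lambda>w. w $ i"]
    by (simp add: cvec_def kernel_projection_def complex_eq_iff)
qed

lemma f_kernel_projection: "f (kernel_projection K (Re \<alpha>) (Re \<beta>) f v) = 0"
proof -
  have "f (kernel_projection K (Re \<alpha>) (Re \<beta>) f v)
      = f v + Re \<alpha> *\<^sub>R (f ^^ (K + 1)) v + Re \<beta> *\<^sub>R (f ^^ Suc (K - 1)) v"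
    by (simp add: kernel_projection_def linear_add[OF lin] linear_scale[OF lin])
  moreover have "Suc (K - 1) = K" using K by simp
  ultimately show ?thesis using Re_eq[of v] by (simp add: add.commute add.left_commute del: funpow.simps)
qed

lemma kernel_projection_self: "f v = 0 \<Longrightarrow> kernel_projection K (Re \<alpha>) (Re \<beta>) f v = v"
  using funpow_eq_0[of 1 v K] funpow_eq_0[of 1 v "K - 1"] K by (simp add: kernel_projection_def)

end

section \<open>Brackets and Nijenhuis tensors of complexified real fields\<close>

lemma lie_bracket_cvec:
  assumes "open S" and "x \<in> S" and "\<And>y. y \<in> S \<Longrightarrow> X' c y = cvec (X y)" and "\<And>y. y \<in> S \<Longrightarrow> Y' c y = cvec (Y y)"
    and X: "(X has_derivative DX) (at x)" and Y: "(Y has_derivative DY) (at x)"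
  shows "lie_bracket X' Y' c x = cvec (DY (X x) - DX (Y x))"
proof -
  have "(X' c has_derivative (\<lambda>w. cvec (DX w))) (at x)" "(Y' c has_derivative (\<lambda>w. cvec (DY w))) (at x)"
    by (rule has_derivative_transform_within_open[OF bounded_linear.has_derivative[OF bounded_linear_cvec X] assms(1,2)],
        simp add: assms(3))
       (rule has_derivative_transform_within_open[OF bounded_linear.has_derivative[OF bounded_linear_cvec Y] assms(1,2)],
        simp add: assms(4))
  from this[THEN frechet_derivative_at, symmetric] show ?thesis
    using has_derivative_linear[OF X] has_derivative_linear[OF Y]
    by (simp add: lie_bracket_def assms(2-4) clinear_ext_cvec linear_0 cvec_diff)
qed

text \<open>If \<open>T\<close> annihilates both fields near \<open>x\<close>, every bracket
  containing \<open>TX\<close> or \<open>TY\<close> vanishes, and only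
  \<open>T\<^sup>2 [X, Y]\<close> survives. Vanishing at \<open>x\<close> alone would not do, since
  brackets differentiate.\<close>

lemma nijenhuis_annihilated_fields:
  assumes "open S" and "x \<in> S" and "\<And>y. y \<in> S \<Longrightarrow> X' c y = cvec (X y)" and "\<And>y. y \<in> S \<Longrightarrow> Y' c y = cvec (Y y)"
    and X: "(X has_derivative DX) (at x)" and Y: "(Y has_derivative DY) (at x)"
    and T: "\<And>y u. y \<in> S \<Longrightarrow> T c y (cvec u) = cvec (t y u)"
    and "\<And>y. y \<in> S \<Longrightarrow> t y (X y) = 0" and "\<And>y. y \<in> S \<Longrightarrow> t y (Y y) = 0" and "t x 0 = 0"
  shows "nijenhuis T X' Y' c x = cvec (t x (t x (DY (X x) - DX (Y x))))"
proof -
  \<comment> \<open>Written as \<open>cvec 0\<close> so that \<open>lie_bracket_cvec\<close> applies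
    with the zero real field.\<close>
  have TX: "apply_tensor T X' c y = cvec 0" and TY: "apply_tensor T Y' c y = cvec 0" if "y \<in> S" for y
    using assms that by (simp_all add: apply_tensor_def)
  have T0: "T c x 0 = 0" using T[OF assms(2), of 0] assms(10) by simp
  note d0 = has_derivative_const[of 0 "at x"]
  have "lie_bracket (apply_tensor T X') (apply_tensor T Y') c x = 0"
    using lie_bracket_cvec[where X = "\<lambda>_. 0" and Y = "\<lambda>_. 0" and X' = "apply_tensor T X'" and Y' = "apply_tensor T Y'" and c = c,
        OF assms(1,2) TX TY d0 d0] by simp
  moreover have "lie_bracket (apply_tensor T X') Y' c x = 0"
    using lie_bracket_cvec[where X = "\<lambda>_. 0" and Y = Y and X' = "apply_tensor T X'" and Y' = Y' and c = c, OF assms(1,2) TX assms(4) d0 Y]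
    by (simp add: linear_0[OF has_derivative_linear[OF Y]])
  moreover have "lie_bracket X' (apply_tensor T Y') c x = 0"
    using lie_bracket_cvec[where X = X and X' = X' and Y = "\<lambda>_. 0" and Y' = "apply_tensor T Y'" and c = c, OF assms(1,2,3) TY X d0]
    by (simp add: linear_0[OF has_derivative_linear[OF X]])
  moreover have "lie_bracket X' Y' c x = cvec (DY (X x) - DX (Y x))"
    using lie_bracket_cvec[where X = X and Y = Y and X' = X' and Y' = Y' and c = c, OF assms(1-4) X Y] .
  ultimately show ?thesis
    using T[OF assms(2)] by (simp add: nijenhuis_def apply_tensor_def T0)
qed

section \<open>Charts and global vector fields\<close>

lemma smooth_on_left_inverse_derivative:
  fixes f :: "'a::euclidean_space \<Rightarrow> 'b::euclidean_space"
  assumes "open S" and "smooth_on S f" and "smooth_on T g" and "f ` S \<subseteq> T"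
    and "\<And>x. x \<in> S \<Longrightarrow> g (f x) = x" and "x \<in> S"
  shows "frechet_derivative g (at (f x)) (frechet_derivative f (at x) v) = v"
proof -
  have "((\<lambda>x. g (f x)) has_derivative (\<lambda>v. frechet_derivative g (at (f x)) (frechet_derivative f (at x) v))) (at x)"
    using assms(4,6)
    by (intro has_derivative_compose[OF smooth_on_has_derivative[OF assms(2)] smooth_on_has_derivative[OF assms(3)]]) auto
  then have "((\<lambda>x. x) has_derivative (\<lambda>v. frechet_derivative g (at (f x)) (frechet_derivative f (at x) v))) (at x)"
    by (rule has_derivative_transform_within_open[OF _ assms(1,6,5)])
  from has_derivative_unique[OF this has_derivative_ident] show ?thesis by metis
qed

lemma is_chart_inj: "is_chart c \<Longrightarrow> inj_on (snd c) (fst c)"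
  unfolding is_chart_def homeomorphism_def by (metis inj_on_inverseI)

lemma is_chart_open_image:
  assumes "is_chart c" and "open W" and "W \<subseteq> fst c"
  shows "open (snd c ` W)"
proof -
  obtain g where g: "homeomorphism (fst c) (snd c ` fst c) (snd c) g"
    and op: "open (fst c)" "open (snd c ` fst c)"
    using assms(1) by (auto simp: is_chart_def)
  have "openin (top_of_set (snd c ` fst c)) (snd c ` W)"
    by (rule homeomorphism_imp_open_map[OF g]) (use assms op in \<open>simp add: openin_open_eq\<close>)
  then show ?thesis using op(2) by (simp add: openin_open_eq)
qed

lemma is_chart_inv_continuous:
  assumes "is_chart c"
  shows "continuous_on (snd c ` fst c) (inv_into (fst c) (snd c))"
proof -
  obtain g where g: "homeomorphism (fst c) (snd c ` fst c) (snd c) g"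
    using assms(1) by (auto simp: is_chart_def)
  show ?thesis
  proof (rule continuous_on_eq[OF homeomorphism_cont2[OF g]])
    fix x assume "x \<in> snd c ` fst c"
    then obtain p where "p \<in> fst c" "x = snd c p" by blast
    then show "g x = inv_into (fst c) (snd c) x"
      using homeomorphism_apply1[OF g] is_chart_inj[OF assms] by simp
  qed
qed

lemma transition_apply: "is_chart c \<Longrightarrow> p \<in> fst c \<Longrightarrow> transition c d (snd c p) = snd d p"
  by (simp add: transition_def is_chart_inj)

lemma smooth_structureD:
  assumes "smooth_structure A"
  shows "c \<in> A \<Longrightarrow> is_chart c" and "c \<in> A \<Longrightarrow> open (fst c)"
    and "c \<in> A \<Longrightarrow> d \<in> A \<Longrightarrow> smooth_on (snd c ` (fst c \<inter> fst d)) (transition c d)"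
    and "\<exists>c\<in>A. p \<in> fst c"
    and "is_chart c \<Longrightarrow> (\<And>d. d \<in> A \<Longrightarrow> smoothly_compatible c d) \<Longrightarrow> c \<in> A"
proof -
  have *: "\<forall>c\<in>A. is_chart c" "(\<Union>c\<in>A. fst c) = UNIV" "\<forall>c\<in>A. \<forall>d\<in>A. smoothly_compatible c d"
    "\<forall>c. is_chart c \<and> (\<forall>d\<in>A. smoothly_compatible c d) \<longrightarrow> c \<in> A"
    using assms unfolding smooth_structure_def by blast+
  show "c \<in> A \<Longrightarrow> is_chart c" "is_chart c \<Longrightarrow> (\<And>d. d \<in> A \<Longrightarrow> smoothly_compatible c d) \<Longrightarrow> c \<in> A"
    using *(1,4) by blast+
  show "c \<in> A \<Longrightarrow> open (fst c)" using *(1) by (simp add: is_chart_def)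
  show "c \<in> A \<Longrightarrow> d \<in> A \<Longrightarrow> smooth_on (snd c ` (fst c \<inter> fst d)) (transition c d)"
    using *(3) by (simp add: smoothly_compatible_def)
  show "\<exists>c\<in>A. p \<in> fst c" using *(2) by blast
qed

lemma open_chart_overlap:
  assumes "smooth_structure A" and "c \<in> A" and "d \<in> A"
  shows "open (snd c ` (fst c \<inter> fst d))"
  using assms by (intro is_chart_open_image) (auto intro: smooth_structureD)

lemma open_chart_image:
  assumes "smooth_structure A" and "c \<in> A"
  shows "open (snd c ` fst c)"
  using smooth_structureD(1)[OF assms] by (simp add: is_chart_def)

lemma transition_image:
  assumes "is_chart c"
  shows "transition c d ` (snd c ` (fst c \<inter> W)) = snd d ` (fst c \<inter> W)"
  by (auto simp: image_image transition_apply[OF assms])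

lemma transition_derivative_inverse:
  assumes "smooth_structure A" and "c \<in> A" and "d \<in> A" and "p \<in> fst c" and "p \<in> fst d"
  shows "frechet_derivative (transition d c) (at (snd d p)) (frechet_derivative (transition c d) (at (snd c p)) v) = v"
proof -
  note ch = smooth_structureD(1)[OF assms(1,2)] smooth_structureD(1)[OF assms(1,3)]
  have "frechet_derivative (transition d c) (at (transition c d (snd c p)))
      (frechet_derivative (transition c d) (at (snd c p)) v) = v"
    by (rule smooth_on_left_inverse_derivative[OF open_chart_overlap[OF assms(1-3)]
          smooth_structureD(3)[OF assms(1-3)] smooth_structureD(3)[OF assms(1,3,2)]])
       (use assms(4,5) transition_apply[OF ch(1), of _ d] transition_apply[OF ch(2), of _ c] in \<open>auto simp: Int_commute\<close>)
  then show ?thesis using transition_apply[OF ch(1) assms(4)] by simp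
qed

section \<open>Flat functions and bump functions\<close>

definition flat_function :: "nat \<Rightarrow> real \<Rightarrow> real" where
  "flat_function n t = (if t > 0 then inverse t ^ n * exp (- inverse t) else 0)"

lemma flat_function_tendsto: "((\<lambda>t. flat_function n t) \<longlongrightarrow> 0) (at_right 0)"
proof -
  have "((\<lambda>t. inverse t ^ n / exp (inverse t)) \<longlongrightarrow> 0) (at_right (0::real))"
    by (rule filterlim_compose[OF tendsto_power_div_exp_0 filterlim_inverse_at_top_right])
  then show ?thesis
    by (rule Lim_transform_eventually)
       (auto simp: flat_function_def exp_minus divide_inverse eventually_at_right_field intro!: exI[of _ 1])
qed

text \<open>The powers of \<open>1 / t\<close> are built in so that the family is closed under
  differentiation. At \<open>0\<close> the right difference quotient of member \<open>n\<close> is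
  member \<open>n + 1\<close>, which tends to \<open>0\<close>.\<close>

lemma flat_function_has_derivative:
  "(flat_function n has_real_derivative flat_function (n + 2) t - real n * flat_function (n + 1) t) (at t)"
proof -
  consider "t > 0" | "t < 0" | "t = 0" by linarith
  then show ?thesis
  proof cases
    case 1
    \<comment> \<open>For \<open>n = 0\<close> the exponent \<open>n - 1\<close> is truncated to
      \<open>0\<close>, but then the factor \<open>real n\<close> vanishes.\<close>
    have pow: "real n * inverse t ^ (n - 1) * inverse t ^ 2 = real n * inverse t ^ (n + 1)"
      by (cases n) (simp_all add: power2_eq_square)
    have "((\<lambda>t. inverse t ^ n * exp (- inverse t)) has_real_derivative
        flat_function (n + 2) t - real n * flat_function (n + 1) t) (at t)"
      using 1 pow
      by (auto intro!: derivative_eq_intros simp: flat_function_def power2_eq_square algebra_simps)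
    then show ?thesis
      by (rule DERIV_cong_ev[THEN iffD1, rotated -1])
         (use 1 in \<open>auto simp: flat_function_def eventually_nhds intro!: exI[of _ "{0<..}"]\<close>)
  next
    case 2
    have "((\<lambda>t. 0) has_real_derivative flat_function (n + 2) t - real n * flat_function (n + 1) t) (at t)"
      using 2 by (simp add: flat_function_def)
    then show ?thesis
      by (rule DERIV_cong_ev[THEN iffD1, rotated -1])
         (use 2 in \<open>auto simp: flat_function_def eventually_nhds intro!: exI[of _ "{..<0}"]\<close>)
  next
    case 3
    have "((\<lambda>h. (flat_function n (0 + h) - flat_function n 0) / h) \<longlongrightarrow> 0) (at 0)"
    proof (rule filterlim_split_at)
      show "((\<lambda>h. (flat_function n (0 + h) - flat_function n 0) / h) \<longlongrightarrow> 0) (at_left 0)"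
        by (rule Lim_transform_eventually[OF tendsto_const])
           (auto simp: flat_function_def eventually_at_left_field intro!: exI[of _ "-1"])
      show "((\<lambda>h. (flat_function n (0 + h) - flat_function n 0) / h) \<longlongrightarrow> 0) (at_right 0)"
        by (rule Lim_transform_eventually[OF flat_function_tendsto[of "n + 1"]])
           (auto simp: flat_function_def divide_inverse eventually_at_right_field intro!: exI[of _ 1])
    qed
    then show ?thesis unfolding 3 DERIV_def by (simp add: flat_function_def)
  qed
qed

lemma smooth_on_flat_function: "smooth_on UNIV (flat_function n)"
  unfolding smooth_on_def
proof
  fix k show "k_times_differentiable k (flat_function n) UNIV"
  proof (induction k arbitrary: n)
    case 0
    then show ?case
      by (auto intro!: continuous_at_imp_continuous_on DERIV_isCont[OF flat_function_has_derivative])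
  next
    case (Suc k)
    show ?case
    proof (rule k_times_differentiable_SucI[OF open_UNIV])
      show "(flat_function n has_derivative
          (\<lambda>v. flat_function (n + 2) t * v + - real n * flat_function (n + 1) t * v)) (at t)" for t
        by (rule has_derivative_eq_rhs[OF flat_function_has_derivative[unfolded has_field_derivative_def]])
           (simp add: algebra_simps fun_eq_iff)
      show "k_times_differentiable k (\<lambda>t. flat_function (n + 2) t * v + - real n * flat_function (n + 1) t * v) UNIV" for v
        by (intro k_times_differentiable_add k_times_differentiable_bilinear[OF _ _ _ bounded_bilinear_mult]
            k_times_differentiable_const Suc open_UNIV)
    qed
  qed
qed

lemma smooth_bump:
  fixes x0 :: "'a::euclidean_space"
  assumes "R > 0"
  obtains \<rho> :: "'a \<Rightarrow> real" where "smooth_on UNIV \<rho>" and "\<rho> x0 \<noteq> 0" and "\<And>x. x \<notin> cball x0 R \<Longrightarrow> \<rho> x = 0"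
proof
  \<comment> \<open>The squared distance, unlike the distance, is smooth at \<open>x0\<close>; the
    argument of the flat function is positive exactly inside the ball.\<close>
  let ?\<rho> = "\<lambda>x. flat_function 0 (R\<^sup>2 - (x - x0) \<bullet> (x - x0))"
  show "smooth_on UNIV ?\<rho>"
    by (intro smooth_on_compose[OF _ smooth_on_flat_function] smooth_on_diff smooth_on_const
        smooth_on_bilinear[OF _ _ _ bounded_bilinear_inner] smooth_on_id open_UNIV subset_UNIV)
  show "?\<rho> x0 \<noteq> 0" using assms by (simp add: flat_function_def)
  show "?\<rho> x = 0" if "x \<notin> cball x0 R" for x
  proof -
    have "R\<^sup>2 \<le> (norm (x - x0))\<^sup>2"
      using that assms by (intro power_mono) (auto simp: dist_norm norm_minus_commute)
    then show ?thesis by (simp add: flat_function_def power2_norm_eq_inner)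
  qed
qed

text \<open>A constant field in the chart \<open>c\<close>, cut off by a bump function, is carried
  to the other charts by the derivatives of the transitions and extended by zero.\<close>

lemma smooth_vector_field_through:
  fixes A :: "('a::t2_space, 'n::finite) chart set"
  assumes "smooth_structure A" and "c \<in> A" and "x0 \<in> snd c ` fst c"
  obtains X where "smooth_vector_field A X" and "X c x0 = v"
proof -
  note ch = smooth_structureD(1)[OF assms(1)]
  note tr = transition_apply[OF ch]
  obtain R where R: "R > 0" "cball x0 R \<subseteq> snd c ` fst c"
    using open_chart_image[OF assms(1,2)] assms(3) open_contains_cball by blast
  obtain \<rho> :: "real^'n \<Rightarrow> real" where \<rho>: "smooth_on UNIV \<rho>" "\<rho> x0 \<noteq> 0" "\<And>x. x \<notin> cball x0 R \<Longrightarrow> \<rho> x = 0"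
    using smooth_bump[OF R(1)] by metis
  \<comment> \<open>Normalised by \<open>\<rho> x0\<close> so that the cut-off field takes the value
    \<open>v\<close> at \<open>x0\<close>.\<close>
  define w where "w = inverse (\<rho> x0) *\<^sub>R v"
  let ?D = "\<lambda>c d x. frechet_derivative (transition c d) (at x)"
  define X where "X d y = (if y \<in> snd d ` (fst c \<inter> fst d)
    then ?D c d (transition d c y) (\<rho> (transition d c y) *\<^sub>R w) else 0)" for d y
  have X_in: "X d (snd d p) = ?D c d (snd c p) (\<rho> (snd c p) *\<^sub>R w)" if "d \<in> A" "p \<in> fst c" "p \<in> fst d" for d p
    using that tr[OF that(1,3), of c] by (simp add: X_def)
  have X_out: "X d (snd d p) = 0" if "d \<in> A" "p \<notin> fst c" "p \<in> fst d" for d p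
  proof -
    have "snd d p \<notin> snd d ` (fst c \<inter> fst d)"
      using inj_onD[OF is_chart_inj[OF ch[OF that(1)]]] that by blast
    then show ?thesis by (simp add: X_def)
  qed
  have D: "(transition d e has_derivative ?D d e (snd d p)) (at (snd d p))"
    if "d \<in> A" "e \<in> A" "p \<in> fst d" "p \<in> fst e" for d e p
    by (rule smooth_on_has_derivative[OF smooth_structureD(3)[OF assms(1) that(1,2)]]) (use that in auto)
  \<comment> \<open>The field vanishes outside the compact set \<open>C\<close>, which is closed
    because the manifold is Hausdorff. So each chart domain is covered by two open pieces: the
    overlap with \<open>c\<close>, where the transported formula is smooth, and the complement of
    \<open>C\<close>, where the field is zero.\<close>
  define C where "C = inv_into (fst c) (snd c) ` cball x0 R"
  have "compact C"
    unfolding C_def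
    by (intro compact_continuous_image continuous_on_subset[OF is_chart_inv_continuous[OF ch[OF assms(2)]] R(2)]
        compact_cball)
  then have "closed C" by (rule compact_imp_closed)
  have "smooth_vector_field A X"
    unfolding smooth_vector_field_def
  proof (intro conjI ballI)
    fix d assume d: "d \<in> A"
    let ?V1 = "snd d ` (fst d \<inter> fst c)" and ?V2 = "snd d ` (fst d - C)"
    have oV1: "open ?V1" by (rule open_chart_overlap[OF assms(1) d assms(2)])
    have oV2: "open ?V2"
      by (intro is_chart_open_image[OF ch[OF d]] open_Diff smooth_structureD(2)[OF assms(1) d] \<open>closed C\<close>) auto
    have "smooth_on ?V1 (X d)"
    proof (rule smooth_on_cong[OF oV1])
      have sm: "smooth_on ?V1 (transition d c)"
        by (rule smooth_structureD(3)[OF assms(1) d assms(2)])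
      have sub: "transition d c ` ?V1 \<subseteq> snd c ` (fst c \<inter> fst d)"
        using transition_image[OF ch[OF d], of c "fst c"] by (simp add: Int_commute)
      show "smooth_on ?V1 (\<lambda>y. ?D c d (transition d c y) (\<rho> (transition d c y) *\<^sub>R w))"
      proof (rule smooth_on_apply_linear[OF oV1, where f = "\<lambda>y. ?D c d (transition d c y)"])
        show "smooth_on ?V1 (\<lambda>y. \<rho> (transition d c y) *\<^sub>R w)"
          by (intro smooth_on_scaleR smooth_on_const smooth_on_compose[OF _ \<rho>(1) sm] oV1 subset_UNIV)
        show "smooth_on ?V1 (\<lambda>y. ?D c d (transition d c y) u)" for u
          by (rule smooth_on_compose[OF oV1 smooth_on_frechet_derivative[OF
                smooth_structureD(3)[OF assms(1,2) d]] sm sub])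
        show "linear (?D c d (transition d c y))" if y: "y \<in> ?V1" for y
        proof -
          obtain p where "p \<in> fst d" "p \<in> fst c" "y = snd d p" using y by blast
          then show ?thesis using has_derivative_linear[OF D[OF assms(2) d]] tr[OF d] by simp
        qed
      qed
      show "?D c d (transition d c y) (\<rho> (transition d c y) *\<^sub>R w) = X d y" if "y \<in> ?V1" for y
        using that by (simp add: X_def Int_commute)
    qed
    moreover have "smooth_on ?V2 (X d)"
    proof (rule smooth_on_cong[OF oV2 _ smooth_on_const[OF oV2, of 0]])
      fix y assume "y \<in> ?V2"
      then obtain p where p: "p \<in> fst d" "p \<notin> C" "y = snd d p" by blast
      show "0 = X d y"
      proof (cases "p \<in> fst c")
        case True
        have "snd c p \<notin> cball x0 R"
        proof
          assume "snd c p \<in> cball x0 R"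
          then have "inv_into (fst c) (snd c) (snd c p) \<in> C" by (simp add: C_def)
          then show False using p(2) True is_chart_inj[OF ch[OF assms(2)]] by simp
        qed
        then show ?thesis
          using X_in[OF d True p(1)] \<rho>(3) linear_0[OF has_derivative_linear[OF D[OF assms(2) d True p(1)]]] p(3)
          by simp
      qed (use X_out[OF d _ p(1)] p(3) in simp)
    qed
    ultimately have "smooth_on (\<Union>{?V1, ?V2}) (X d)"
      by (intro smooth_on_Union) (use oV1 oV2 in auto)
    moreover have "C \<subseteq> fst c"
      using R(2) by (auto simp: C_def intro!: inv_into_into)
    then have "\<Union>{?V1, ?V2} = snd d ` fst d" by blast
    ultimately show "smooth_on (snd d ` fst d) (X d)" by simp
  next
    fix d e y assume de: "d \<in> A" "e \<in> A" and "y \<in> snd d ` (fst d \<inter> fst e)"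
    then obtain p where p: "p \<in> fst d" "p \<in> fst e" "y = snd d p" by blast
    show "X e (transition d e y) = ?D d e y (X d y)"
    proof (cases "p \<in> fst c")
      case True
      \<comment> \<open>The transformation law from \<open>d\<close> to \<open>e\<close> is the
        chain rule for the passage from \<open>c\<close> to \<open>e\<close> through
        \<open>d\<close>, valid near points common to all three charts.\<close>
      let ?W = "snd c ` (fst c \<inter> (fst d \<inter> fst e))"
      have "((\<lambda>x. transition d e (transition c d x)) has_derivative (\<lambda>u. ?D d e y (?D c d (snd c p) u))) (at (snd c p))"
        by (rule has_derivative_compose[OF D[OF assms(2) de(1) True p(1)]])
           (use D[OF de p(1,2)] tr[OF assms(2) True] p(3) in simp)
      then have "(transition c e has_derivative (\<lambda>u. ?D d e y (?D c d (snd c p) u))) (at (snd c p))"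
      proof (rule has_derivative_transform_within_open)
        show "open ?W"
          by (intro is_chart_open_image[OF ch[OF assms(2)]] open_Int smooth_structureD(2)[OF assms(1)] assms(2) de) auto
        show "snd c p \<in> ?W" using True p by blast
        show "transition d e (transition c d x) = transition c e x" if "x \<in> ?W" for x
          using that tr[OF assms(2), of _ d] tr[OF assms(2), of _ e] tr[OF de(1), of _ e] by auto
      qed
      from has_derivative_unique[OF this D[OF assms(2) de(2) True p(2)]]
      show ?thesis
        using X_in[OF de(1) True p(1)] X_in[OF de(2) True p(2)] tr[OF de(1) p(1), of e] p(3) by metis
    next
      case False
      then show ?thesis
        using X_out[OF de(1) _ p(1)] X_out[OF de(2) _ p(2)] tr[OF de(1) p(1), of e] p(3)
          linear_0[OF has_derivative_linear[OF D[OF de p(1,2)]]] by simp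
    qed
  qed
  moreover have "X c x0 = v"
  proof -
    obtain p where p: "p \<in> fst c" "x0 = snd c p" using assms(3) by blast
    have "((\<lambda>x. x) has_derivative ?D c c x0) (at x0)"
      by (rule has_derivative_transform_within_open[where f = "transition c c", OF _ open_chart_image[OF assms(1,2)] assms(3)])
         (use D[OF assms(2,2) p(1,1)] p(2) tr[OF assms(2), of _ c] in auto)
    from has_derivative_unique[OF this has_derivative_ident] have "?D c c x0 u = u" for u by metis
    then show ?thesis using X_in[OF assms(2) p(1,1)] p(2) \<rho>(2) by (simp add: w_def)
  qed
  ultimately show thesis by (rule that)
qed

section \<open>F-structures\<close>

locale f_structure =
  fixes A :: "('a::t2_space, 'n::finite) chart set" and F :: "('a, 'n) tfield"
    and K r :: nat and \<alpha> \<beta> :: complex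
  assumes K: "K \<ge> 3" and F_structure: "F_structure A K \<alpha> \<beta> r F"
begin

abbreviation m_real :: "('a, 'n) tfield" where
  "m_real c x \<equiv> kernel_projection K (Re \<alpha>) (Re \<beta>) (F c x)"

text \<open>The vectors \<open>u\<close> and \<open>w\<close> are held constant in the coordinates
  of \<open>c\<close>. A derivative of components is not a tensor, so the condition is imposed in
  every chart.\<close>

definition symmetric_on_kernel :: bool where
  "symmetric_on_kernel \<longleftrightarrow> (\<forall>c\<in>A. \<forall>x\<in>snd c ` fst c. \<forall>u w. F c x u = 0 \<longrightarrow> F c x w = 0 \<longrightarrow>
    frechet_derivative (\<lambda>y. F c y u) (at x) w = frechet_derivative (\<lambda>y. F c y w) (at x) u)"

lemma is_smooth_structure: "smooth_structure A" and tensor: "smooth_tensor_field A F"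
  using F_structure by (simp_all add: F_structure_def)

lemma linear_F: "c \<in> A \<Longrightarrow> x \<in> snd c ` fst c \<Longrightarrow> linear (F c x)"
  and smooth_F: "c \<in> A \<Longrightarrow> smooth_on (snd c ` fst c) (\<lambda>x. F c x v)"
  using tensor unfolding smooth_tensor_field_def by blast+

lemma F_transition:
  assumes "c \<in> A" and "d \<in> A" and "p \<in> fst c" and "p \<in> fst d"
  shows "F d (snd d p) (frechet_derivative (transition c d) (at (snd c p)) v)
    = frechet_derivative (transition c d) (at (snd c p)) (F c (snd c p) v)"
proof -
  have "\<forall>x\<in>snd c ` (fst c \<inter> fst d). \<forall>v.
      F d (transition c d x) (frechet_derivative (transition c d) (at x) v)
      = frechet_derivative (transition c d) (at x) (F c x v)"
    using tensor assms(1,2) unfolding smooth_tensor_field_def by blast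
  moreover have "transition c d (snd c p) = snd d p"
    using smooth_structureD(1)[OF is_smooth_structure assms(1)] assms(3) by (rule transition_apply)
  ultimately show ?thesis using assms(3,4) by force
qed

lemma f_endomorphism:
  assumes "c \<in> A" and "x \<in> snd c ` fst c"
  shows "f_endomorphism K \<alpha> \<beta> (F c x)"
proof (rule f_endomorphism.intro[OF K linear_F[OF assms]])
  fix v
  have pow: "(complexify_tfield F c x ^^ k) (cvec v) = cvec ((F c x ^^ k) v)" for k
    using complexify_tfield_power[of F c x k v 0, OF linear_F[OF assms]]
    by (simp add: linear_0[OF linear_funpow[OF linear_F[OF assms]]])
  have "\<forall>c\<in>A. \<forall>x\<in>snd c ` fst c. \<forall>v.
      \<alpha> *s (complexify_tfield F c x ^^ (K + 1)) v + \<beta> *s (complexify_tfield F c x ^^ K) v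
      + complexify_tfield F c x v = 0"
    using F_structure unfolding F_structure_def by blast
  then have "\<alpha> *s (complexify_tfield F c x ^^ (K + 1)) (cvec v) + \<beta> *s (complexify_tfield F c x ^^ K) (cvec v)
      + complexify_tfield F c x (cvec v) = 0"
    using assms by blast
  then show "\<alpha> *s cvec ((F c x ^^ (K + 1)) v) + \<beta> *s cvec ((F c x ^^ K) v) + cvec (F c x v) = 0"
    unfolding pow complexify_tfield_cvec[of F c x, OF linear_F[OF assms]] .
qed

lemmas F_m_real = f_endomorphism.f_kernel_projection[OF f_endomorphism]
  and m_real_self = f_endomorphism.kernel_projection_self[OF f_endomorphism]
  and F_square_eq_0_iff = f_endomorphism.square_eq_0_iff[OF f_endomorphism]

lemma linear_m_real: "c \<in> A \<Longrightarrow> x \<in> snd c ` fst c \<Longrightarrow> linear (m_real c x)"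
  by (rule linear_kernel_projection[OF linear_F])

lemma m_tensor_eq:
  assumes "c \<in> A" and "x \<in> snd c ` fst c"
  shows "m_tensor K \<alpha> \<beta> F c x (cvec u + \<i> *s cvec w) = cvec (m_real c x u) + \<i> *s cvec (m_real c x w)"
proof -
  interpret f_endomorphism K \<alpha> \<beta> "F c x" by (rule f_endomorphism[OF assms])
  show ?thesis
    unfolding m_tensor_def complexify_tfield_power[of F c x, OF lin] kernel_projection_complex[symmetric]
    by (simp add: vector_add_ldistrib vector_smult_assoc mult.commute)
qed

lemma m_tensor_cvec:
  assumes "c \<in> A" and "x \<in> snd c ` fst c"
  shows "m_tensor K \<alpha> \<beta> F c x (cvec u) = cvec (m_real c x u)"
  using m_tensor_eq[OF assms, of u 0] by (simp add: linear_0[OF linear_m_real[OF assms]])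

lemma l_tensor_cvec:
  assumes "c \<in> A" and "x \<in> snd c ` fst c"
  shows "l_tensor K \<alpha> \<beta> F c x (cvec u) = cvec (u - m_real c x u)"
proof -
  have "l_tensor K \<alpha> \<beta> F c x (cvec u) = cvec u - m_tensor K \<alpha> \<beta> F c x (cvec u)"
    by (simp add: l_tensor_def m_tensor_def)
  then show ?thesis by (simp add: m_tensor_cvec[OF assms] cvec_diff)
qed

lemma l_eq_0_iff:
  assumes "c \<in> A" and "x \<in> snd c ` fst c"
  shows "u - m_real c x u = 0 \<longleftrightarrow> F c x u = 0"
  using F_m_real[OF assms, of u] m_real_self[OF assms, of u] by auto

lemma image_m_tensor:
  assumes "c \<in> A" and "x \<in> snd c ` fst c"
  shows "image_distribution (m_tensor K \<alpha> \<beta> F) c x = complexify_subspace {v. F c x v = 0}"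
  unfolding image_distribution_def
proof (intro equalityI subsetI)
  fix z assume "z \<in> range (m_tensor K \<alpha> \<beta> F c x)"
  then obtain v where "z = m_tensor K \<alpha> \<beta> F c x (cvec (Re_vec v) + \<i> *s cvec (Im_vec v))"
    by (auto simp: cvec_Re_Im)
  then show "z \<in> complexify_subspace {v. F c x v = 0}"
    unfolding m_tensor_eq[OF assms] complexify_subspace_def using F_m_real[OF assms] by blast
next
  fix z assume "z \<in> complexify_subspace {v. F c x v = 0}"
  then obtain u w where "z = cvec u + \<i> *s cvec w" "F c x u = 0" "F c x w = 0"
    by (auto simp: complexify_subspace_def)
  then have "z = m_tensor K \<alpha> \<beta> F c x (cvec u + \<i> *s cvec w)"
    by (simp add: m_tensor_eq[OF assms] m_real_self[OF assms])
  then show "z \<in> range (m_tensor K \<alpha> \<beta> F c x)" by blast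
qed

lemma smooth_m_real:
  assumes "c \<in> A"
  shows "smooth_on (snd c ` fst c) (\<lambda>x. m_real c x v)"
proof -
  note op = open_chart_image[OF is_smooth_structure assms]
  have pow: "smooth_on (snd c ` fst c) (\<lambda>x. (F c x ^^ k) v)" for k
  proof (induction k)
    case 0
    show ?case using smooth_on_const[OF op] by simp
  next
    case (Suc k)
    have "smooth_on (snd c ` fst c) (\<lambda>x. F c x ((F c x ^^ k) v))"
      by (rule smooth_on_apply_linear[OF op Suc smooth_F[OF assms] linear_F[OF assms]])
    then show ?case by simp
  qed
  show ?thesis
    unfolding kernel_projection_def
    by (intro smooth_on_add smooth_on_linear[OF op pow bounded_linear_scaleR_right] smooth_on_const op)
qed

section \<open>The bracket identities as a pointwise condition\<close>

definition m_bracket :: "('a, 'n) vfield \<Rightarrow> ('a, 'n) vfield \<Rightarrow> ('a, 'n) vfield" where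
  "m_bracket X Y c x =
    frechet_derivative (\<lambda>y. m_real c y (Y c y)) (at x) (m_real c x (X c x))
    - frechet_derivative (\<lambda>y. m_real c y (X c y)) (at x) (m_real c x (Y c x))"

lemma m_field_has_derivative:
  assumes "smooth_vector_field A X" and "c \<in> A" and "x \<in> snd c ` fst c"
  shows "((\<lambda>y. m_real c y (X c y)) has_derivative frechet_derivative (\<lambda>y. m_real c y (X c y)) (at x)) (at x)"
proof -
  have X: "smooth_on (snd c ` fst c) (X c)" using assms(1,2) unfolding smooth_vector_field_def by blast
  show ?thesis
    by (rule smooth_on_has_derivative[OF smooth_on_apply_linear[OF open_chart_image[OF is_smooth_structure assms(2)]
          X smooth_m_real[OF assms(2)] linear_m_real[OF assms(2)]] assms(3)])
qed

text \<open>Serves both \<open>l\<close> and \<open>F\<close>: all that is asked of \<open>T\<close>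
  is that it is real, with real form \<open>t\<close>, and annihilates \<open>ker F\<close>.\<close>

lemma nijenhuis_m:
  assumes "smooth_vector_field A X" and "smooth_vector_field A Y" and "c \<in> A" and "x \<in> snd c ` fst c"
    and T: "\<And>y u. y \<in> snd c ` fst c \<Longrightarrow> T c y (cvec u) = cvec (t y u)"
    and t: "\<And>y u. y \<in> snd c ` fst c \<Longrightarrow> F c y u = 0 \<Longrightarrow> t y u = 0"
  shows "nijenhuis T (apply_tensor (m_tensor K \<alpha> \<beta> F) (complexify_vfield X))
      (apply_tensor (m_tensor K \<alpha> \<beta> F) (complexify_vfield Y)) c x = cvec (t x (t x (m_bracket X Y c x)))"
proof -
  have m: "apply_tensor (m_tensor K \<alpha> \<beta> F) (complexify_vfield Z) c y = cvec (m_real c y (Z c y))"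
    if "y \<in> snd c ` fst c" for Z y
    using m_tensor_cvec[OF assms(3) that] by (simp add: apply_tensor_def complexify_vfield_def)
  show ?thesis
    unfolding m_bracket_def
    by (rule nijenhuis_annihilated_fields[where X = "\<lambda>y. m_real c y (X c y)" and Y = "\<lambda>y. m_real c y (Y c y)"
          and X' = "apply_tensor (m_tensor K \<alpha> \<beta> F) (complexify_vfield X)"
          and Y' = "apply_tensor (m_tensor K \<alpha> \<beta> F) (complexify_vfield Y)"
          and S = "snd c ` fst c" and c = c and T = T and t = t, OF open_chart_image[OF is_smooth_structure assms(3)] assms(4) m m
          m_field_has_derivative[OF assms(1,3,4)] m_field_has_derivative[OF assms(2,3,4)] T])
       (auto intro!: t F_m_real assms(3,4) linear_0[OF linear_F[OF assms(3,4)]])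
qed

text \<open>Differentiating \<open>F (mZ) = 0\<close> trades each derivative of a field for a
  derivative of \<open>F\<close> with frozen argument. Hence the left side depends only on the
  values of the two fields at \<open>x\<close>.\<close>

lemma F_m_bracket:
  assumes "smooth_vector_field A X" and "smooth_vector_field A Y" and "c \<in> A" and "x \<in> snd c ` fst c"
  defines "u \<equiv> m_real c x (X c x)" and "w \<equiv> m_real c x (Y c x)"
  shows "F c x (m_bracket X Y c x)
    = frechet_derivative (\<lambda>y. F c y u) (at x) w - frechet_derivative (\<lambda>y. F c y w) (at x) u"
proof -
  have "frechet_derivative (\<lambda>y. F c y (m_real c x (Z c x))) (at x) v
      + F c x (frechet_derivative (\<lambda>y. m_real c y (Z c y)) (at x) v) = 0"
    if "smooth_vector_field A Z" for Z v
  proof -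
    note op = open_chart_image[OF is_smooth_structure assms(3)]
    have "((\<lambda>y. F c y (m_real c y (Z c y))) has_derivative
        (\<lambda>v. frechet_derivative (\<lambda>y. F c y (m_real c x (Z c x))) (at x) v
          + F c x (frechet_derivative (\<lambda>y. m_real c y (Z c y)) (at x) v))) (at x)"
      by (rule has_derivative_apply_linear[OF op assms(4) linear_F[OF assms(3)] smooth_F[OF assms(3)]
            m_field_has_derivative[OF that assms(3,4)]])
    then have "((\<lambda>y. 0) has_derivative
        (\<lambda>v. frechet_derivative (\<lambda>y. F c y (m_real c x (Z c x))) (at x) v
          + F c x (frechet_derivative (\<lambda>y. m_real c y (Z c y)) (at x) v))) (at x)"
      by (rule has_derivative_transform_within_open[OF _ op assms(4) F_m_real[OF assms(3)]])
    from has_derivative_unique[OF this has_derivative_const] show ?thesis by metis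
  qed
  from this[OF assms(1), of w] this[OF assms(2), of u] show ?thesis
    by (simp add: m_bracket_def linear_diff[OF linear_F[OF assms(3,4)]] add_eq_0_iff2 flip: u_def w_def)
qed

text \<open>Every pair of kernel vectors is attained by global fields, and \<open>m\<close> fixes
  kernel vectors; conversely \<open>mX\<close> and \<open>mY\<close> take values in the
  kernel.\<close>

lemma F_m_bracket_eq_0_iff:
  "(\<forall>X Y. smooth_vector_field A X \<and> smooth_vector_field A Y \<longrightarrow>
      (\<forall>c\<in>A. \<forall>x\<in>snd c ` fst c. F c x (m_bracket X Y c x) = 0)) \<longleftrightarrow> symmetric_on_kernel"
proof
  assume *: "\<forall>X Y. smooth_vector_field A X \<and> smooth_vector_field A Y \<longrightarrow>
      (\<forall>c\<in>A. \<forall>x\<in>snd c ` fst c. F c x (m_bracket X Y c x) = 0)"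
  show symmetric_on_kernel
    unfolding symmetric_on_kernel_def
  proof (intro ballI allI impI)
    fix c x u w assume cx: "c \<in> A" "x \<in> snd c ` fst c" and uw: "F c x u = 0" "F c x w = 0"
    obtain X where X: "smooth_vector_field A X" "X c x = u" by (rule smooth_vector_field_through[OF is_smooth_structure cx])
    obtain Y where Y: "smooth_vector_field A Y" "Y c x = w" by (rule smooth_vector_field_through[OF is_smooth_structure cx])
    have "F c x (m_bracket X Y c x) = 0" using * X(1) Y(1) cx by blast
    then show "frechet_derivative (\<lambda>y. F c y u) (at x) w = frechet_derivative (\<lambda>y. F c y w) (at x) u"
      using F_m_bracket[OF X(1) Y(1) cx] uw by (simp add: X(2) Y(2) m_real_self[OF cx])
  qed
next
  assume s: symmetric_on_kernel
  show "\<forall>X Y. smooth_vector_field A X \<and> smooth_vector_field A Y \<longrightarrow>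
      (\<forall>c\<in>A. \<forall>x\<in>snd c ` fst c. F c x (m_bracket X Y c x) = 0)"
  proof (intro allI impI ballI; elim conjE)
    fix X Y c x
    assume XY: "smooth_vector_field A X" "smooth_vector_field A Y" and cx: "c \<in> A" "x \<in> snd c ` fst c"
    have "frechet_derivative (\<lambda>y. F c y (m_real c x (X c x))) (at x) (m_real c x (Y c x))
        = frechet_derivative (\<lambda>y. F c y (m_real c x (Y c x))) (at x) (m_real c x (X c x))"
      using s cx F_m_real[OF cx] unfolding symmetric_on_kernel_def by blast
    then show "F c x (m_bracket X Y c x) = 0" by (simp add: F_m_bracket[OF XY cx])
  qed
qed

section \<open>Integral manifolds and the pointwise condition\<close>

lemma integrable_imp_symmetric:
  assumes "integrable_distribution A (image_distribution (m_tensor K \<alpha> \<beta> F))"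
  shows symmetric_on_kernel
  unfolding symmetric_on_kernel_def
proof (intro ballI allI impI)
  fix d y u' w' assume d: "d \<in> A" and "y \<in> snd d ` fst d" and u'w': "F d y u' = 0" "F d y w' = 0"
  then obtain p where p: "p \<in> fst d" "y = snd d p" by blast
  obtain N where N: "p \<in> N" "integral_manifold A (image_distribution (m_tensor K \<alpha> \<beta> F)) N"
    using assms unfolding integrable_distribution_def by blast
  then obtain c V where cV: "slice_chart A N c V" "p \<in> fst c"
    and DV: "\<forall>x\<in>snd c ` (N \<inter> fst c). image_distribution (m_tensor K \<alpha> \<beta> F) c x = complexify_subspace V"
    unfolding integral_manifold_def by blast
  have c: "c \<in> A" and V: "subspace V" and slice: "snd c ` (N \<inter> fst c) = snd c ` fst c \<inter> V"
    using cV(1) by (auto simp: slice_chart_def)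
  define x where "x = snd c p"
  have xV: "x \<in> V" using slice N(1) cV(2) by (auto simp: x_def)
  have xc: "x \<in> snd c ` fst c" using cV(2) by (simp add: x_def)
  \<comment> \<open>Along the slice the kernel of \<open>F\<close> is one fixed subspace of the
    coordinate space; this is the gain of a slice chart.\<close>
  have kerV: "{v. F c z v = 0} = V" if "z \<in> snd c ` fst c" "z \<in> V" for z
  proof (rule complexify_subspace_eq_imp)
    show "complexify_subspace {v. F c z v = 0} = complexify_subspace V"
      using DV slice that image_m_tensor[OF c that(1)] by auto
  qed (use linear_0[OF linear_F[OF c that(1)]] subspace_0[OF V] in auto)
  note opc = open_chart_image[OF is_smooth_structure c]
  \<comment> \<open>Moving from \<open>x\<close> in a direction \<open>w\<close> of \<open>V\<close>
    stays in the slice, where \<open>v\<close> remains in the kernel; so the function being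
    differentiated is zero along this line.\<close>
  have flat: "frechet_derivative (\<lambda>z. F c z v) (at x) w = 0" if "v \<in> V" "w \<in> V" for v w
  proof -
    let ?l = "\<lambda>t::real. x + t *\<^sub>R w"
    have "((\<lambda>t. F c (?l t) v) has_derivative (\<lambda>t. frechet_derivative (\<lambda>z. F c z v) (at x) (t *\<^sub>R w))) (at 0)"
      by (rule has_derivative_compose[where f = ?l])
         (use smooth_on_has_derivative[OF smooth_F[OF c] xc] in \<open>auto intro!: derivative_eq_intros\<close>)
    then have "((\<lambda>t::real. 0) has_derivative (\<lambda>t. frechet_derivative (\<lambda>z. F c z v) (at x) (t *\<^sub>R w))) (at 0)"
    proof (rule has_derivative_transform_within_open)
      show "open (?l -` (snd c ` fst c))"
        by (intro open_vimage opc continuous_intros)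
      show "0 \<in> ?l -` (snd c ` fst c)" using xc by simp
      fix t assume "t \<in> ?l -` (snd c ` fst c)"
      moreover have "?l t \<in> V" using V xV that(2) by (intro subspace_add subspace_scale)
      ultimately show "F c (?l t) v = 0" using kerV[of "?l t"] that(1) by blast
    qed
    from has_derivative_unique[OF this has_derivative_const]
    have "(\<lambda>t. frechet_derivative (\<lambda>z. F c z v) (at x) (t *\<^sub>R w)) = (\<lambda>t. 0)" .
    from fun_cong[OF this, of 1] show ?thesis by simp
  qed
  let ?\<phi> = "transition c d" and ?S = "snd c ` (fst c \<inter> fst d)"
  let ?D = "\<lambda>z. frechet_derivative ?\<phi> (at z)"
  have opS: "open ?S" by (rule open_chart_overlap[OF is_smooth_structure c d])
  have xS: "x \<in> ?S" using cV(2) p(1) by (auto simp: x_def)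
  have sm\<phi>: "smooth_on ?S ?\<phi>" by (rule smooth_structureD(3)[OF is_smooth_structure c d])
  have \<phi>: "?\<phi> (snd c q) = snd d q" if "q \<in> fst c" for q
    by (rule transition_apply[OF smooth_structureD(1)[OF is_smooth_structure c] that])
  have \<phi>x: "?\<phi> x = y" using \<phi>[OF cV(2)] p(2) by (simp add: x_def)
  have D: "(?\<phi> has_derivative ?D z) (at z)" if "z \<in> ?S" for z
    by (rule smooth_on_has_derivative[OF sm\<phi> that])
  have smD: "smooth_on ?S (\<lambda>z. ?D z v)" for v by (rule smooth_on_frechet_derivative[OF sm\<phi>])
  \<comment> \<open>Differentiate the tensor law
    \<open>F d (?\<phi> z) (?D z u) = ?D z (F c z u)\<close> in direction \<open>w\<close>. The
    right side contributes nothing, since \<open>F c x u = 0\<close> and its derivative vanishes by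
    \<open>flat\<close>; what remains is \<open>F d y\<close> of a second derivative of
    \<open>?\<phi>\<close>, which is symmetric in \<open>u\<close> and \<open>w\<close>.\<close>
  have key: "frechet_derivative (\<lambda>z. F d z (?D x u)) (at y) (?D x w)
      = - F d y (frechet_derivative (\<lambda>z. ?D z u) (at x) w)" if u: "u \<in> V" and w: "w \<in> V" for u w
  proof -
    have smFd: "smooth_on ?S (\<lambda>z. F d (?\<phi> z) v)" for v
      by (rule smooth_on_compose[OF opS smooth_F[OF d] sm\<phi>]) (auto simp: \<phi>)
    have lin: "linear (F d (?\<phi> z))" if "z \<in> ?S" for z
      using that \<phi> by (auto intro!: linear_F[OF d])
    have Da: "((\<lambda>z. ?D z u) has_derivative frechet_derivative (\<lambda>z. ?D z u) (at x)) (at x)"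
      by (rule smooth_on_has_derivative[OF smD xS])
    have L: "((\<lambda>z. F d (?\<phi> z) (?D z u)) has_derivative (\<lambda>w.
        frechet_derivative (\<lambda>z. F d (?\<phi> z) (?D x u)) (at x) w
        + F d (?\<phi> x) (frechet_derivative (\<lambda>z. ?D z u) (at x) w))) (at x)"
      by (rule has_derivative_apply_linear[where F = "\<lambda>z. F d (?\<phi> z)", OF opS xS lin smFd Da])
    have "((\<lambda>z. F d (?\<phi> z) (?D x u)) has_derivative
        (\<lambda>w. frechet_derivative (\<lambda>z. F d z (?D x u)) (at y) (?D x w))) (at x)"
      by (rule has_derivative_compose[OF D[OF xS]])
         (use smooth_on_has_derivative[OF smooth_F[OF d]] p \<phi>x in auto)
    from frechet_derivative_at[OF this]
    have L': "frechet_derivative (\<lambda>z. F d (?\<phi> z) (?D x u)) (at x) w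
        = frechet_derivative (\<lambda>z. F d z (?D x u)) (at y) (?D x w)" by metis
    have "((\<lambda>z. ?D z (F c z u)) has_derivative (\<lambda>w.
        frechet_derivative (\<lambda>z. ?D z (F c x u)) (at x) w
        + ?D x (frechet_derivative (\<lambda>z. F c z u) (at x) w))) (at x)"
      by (rule has_derivative_apply_linear[where F = ?D, OF opS xS has_derivative_linear[OF D] smD
            smooth_on_has_derivative[OF smooth_F[OF c] xc]])
    then have "((\<lambda>z. F d (?\<phi> z) (?D z u)) has_derivative (\<lambda>w.
        frechet_derivative (\<lambda>z. ?D z (F c x u)) (at x) w
        + ?D x (frechet_derivative (\<lambda>z. F c z u) (at x) w))) (at x)"
      by (rule has_derivative_transform_within_open[OF _ opS xS]) (auto simp: \<phi> F_transition[OF c d])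
    from has_derivative_unique[OF L this] have "frechet_derivative (\<lambda>z. F d z (?D x u)) (at y) (?D x w)
        + F d y (frechet_derivative (\<lambda>z. ?D z u) (at x) w)
      = frechet_derivative (\<lambda>z. ?D z (F c x u)) (at x) w
        + ?D x (frechet_derivative (\<lambda>z. F c z u) (at x) w)"
      unfolding \<phi>x L'[symmetric] by metis
    moreover have "frechet_derivative (\<lambda>z. ?D z (F c x u)) (at x) w = 0"
    proof -
      have "((\<lambda>z. ?D z (F c x u)) has_derivative (\<lambda>w. 0)) (at x)"
      proof (rule has_derivative_transform_within_open[OF has_derivative_const opS xS])
        have "F c x u = 0" using kerV[OF xc xV] u by blast
        then show "0 = ?D z (F c x u)" if "z \<in> ?S" for z
          using linear_0[OF has_derivative_linear[OF D[OF that]]] by simp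
      qed
      from frechet_derivative_at[OF this] show ?thesis by metis
    qed
    ultimately show ?thesis
      using flat[OF u w] linear_0[OF has_derivative_linear[OF D[OF xS]]] by (simp add: eq_neg_iff_add_eq_0)
  qed
  \<comment> \<open>Invariance of the kernel under transitions: every kernel vector in the chart
    \<open>d\<close> comes from the slice directions, so \<open>key\<close> covers all
    pairs.\<close>
  have pull: "\<exists>v\<in>V. ?D x v = v'" if "F d y v' = 0" for v'
  proof
    let ?v = "frechet_derivative (transition d c) (at y) v'"
    have "F c x ?v = frechet_derivative (transition d c) (at y) (F d y v')"
      using F_transition[OF d c p(1) cV(2)] p(2) by (simp add: x_def)
    also have "\<dots> = 0"
      using that linear_0[OF has_derivative_linear[OF smooth_on_has_derivative[OF
            smooth_structureD(3)[OF is_smooth_structure d c]]]] p cV(2) by auto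
    finally show "?v \<in> V" using kerV[OF xc xV] by blast
    show "?D x ?v = v'"
      using transition_derivative_inverse[OF is_smooth_structure d c p(1) cV(2)] p(2) by (simp add: x_def)
  qed
  obtain u where u: "u \<in> V" "?D x u = u'" using pull[OF u'w'(1)] by blast
  obtain w where w: "w \<in> V" "?D x w = w'" using pull[OF u'w'(2)] by blast
  show "frechet_derivative (\<lambda>z. F d z u') (at y) w' = frechet_derivative (\<lambda>z. F d z w') (at y) u'"
    using key[OF u(1) w(1)] key[OF w(1) u(1)] frechet_derivative_commute[OF opS sm\<phi> xS, of u w]
    by (simp add: u(2) w(2))
qed

lemma symmetric_imp_integrable:
  assumes symmetric_on_kernel
  shows "integrable_distribution A (image_distribution (m_tensor K \<alpha> \<beta> F))"
  unfolding integrable_distribution_def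
proof
  fix p
  obtain c where c: "c \<in> A" "p \<in> fst c" using smooth_structureD(4)[OF is_smooth_structure] by blast
  let ?S = "snd c ` fst c"
  note ch = smooth_structureD(1)[OF is_smooth_structure c(1)]
  note opS = open_chart_image[OF is_smooth_structure c(1)]
  have inj: "inj_on (snd c) (fst c)" by (rule is_chart_inj[OF ch])
  have pS: "snd c p \<in> ?S" using c(2) by blast
  have sym: "frechet_derivative (\<lambda>y. F c y u) (at x) w = frechet_derivative (\<lambda>y. F c y w) (at x) u"
    if "x \<in> ?S" "F c x u = 0" "F c x w = 0" for x u w
    using assms c(1) that unfolding symmetric_on_kernel_def by blast
  obtain E U and \<psi> \<psi>' :: "real^'n \<Rightarrow> real^'n"
    where E: "subspace E" and U: "open U" "snd c p \<in> U" "U \<subseteq> ?S" and op\<psi>U: "open (\<psi> ` U)"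
      and sm\<psi>: "smooth_on U \<psi>" and sm\<psi>': "smooth_on (\<psi> ` U) \<psi>'" and inv: "\<And>x. x \<in> U \<Longrightarrow> \<psi>' (\<psi> x) = x"
      and \<psi>p: "\<psi> (snd c p) \<in> E"
      and D\<psi>: "\<And>x. x \<in> U \<Longrightarrow> \<psi> x \<in> E \<Longrightarrow> frechet_derivative \<psi> (at x) ` {v. F c x v = 0} = E"
    by (rule local_frobenius[OF opS pS linear_F[OF c(1)] smooth_F[OF c(1)] linear_m_real[OF c(1)]
          smooth_m_real[OF c(1)] F_m_real[OF c(1)] m_real_self[OF c(1)] sym];
        (assumption | (rule that; (assumption | iprover))))
  let ?\<phi> = "snd c" and ?\<phi>' = "inv_into (fst c) (snd c)"
  have inv\<phi>: "?\<phi>' (?\<phi> q) = q" if "q \<in> fst c" for q using inj that by simp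
  define W where "W = {q \<in> fst c. ?\<phi> q \<in> U}"
  have W: "W \<subseteq> fst c" and pW: "p \<in> W" using U(2) c(2) by (auto simp: W_def)
  have \<phi>W: "?\<phi> ` W = U" using U(3) by (auto simp: W_def)
  \<comment> \<open>The chart \<open>c\<close> followed by the flattening map, on the part of its
    domain where that map is defined; maximality of the atlas will admit it.\<close>
  define e where "e = (W, \<lambda>q. \<psi> (?\<phi> q))"
  have fst_e: "fst e = W" and snd_e: "snd e q = \<psi> (?\<phi> q)" for q by (simp_all add: e_def)
  have img_e: "snd e ` W = \<psi> ` U" by (simp add: snd_e image_image flip: \<phi>W)
  have cont\<phi>: "continuous_on (fst c) ?\<phi>"
    using ch by (auto simp: is_chart_def homeomorphism_def)
  have opW: "open W"
  proof -
    have "open (fst c \<inter> ?\<phi> -` U)"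
      by (rule continuous_open_preimage[OF cont\<phi> smooth_structureD(2)[OF is_smooth_structure c(1)] U(1)])
    moreover have "W = fst c \<inter> ?\<phi> -` U" by (auto simp: W_def)
    ultimately show ?thesis by simp
  qed
  have chart_e: "is_chart e"
    unfolding is_chart_def
  proof (intro conjI exI)
    show "open (fst e)" "open (snd e ` fst e)" by (simp_all add: fst_e img_e opW op\<psi>U)
    show "homeomorphism (fst e) (snd e ` fst e) (snd e) (\<lambda>z. ?\<phi>' (\<psi>' z))"
      unfolding fst_e img_e
    proof (rule homeomorphismI)
      show "continuous_on W (snd e)"
        unfolding e_def snd_conv
        by (rule continuous_on_compose2[OF smooth_on_imp_continuous_on[OF sm\<psi>] continuous_on_subset[OF cont\<phi> W]])
           (simp add: \<phi>W)
      have img\<psi>': "\<psi>' ` \<psi> ` U \<subseteq> ?S" using inv U(3) by (auto simp: image_image)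
      show "continuous_on (\<psi> ` U) (\<lambda>z. ?\<phi>' (\<psi>' z))"
        by (rule continuous_on_compose2[OF is_chart_inv_continuous[OF ch] smooth_on_imp_continuous_on[OF sm\<psi>'] img\<psi>'])
      show "(\<lambda>z. ?\<phi>' (\<psi>' z)) ` (\<psi> ` U) \<subseteq> W"
        using inv inv\<phi> W by (auto simp flip: \<phi>W)
      show "snd e ` W \<subseteq> \<psi> ` U" by (simp add: img_e)
      show "?\<phi>' (\<psi>' (snd e q)) = q" if "q \<in> W" for q
        using inv[of "?\<phi> q"] inv\<phi>[of q] that by (simp add: W_def snd_e)
      show "snd e (?\<phi>' (\<psi>' z)) = z" if "z \<in> \<psi> ` U" for z
        using that inv inv\<phi> W by (auto simp: snd_e subset_iff simp flip: \<phi>W)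
    qed
  qed
  \<comment> \<open>Both transitions factor through \<open>c\<close>, so they are smooth because
    \<open>\<psi>\<close> and \<open>\<psi>'\<close> are.\<close>
  have compat: "smoothly_compatible e d" if d: "d \<in> A" for d
    unfolding smoothly_compatible_def
  proof
    note chd = smooth_structureD(1)[OF is_smooth_structure d]
    have opd: "open (fst d)" by (rule smooth_structureD(2)[OF is_smooth_structure d])
    let ?S1 = "snd e ` (fst e \<inter> fst d)" and ?S2 = "snd d ` (fst e \<inter> fst d)"
    have op1: "open ?S1" and op2: "open ?S2"
      using is_chart_open_image[OF chart_e, of "fst e \<inter> fst d"] is_chart_open_image[OF chd, of "fst e \<inter> fst d"]
        opW opd by (auto simp: fst_e)
    show "smooth_on ?S1 (transition e d)"
    proof (rule smooth_on_cong[OF op1])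
      show "smooth_on ?S1 (\<lambda>z. transition c d (\<psi>' z))"
      proof (rule smooth_on_compose[OF op1 smooth_structureD(3)[OF is_smooth_structure c(1) d]])
        show "smooth_on ?S1 \<psi>'"
          by (rule smooth_on_subset[OF sm\<psi>']) (auto simp: fst_e simp flip: img_e)
        show "\<psi>' ` ?S1 \<subseteq> ?\<phi> ` (fst c \<inter> fst d)"
          using inv by (auto simp: fst_e snd_e W_def)
      qed
      show "transition c d (\<psi>' z) = transition e d z" if z: "z \<in> ?S1" for z
      proof -
        obtain q where q: "q \<in> W" "z = snd e q" using z by (auto simp: fst_e)
        then have "\<psi>' z = ?\<phi> q" using inv by (simp add: snd_e W_def)
        then show ?thesis
          using transition_apply[OF ch, of q d] transition_apply[OF chart_e, of q d] q W by (auto simp: fst_e)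
      qed
    qed
    show "smooth_on ?S2 (transition d e)"
    proof (rule smooth_on_cong[OF op2])
      show "smooth_on ?S2 (\<lambda>z. \<psi> (transition d c z))"
      proof (rule smooth_on_compose[OF op2 sm\<psi>])
        show "smooth_on ?S2 (transition d c)"
          by (rule smooth_on_subset[OF smooth_structureD(3)[OF is_smooth_structure d c(1)]]) (use W in \<open>auto simp: fst_e\<close>)
        show "transition d c ` ?S2 \<subseteq> U"
          using transition_apply[OF chd, of _ c] by (auto simp: fst_e W_def)
      qed
      show "\<psi> (transition d c z) = transition d e z" if z: "z \<in> ?S2" for z
      proof -
        obtain q where q: "q \<in> W" "q \<in> fst d" "z = snd d q" using z by (auto simp: fst_e)
        then show ?thesis
          using transition_apply[OF chd, of q c] transition_apply[OF chd, of q e] by (simp add: snd_e)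
      qed
    qed
  qed
  have eA: "e \<in> A" by (rule smooth_structureD(5)[OF is_smooth_structure chart_e compat])
  define N where "N = {q \<in> W. snd e q \<in> E}"
  have slice: "slice_chart A N e E"
    unfolding slice_chart_def using eA E by (auto simp: N_def fst_e)
  have "image_distribution (m_tensor K \<alpha> \<beta> F) e z = complexify_subspace E" if zN: "z \<in> snd e ` (N \<inter> fst e)" for z
  proof -
    obtain q where q: "q \<in> W" "z = snd e q" "z \<in> E" using zN by (auto simp: N_def)
    have qc: "q \<in> fst c" and qe: "q \<in> fst e" using q(1) W by (auto simp: fst_e)
    define x where "x = ?\<phi> q"
    have xU: "x \<in> U" using q(1) by (simp add: W_def x_def)
    have z: "z = \<psi> x" using q(2) by (simp add: snd_e x_def)
    \<comment> \<open>Near \<open>x\<close> the transition from \<open>c\<close> to \<open>e\<close>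
      is \<open>\<psi>\<close> itself, so the tensor law describes \<open>F e\<close> through the
      derivative of \<open>\<psi>\<close>.\<close>
    have Dtr: "frechet_derivative (transition c e) (at x) = frechet_derivative \<psi> (at x)"
    proof (rule frechet_derivative_transform_within_open[OF _ U(1) xU, symmetric])
      show "\<psi> differentiable at x"
        using smooth_on_has_derivative[OF sm\<psi> xU] by (auto simp: differentiable_def)
      fix x' assume "x' \<in> U"
      then obtain q' where "q' \<in> W" "x' = ?\<phi> q'" by (auto simp flip: \<phi>W)
      then show "\<psi> x' = transition c e x'"
        using transition_apply[OF ch, of q' e] W by (auto simp: snd_e)
    qed
    \<comment> \<open>The kernel in the new chart is the pushforward of the old one, and
      \<open>D\<psi>\<close> identifies that pushforward with \<open>E\<close> at each point of the
      slice.\<close>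
    have ker: "{v. F e z v = 0} = frechet_derivative \<psi> (at x) ` {v. F c x v = 0}"
    proof (intro equalityI subsetI)
      fix v assume "v \<in> frechet_derivative \<psi> (at x) ` {v. F c x v = 0}"
      then show "v \<in> {v. F e z v = 0}"
        using F_transition[OF c(1) eA qc qe] q(2) Dtr
          linear_0[OF has_derivative_linear[OF smooth_on_has_derivative[OF sm\<psi> xU]]]
        by (auto simp flip: x_def)
    next
      fix v assume v: "v \<in> {v. F e z v = 0}"
      let ?D' = "frechet_derivative (transition e c) (at z)"
      have "F c x (?D' v) = ?D' (F e z v)"
        using F_transition[OF eA c(1) qe qc] q(2) by (simp add: x_def)
      also have "\<dots> = 0"
        using v linear_0[OF has_derivative_linear[OF smooth_on_has_derivative[OF
              smooth_structureD(3)[OF is_smooth_structure eA c(1)]]]] q(2) qe qc by auto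
      finally have "F c x (?D' v) = 0" .
      moreover have "frechet_derivative \<psi> (at x) (?D' v) = v"
        using transition_derivative_inverse[OF is_smooth_structure eA c(1) qe qc, of v] q(2) Dtr by (simp add: x_def)
      ultimately show "v \<in> frechet_derivative \<psi> (at x) ` {v. F c x v = 0}" by (metis (mono_tags) image_eqI mem_Collect_eq)
    qed
    have "z \<in> snd e ` fst e" using q(2) qe by blast
    then show ?thesis
      using image_m_tensor[OF eA] ker D\<psi>[OF xU] q(3) z by simp
  qed
  then have DN: "\<forall>z\<in>snd e ` (N \<inter> fst e). image_distribution (m_tensor K \<alpha> \<beta> F) e z = complexify_subspace E"
    by blast
  have pN: "p \<in> N" using pW \<psi>p by (simp add: N_def snd_e)
  have "\<exists>c V. slice_chart A N c V \<and> q \<in> fst c \<and>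
      (\<forall>x\<in>snd c ` (N \<inter> fst c). image_distribution (m_tensor K \<alpha> \<beta> F) c x = complexify_subspace V)"
    if "q \<in> N" for q
    by (intro exI[of _ e] exI[of _ E] conjI slice DN) (use that in \<open>simp add: N_def fst_e\<close>)
  then have "integral_manifold A (image_distribution (m_tensor K \<alpha> \<beta> F)) N"
    unfolding integral_manifold_def using pN by blast
  then show "\<exists>N. p \<in> N \<and> integral_manifold A (image_distribution (m_tensor K \<alpha> \<beta> F)) N"
    using pN by blast
qed

lemma integrable_iff_symmetric:
  "integrable_distribution A (image_distribution (m_tensor K \<alpha> \<beta> F)) \<longleftrightarrow> symmetric_on_kernel"
  using integrable_imp_symmetric symmetric_imp_integrable by blast

end

theorem theorem5p7:
  fixes A :: "('a::{t2_space,second_countable_topology}, 'n::finite) chart set"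
    and F :: "('a, 'n) tfield" and K r :: nat and \<alpha> \<beta> :: complex
    and l m :: "('a, 'n) ctfield"
  assumes "K \<ge> 3"
    and "F_structure A K \<alpha> \<beta> r F"
  defines "l \<equiv> l_tensor K \<alpha> \<beta> F"
    and "m \<equiv> m_tensor K \<alpha> \<beta> F"
  shows "(integrable_distribution A (image_distribution m) \<longleftrightarrow>
          (\<forall>X Y. smooth_vector_field A X \<and> smooth_vector_field A Y \<longrightarrow>
             vanishes A (nijenhuis l (apply_tensor m (complexify_vfield X))
                           (apply_tensor m (complexify_vfield Y))))) \<and>
         (integrable_distribution A (image_distribution m) \<longleftrightarrow>
          (\<forall>X Y. smooth_vector_field A X \<and> smooth_vector_field A Y \<longrightarrow>
             vanishes A (nijenhuis (complexify_tfield F) (apply_tensor m (complexify_vfield X))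
                           (apply_tensor m (complexify_vfield Y))))) \<and>
         (integrable_distribution A (image_distribution m) \<longleftrightarrow>
          (\<forall>X Y. smooth_vector_field A X \<and> smooth_vector_field A Y \<longrightarrow>
             vanishes A (apply_tensor l (nijenhuis (complexify_tfield F) (apply_tensor m (complexify_vfield X))
                           (apply_tensor m (complexify_vfield Y))))))"
proof -
  interpret f_structure A F K r \<alpha> \<beta> by (rule f_structure.intro[OF assms(1,2)])
  let ?mX = "\<lambda>X. apply_tensor m (complexify_vfield X)"
  have 1: "nijenhuis l (?mX X) (?mX Y) c x = 0 \<longleftrightarrow> F c x (m_bracket X Y c x) = 0"
    and 2: "nijenhuis (complexify_tfield F) (?mX X) (?mX Y) c x = 0 \<longleftrightarrow> F c x (m_bracket X Y c x) = 0"
    and 3: "apply_tensor l (nijenhuis (complexify_tfield F) (?mX X) (?mX Y)) c x = 0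
      \<longleftrightarrow> F c x (m_bracket X Y c x) = 0"
    if XY: "smooth_vector_field A X" "smooth_vector_field A Y" and cx: "c \<in> A" "x \<in> snd c ` fst c" for X Y c x
  proof -
    let ?b = "m_bracket X Y c x"
    have L: "nijenhuis l (?mX X) (?mX Y) c x
        = cvec ((?b - m_real c x ?b) - m_real c x (?b - m_real c x ?b))"
      unfolding l_def m_def
      by (rule nijenhuis_m[where t = "\<lambda>y u. u - m_real c y u", OF XY cx])
         (auto simp: l_tensor_cvec[OF cx(1)] m_real_self[OF cx(1)])
    \<comment> \<open>The outer \<open>l\<close> vanishes exactly when \<open>F\<close> kills
      \<open>?b - m_real c x ?b\<close>, and \<open>F\<close> does not see the subtracted
      part.\<close>
    show "nijenhuis l (?mX X) (?mX Y) c x = 0 \<longleftrightarrow> F c x ?b = 0"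
      unfolding L cvec_eq_0_iff l_eq_0_iff[OF cx]
      by (simp add: linear_diff[OF linear_F[OF cx]] F_m_real[OF cx])
    have N: "nijenhuis (complexify_tfield F) (?mX X) (?mX Y) c x = cvec (F c x (F c x ?b))"
      unfolding m_def
      by (rule nijenhuis_m[where t = "F c", OF XY cx]) (auto simp: complexify_tfield_cvec linear_F[OF cx(1)])
    then show "nijenhuis (complexify_tfield F) (?mX X) (?mX Y) c x = 0 \<longleftrightarrow> F c x ?b = 0"
      by (simp add: F_square_eq_0_iff[OF cx])
    have lN: "apply_tensor l (nijenhuis (complexify_tfield F) (?mX X) (?mX Y)) c x = l c x (cvec (F c x (F c x ?b)))"
      unfolding apply_tensor_def[of l] N ..
    \<comment> \<open>Here \<open>l\<close> tests whether the third power of \<open>F c x\<close>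
      kills \<open>?b\<close>; cancelling twice by \<open>F_square_eq_0_iff\<close> brings this down
      to the first power.\<close>
    show "apply_tensor l (nijenhuis (complexify_tfield F) (?mX X) (?mX Y)) c x = 0 \<longleftrightarrow> F c x ?b = 0"
      unfolding lN unfolding l_def l_tensor_cvec[OF cx] cvec_eq_0_iff l_eq_0_iff[OF cx]
      by (simp add: F_square_eq_0_iff[OF cx])
  qed
  \<comment> \<open>All three expressions vanish exactly where
    \<open>F c x (m_bracket X Y c x)\<close> does, so one argument over an abstract \<open>N\<close>
    settles the three equivalences.\<close>
  have equiv: "integrable_distribution A (image_distribution m) \<longleftrightarrow>
      (\<forall>X Y. smooth_vector_field A X \<and> smooth_vector_field A Y \<longrightarrow> vanishes A (N X Y))"
    if N: "\<And>X Y c x. smooth_vector_field A X \<Longrightarrow> smooth_vector_field A Y \<Longrightarrow> c \<in> A \<Longrightarrow> x \<in> snd c ` fst c \<Longrightarrow>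
      N X Y c x = 0 \<longleftrightarrow> F c x (m_bracket X Y c x) = 0" for N :: "('a, 'n) vfield \<Rightarrow> ('a, 'n) vfield \<Rightarrow> ('a, 'n) cvfield"
  proof -
    have "(\<forall>X Y. smooth_vector_field A X \<and> smooth_vector_field A Y \<longrightarrow> vanishes A (N X Y)) \<longleftrightarrow> symmetric_on_kernel"
      unfolding vanishes_def F_m_bracket_eq_0_iff[symmetric]
      by (intro all_cong1 imp_cong ball_cong refl) (elim conjE; rule N)
    then show ?thesis unfolding m_def integrable_iff_symmetric by simp
  qed
  show ?thesis by (intro conjI equiv 1 2 3)
qed

end
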